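(* Let $G$ be a hyperbolic group. Then the subset sum problem $\mathbf{SSP}(G)$ is in $\mathbf{P}$, i.e., it is decidable by an algorithm running in time polynomial in the size of the input.
   Context: Fix a finite generating set $X$ of $G$ (the complexity of the problem does not depend on this choice up to polynomial-time equivalence). Elements of $G$ are given as words over $X\cup X^{-1}$, and the size of a tuple of words is the sum of their lengths. The subset sum problem $\mathbf{SSP}(G)$: given $g_1,\ldots,g_k,g\in G$, decide whether $g=g_1^{\varepsilon_1}\cdots g_k^{\varepsilon_k}$ in $G$ for some $\varepsilon_1,\ldots,\varepsilon_k\in\{0,1\}$. The group $G$ is fixed (not part of the input). *)

theory Defs
  imports "HOL-Algebra.Generated_Groups" "HOL-Computational_Algebra.Polynomial"
begin

section \<open>Words over a generating set\<close>

text \<open>The letter \<open>(x, True)\<close> stands for \<open>x\<close> and \<open>(x, False)\<close> for the formal inverse of \<open>x\<close>.\<close>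

type_synonym 'a letter = "'a \<times> bool"
type_synonym 'a word = "'a letter list"

definition words :: "'a set \<Rightarrow> 'a word set" where
  "words X = lists (X \<times> UNIV)"

definition letter_val :: "('a, 'm) monoid_scheme \<Rightarrow> 'a letter \<Rightarrow> 'a" where
  "letter_val G l = (if snd l then fst l else inv\<^bsub>G\<^esub> (fst l))"

definition list_prod :: "('a, 'm) monoid_scheme \<Rightarrow> 'a list \<Rightarrow> 'a" where
  "list_prod G xs = foldr (\<lambda>x y. x \<otimes>\<^bsub>G\<^esub> y) xs \<one>\<^bsub>G\<^esub>"

definition word_val :: "('a, 'm) monoid_scheme \<Rightarrow> 'a word \<Rightarrow> 'a" where
  "word_val G w = list_prod G (map (letter_val G) w)"

definition finite_generating_set :: "('a, 'm) monoid_scheme \<Rightarrow> 'a set \<Rightarrow> bool" where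
  "finite_generating_set G X \<longleftrightarrow> finite X \<and> X \<subseteq> carrier G \<and> generate G X = carrier G"


section \<open>Hyperbolic groups\<close>

definition word_metric :: "('a, 'm) monoid_scheme \<Rightarrow> 'a set \<Rightarrow> 'a \<Rightarrow> 'a \<Rightarrow> nat" where
  "word_metric G X x y =
     (LEAST n. \<exists>w \<in> words X. length w = n \<and> word_val G w = inv\<^bsub>G\<^esub> x \<otimes>\<^bsub>G\<^esub> y)"

definition gromov_product :: "('a \<Rightarrow> 'a \<Rightarrow> nat) \<Rightarrow> 'a \<Rightarrow> 'a \<Rightarrow> 'a \<Rightarrow> real" where
  "gromov_product d e x y = (real (d x e) + real (d y e) - real (d x y)) / 2"

text \<open>Gromov's definition of a \<open>\<delta>\<close>-hyperbolic metric space \<open>(S, d)\<close>; it needs no geodesics, so it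
  applies to the group itself with its word metric.\<close>

definition gromov_hyperbolic :: "real \<Rightarrow> 'a set \<Rightarrow> ('a \<Rightarrow> 'a \<Rightarrow> nat) \<Rightarrow> bool" where
  "gromov_hyperbolic \<delta> S d \<longleftrightarrow>
     (\<forall>e \<in> S. \<forall>x \<in> S. \<forall>y \<in> S. \<forall>z \<in> S.
        gromov_product d e x z \<ge> min (gromov_product d e x y) (gromov_product d e y z) - \<delta>)"

text \<open>Whether a suitable \<open>\<delta>\<close> exists does not depend on the finite generating set.\<close>

definition hyperbolic_group :: "('a, 'm) monoid_scheme \<Rightarrow> bool" where
  "hyperbolic_group G \<longleftrightarrow> group G \<and>
     (\<exists>Y \<delta>. finite_generating_set G Y \<and> \<delta> \<ge> 0 \<and>
        gromov_hyperbolic \<delta> (carrier G) (word_metric G Y))"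


section \<open>Polynomial time on deterministic multitape Turing machines\<close>

text \<open>Tape symbols of a machine whose input symbols have type \<open>'b\<close>.\<close>

datatype 'b tsym = Blank | Input 'b | Work nat

datatype move = MoveL | Stay | MoveR

text \<open>States are the numbers below \<open>tm_states\<close>; 0 is the initial, 1 the accepting and 2 the
  rejecting state. Given a state and the symbols under the heads, the transition function yields
  the next state and, for each tape, the symbol to write and the head movement.\<close>

record 'b tm =
  tm_tapes :: nat
  tm_states :: nat
  tm_work :: nat
  tm_trans :: "nat \<Rightarrow> 'b tsym list \<Rightarrow> nat \<times> ('b tsym \<times> move) list"

definition tape_alphabet :: "'b set \<Rightarrow> 'b tm \<Rightarrow> 'b tsym set" where
  "tape_alphabet A M = {Blank} \<union> Input ` A \<union> Work ` {..<tm_work M}"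

definition turing_machine :: "'b set \<Rightarrow> 'b tm \<Rightarrow> bool" where
  "turing_machine A M \<longleftrightarrow> finite A \<and> tm_tapes M \<ge> 1 \<and> tm_states M \<ge> 3 \<and>
     (\<forall>q < tm_states M. \<forall>ss \<in> lists (tape_alphabet A M). length ss = tm_tapes M \<longrightarrow>
        fst (tm_trans M q ss) < tm_states M \<and>
        length (snd (tm_trans M q ss)) = tm_tapes M \<and>
        snd (tm_trans M q ss) \<in> lists (tape_alphabet A M \<times> UNIV))"

text \<open>Tapes are infinite in both directions: cell contents together with the head position.\<close>

type_synonym 'b tape = "(int \<Rightarrow> 'b tsym) \<times> int"
type_synonym 'b config = "nat \<times> 'b tape list"

definition move_offset :: "move \<Rightarrow> int" where
  "move_offset m = (case m of MoveL \<Rightarrow> - 1 | Stay \<Rightarrow> 0 | MoveR \<Rightarrow> 1)"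

definition tape_read :: "'b tape \<Rightarrow> 'b tsym" where
  "tape_read t = fst t (snd t)"

definition tape_act :: "'b tape \<Rightarrow> 'b tsym \<times> move \<Rightarrow> 'b tape" where
  "tape_act t a = ((fst t)(snd t := fst a), snd t + move_offset (snd a))"

definition tm_step :: "'b tm \<Rightarrow> 'b config \<Rightarrow> 'b config" where
  "tm_step M c =
     (if fst c \<in> {1, 2} then c
      else let (q, as) = tm_trans M (fst c) (map tape_read (snd c))
           in (q, map2 tape_act (snd c) as))"

definition blank_tape :: "'b tape" where
  "blank_tape = (\<lambda>_. Blank, 0)"

definition input_tape :: "'b list \<Rightarrow> 'b tape" where
  "input_tape x =
     (\<lambda>i. if 0 \<le> i \<and> i < int (length x) then Input (x ! nat i) else Blank, 0)"

definition tm_init :: "'b tm \<Rightarrow> 'b list \<Rightarrow> 'b config" where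
  "tm_init M x = (0, input_tape x # replicate (tm_tapes M - 1) blank_tape)"

definition decides_in_time :: "'b set \<Rightarrow> 'b tm \<Rightarrow> 'b list set \<Rightarrow> (nat \<Rightarrow> nat) \<Rightarrow> bool" where
  "decides_in_time A M L T \<longleftrightarrow>
     (\<forall>x \<in> lists A. \<exists>t \<le> T (length x).
        fst ((tm_step M ^^ t) (tm_init M x)) = (if x \<in> L then 1 else 2))"

definition class_P :: "'b set \<Rightarrow> 'b list set set" where
  "class_P A = {L. L \<subseteq> lists A \<and>
     (\<exists>M (p :: nat poly). turing_machine A M \<and> decides_in_time A M L (poly p))}"


section \<open>The subset sum problem\<close>

definition subset_sum :: "('a, 'm) monoid_scheme \<Rightarrow> 'a list \<Rightarrow> 'a \<Rightarrow> bool" where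
  "subset_sum G gs g \<longleftrightarrow>
     (\<exists>\<epsilon> :: nat \<Rightarrow> nat. (\<forall>i < length gs. \<epsilon> i \<in> {0, 1}) \<and>
        g = list_prod G (map (\<lambda>i. (gs ! i) [^]\<^bsub>G\<^esub> \<epsilon> i) [0..<length gs]))"

text \<open>An instance is written on the tape as its words \<open>u\<^sub>1, \<dots>, u\<^sub>k, u\<close>, each followed by the
  separator \<open>None\<close>. Its length is the sum of the lengths of the words plus \<open>k + 1\<close>; the
  summand \<open>k + 1\<close> matters only for tuples containing empty words.\<close>

definition ssp_alphabet :: "'a set \<Rightarrow> 'a letter option set" where
  "ssp_alphabet X = insert None (Some ` (X \<times> UNIV))"

definition encode_tuple :: "'a word list \<Rightarrow> 'a letter option list" where
  "encode_tuple us = concat (map (\<lambda>u. map Some u @ [None]) us)"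

definition SSP :: "('a, 'm) monoid_scheme \<Rightarrow> 'a set \<Rightarrow> 'a letter option list set" where
  "SSP G X = {encode_tuple (us @ [u]) | us u.
     us \<in> lists (words X) \<and> u \<in> words X \<and>
     subset_sum G (map (word_val G) us) (word_val G u)}"

end

theory Submission
  imports Defs
begin

text \<open>Turn an instance \<open>u\<^sub>1, \<dots>, u\<^sub>k, u\<close> into a finite acyclic graph with edges labelled by group elements, in
  which a fixed pair of nodes is joined by a path of value \<open>1\<close> iff the instance is positive. Let the
  digits be the elements of a large enough fixed ball, and consider pairs \<open>(p, v)\<close> of a node and a word
  of at most logarithmic length over the digits; there are only polynomially many. Saturate the relation
  ``some path from \<open>p\<close> to \<open>q\<close> has value \<open>v w\<^sup>-\<^sup>1\<close>'' between such pairs \<open>(p, v)\<close> and \<open>(q, w)\<close> under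
  transitivity, simultaneous appending and removal of a digit, and the multiplication table of the ball.

  Saturation finds every closed path: the points of a closed path with \<open>n\<close> steps are, up to an error
  \<open>O(log n)\<close>, points of a tree, and a closed path in a tree can be cut by a short chord, then both parts
  again by short chords, down to single steps. Chords thus have logarithmic length, and two adjacent
  chords are replaced by the third side of their triangle with the multiplication table, because
  geodesics with close endpoints fellow-travel in a hyperbolic group.

  The saturation is written in a small imperative language over unary registers and one bit array,
  which is compiled to Turing machines with a quadratic slowdown.\<close>

section \<open>Synchronous tape programs and their realisation by Turing machines\<close>

section \<open>Structured tape programs\<close>

text \<open>The reachable group elements may be too many to be listed, and short words are not
  unique names for them; so nothing is normalised, and the relation itself must come to identify
  short words with the same value. Chords are logarithmic because the graph is acyclic, which bounds
  a path by the number of nodes, and because the tree metric costs only the logarithm of that bound;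
  hence polynomially many words over a fixed alphabet suffice. The target is moved to the other side
  by reading the last word backwards with inverted letters, so that equality becomes value 1.

  Soundness and completeness need different views of the rules. The relation meant by actual paths
  is closed under the rules for all numbers, so a run starting inside it never leaves it, however
  far the entries reach. Completeness may use the rules only for numbers below \<open>V\<close>;
  every word in the argument must fit there, and this bookkeeping dictates the exponent of
  \<open>V\<close>.\<close>

datatype 'b tcom =
    TSkip
  | TAct "nat \<Rightarrow> bool option" move
  | TSeq "'b tcom" "'b tcom"
  | TIf "'b tsym list \<Rightarrow> bool" "'b tcom" "'b tcom"
  | TWhile "'b tsym list \<Rightarrow> bool" "'b tcom"

text \<open>All heads move in the same direction in every step, so that they always stand at one common
  position.\<close>

type_synonym 'b sconf = "(nat \<Rightarrow> int \<Rightarrow> 'b tsym) \<times> int"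

fun wsym :: "bool option \<Rightarrow> 'b tsym \<Rightarrow> 'b tsym" where
  "wsym None s = s"
| "wsym (Some True) s = Work 0"
| "wsym (Some False) s = Blank"

text \<open>The residual program is the control state. Unfolding a sequence, a conditional or a loop
  costs one step in which the heads stay and nothing is written.\<close>

fun tnext :: "'b tcom \<Rightarrow> 'b tsym list \<Rightarrow> 'b tcom \<times> (nat \<Rightarrow> bool option) \<times> move" where
  "tnext TSkip ss = (TSkip, (\<lambda>_. None), Stay)"
| "tnext (TAct w m) ss = (TSkip, w, m)"
| "tnext (TSeq c d) ss =
     (if c = TSkip then (d, (\<lambda>_. None), Stay)
      else (TSeq (fst (tnext c ss)) d, snd (tnext c ss)))"
| "tnext (TIf p c d) ss = (if p ss then c else d, (\<lambda>_. None), Stay)"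
| "tnext (TWhile p c) ss =
     (if p ss then TSeq c (TWhile p c) else TSkip, (\<lambda>_. None), Stay)"

text \<open>An upper bound for the residuals of a program, by recursion on the syntax: unfolding a
  loop enlarges the term, yet the residuals of the unfolded body return to the loop itself, so
  finitely many suffice.\<close>

fun tderivs :: "'b tcom \<Rightarrow> 'b tcom set" where
  "tderivs TSkip = {TSkip}"
| "tderivs (TAct w m) = {TAct w m, TSkip}"
| "tderivs (TSeq c d) = (\<lambda>c'. TSeq c' d) ` tderivs c \<union> tderivs d"
| "tderivs (TIf p c d) = insert (TIf p c d) (tderivs c \<union> tderivs d)"
| "tderivs (TWhile p c) =
     {TWhile p c, TSkip} \<union> (\<lambda>c'. TSeq c' (TWhile p c)) ` tderivs c"

lemma finite_tderivs: "finite (tderivs c)"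
  by (induction c) auto

lemma tderivs_self: "c \<in> tderivs c"
  by (induction c) auto

lemma tderivs_TSkip: "TSkip \<in> tderivs c"
  by (induction c) auto

lemma tderivs_closed: "d \<in> tderivs c \<Longrightarrow> fst (tnext d ss) \<in> tderivs c"
proof (induction c arbitrary: d)
  case (TSeq c1 c2)
  then show ?case using tderivs_self by fastforce
next
  case (TIf p c1 c2)
  then show ?case using tderivs_self[of c1] tderivs_self[of c2] by auto
next
  case (TWhile p c)
  then show ?case using tderivs_self[of c] by fastforce
qed auto

definition reads :: "nat \<Rightarrow> 'b sconf \<Rightarrow> 'b tsym list" where
  "reads k s = map (\<lambda>j. fst s j (snd s)) [0..<k]"

definition sact :: "(nat \<Rightarrow> bool option) \<Rightarrow> move \<Rightarrow> 'b sconf \<Rightarrow> 'b sconf" where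
  "sact w m s = ((\<lambda>j. (fst s j)(snd s := wsym (w j) (fst s j (snd s)))), snd s + move_offset m)"

definition tstep :: "nat \<Rightarrow> 'b tcom \<times> 'b sconf \<Rightarrow> 'b tcom \<times> 'b sconf \<Rightarrow> bool" where
  "tstep k x y \<longleftrightarrow> fst x \<noteq> TSkip \<and>
     (case tnext (fst x) (reads k (snd x)) of (c, w, m) \<Rightarrow> y = (c, sact w m (snd x)))"

abbreviation tsteps :: "nat \<Rightarrow> nat \<Rightarrow> 'b tcom \<times> 'b sconf \<Rightarrow> 'b tcom \<times> 'b sconf \<Rightarrow> bool" where
  "tsteps k n \<equiv> tstep k ^^ n"

lemma sact_nop [simp]: "sact (\<lambda>_. None) Stay s = s"
  by (simp add: sact_def move_offset_def)

lemma tstep_TSeq: "tstep k (c, s) (c', s') \<Longrightarrow> tstep k (TSeq c d, s) (TSeq c' d, s')"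
  by (auto simp: tstep_def split: prod.splits)

lemma tsteps_TSeq_left:
  "tsteps k n (c, s) (c', s') \<Longrightarrow> tsteps k n (TSeq c d, s) (TSeq c' d, s')"
proof (induction n arbitrary: c' s')
  case (Suc n)
  then obtain c1 s1 where "tsteps k n (c, s) (c1, s1)" "tstep k (c1, s1) (c', s')"
    by auto
  then show ?case by (intro relpowp_Suc_I[OF Suc.IH tstep_TSeq])
qed auto

lemma tsteps_trans: "tsteps k n x y \<Longrightarrow> tsteps k m y z \<Longrightarrow> tsteps k (n + m) x z"
  by (auto simp: relpowp_add)

definition trun :: "nat \<Rightarrow> 'b tcom \<Rightarrow> 'b sconf \<Rightarrow> nat \<Rightarrow> 'b sconf \<Rightarrow> bool" where
  "trun k c s t s' \<longleftrightarrow> (\<exists>n\<le>t. tsteps k n (c, s) (TSkip, s'))"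

lemma trun_mono: "trun k c s t s' \<Longrightarrow> t \<le> t' \<Longrightarrow> trun k c s t' s'"
  unfolding trun_def using le_trans by blast

lemma trun_TSkip: "trun k TSkip s t s"
  unfolding trun_def by (auto intro: exI[of _ 0])

lemma trun_TAct: "trun k (TAct w m) s 1 (sact w m s)"
  unfolding trun_def by (rule exI[of _ 1]) (simp add: tstep_def eq_OO)

lemma trun_step: "tstep k (c, s) (c', s1) \<Longrightarrow> trun k c' s1 t s' \<Longrightarrow> trun k c s (Suc t) s'"
  unfolding trun_def by (meson Suc_le_mono relpowp_Suc_I2)

lemma trun_TSeq:
  assumes "trun k c s t1 s1" "trun k d s1 t2 s2"
  shows "trun k (TSeq c d) s (t1 + t2 + 1) s2"
proof -
  from assms obtain n m where nm: "n \<le> t1" "m \<le> t2" "tsteps k n (c, s) (TSkip, s1)"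
    "tsteps k m (d, s1) (TSkip, s2)" unfolding trun_def by blast
  have "tsteps k n (TSeq c d, s) (TSeq TSkip d, s1)" using tsteps_TSeq_left nm by blast
  moreover have "tsteps k (Suc m) (TSeq TSkip d, s1) (TSkip, s2)"
    by (rule relpowp_Suc_I2[OF _ nm(4)]) (simp add: tstep_def)
  ultimately have "tsteps k (n + Suc m) (TSeq c d, s) (TSkip, s2)" by (rule tsteps_trans)
  then show ?thesis unfolding trun_def using nm by (intro exI[of _ "n + Suc m"]) auto
qed

lemma trun_TIf:
  assumes "trun k (if p (reads k s) then c else d) s t s'"
  shows "trun k (TIf p c d) s (t + 1) s'"
  using trun_step[OF _ assms] by (simp add: tstep_def)

lemma trun_TWhile_False:
  assumes "\<not> p (reads k s)" "1 \<le> t"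
  shows "trun k (TWhile p c) s t s"
  using trun_step[OF _ trun_TSkip[of k s "t - 1"], of "TWhile p c" s] assms
  by (simp add: tstep_def)

lemma trun_TWhile_True:
  assumes "p (reads k s)" "trun k c s t1 s1" "trun k (TWhile p c) s1 t2 s2"
  shows "trun k (TWhile p c) s (t1 + t2 + 2) s2"
  using trun_step[OF _ trun_TSeq[OF assms(2,3)], of "TWhile p c" s] assms(1)
  by (simp add: tstep_def)

text \<open>The states of the machine are the finitely many commands reachable from \<open>c\<close>, numbered so that
  \<open>c\<close> is the initial state and the accepting and the rejecting state are avoided.\<close>

lemma tcom_numbering:
  obtains e :: "'b tcom \<Rightarrow> nat" where "inj_on e (tderivs c)" "e c = 0"
    "\<And>d. d \<in> tderivs c \<Longrightarrow> e d < card (tderivs c) + 3"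
    "\<And>d. d \<in> tderivs c \<Longrightarrow> e d \<notin> {1, 2}"
proof -
  obtain f where f: "bij_betw f (tderivs c) {0..<card (tderivs c)}"
    using ex_bij_betw_finite_nat[OF finite_tderivs] by blast
  define e where "e d = (if d = c then 0 else f d + 3)" for d
  have "inj_on e (tderivs c)"
    using f unfolding e_def inj_on_def bij_betw_def by auto
  moreover have "e d < card (tderivs c) + 3" if "d \<in> tderivs c" for d
    using f that unfolding e_def bij_betw_def by auto
  ultimately show ?thesis using that[of e] by (auto simp: e_def)
qed

definition conf_tapes :: "nat \<Rightarrow> 'b sconf \<Rightarrow> 'b tape list" where
  "conf_tapes k s = map (\<lambda>j. (fst s j, snd s)) [0..<k]"

definition init_sconf :: "'b list \<Rightarrow> 'b sconf" where
  "init_sconf x = ((\<lambda>j. if j = 0 then fst (input_tape x) else (\<lambda>_. Blank)), 0)"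

lemma conf_tapes_init:
  assumes "k \<ge> 1"
  shows "conf_tapes k (init_sconf x) = input_tape x # replicate (k - 1) blank_tape"
  using assms
  by (intro nth_equalityI)
    (auto simp: conf_tapes_def init_sconf_def blank_tape_def input_tape_def nth_Cons
      split: nat.splits)

lemma conf_tapes_sact:
  "map2 tape_act (conf_tapes k s) (map2 (\<lambda>j a. (wsym (w j) a, m)) [0..<k] (reads k s))
     = conf_tapes k (sact w m s)"
  by (intro nth_equalityI) (auto simp: conf_tapes_def sact_def reads_def tape_act_def)

lemma reads_conf_tapes: "map tape_read (conf_tapes k s) = reads k s"
  by (simp add: conf_tapes_def reads_def tape_read_def)

text \<open>The extra step beyond the run is the one in which the terminated program, still a proper
  state, evaluates \<open>acc\<close> on the symbols under the heads and enters state 1 or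
  2.\<close>

theorem tcom_turing_machine:
  fixes c :: "'b tcom" and acc :: "'b tsym list \<Rightarrow> bool"
  assumes "finite A" "k \<ge> 1"
  obtains M :: "'b tm" where "turing_machine A M"
    "\<And>x t s. trun k c (init_sconf x) t s \<Longrightarrow>
       \<exists>t'\<le>Suc t. fst ((tm_step M ^^ t') (tm_init M x)) = (if acc (reads k s) then 1 else 2)"
proof -
  obtain e where e: "inj_on e (tderivs c)" "e c = 0"
    "\<And>d. d \<in> tderivs c \<Longrightarrow> e d < card (tderivs c) + 3"
    "\<And>d. d \<in> tderivs c \<Longrightarrow> e d \<notin> {1, 2}" using tcom_numbering[of c] by blast
  \<comment> \<open>States outside the image of \<open>e\<close>, in particular 1 and 2, are decoded
    as \<open>TSkip\<close>, because \<open>turing_machine\<close> asks for well-formed transitions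
    from every state.\<close>
  define dec where "dec q = (if q \<in> e ` tderivs c then inv_into (tderivs c) e q else TSkip)" for q
  have dec_in: "dec q \<in> tderivs c" for q
    unfolding dec_def by (auto simp: tderivs_TSkip inv_into_into)
  have dec_e: "dec (e d) = d" if "d \<in> tderivs c" for d
    using that e(1) unfolding dec_def by auto
  define tr where "tr q ss = (if dec q = TSkip
      then (if acc ss then 1 else 2, map (\<lambda>a. (a, Stay)) ss)
      else case tnext (dec q) ss of (d, w, m) \<Rightarrow>
        (e d, map2 (\<lambda>j a. (wsym (w j) a, m)) [0..<k] ss))" for q ss
  define M where "M = \<lparr>tm_tapes = k, tm_states = card (tderivs c) + 3, tm_work = 1, tm_trans = tr\<rparr>"
  have wsym_in: "wsym w a \<in> tape_alphabet A M" if "a \<in> tape_alphabet A M" for w a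
    using that by (cases "(w, a)" rule: wsym.cases) (auto simp: tape_alphabet_def M_def)
  have "turing_machine A M"
    unfolding turing_machine_def
  proof (intro conjI allI impI ballI)
    fix q ss assume ss: "ss \<in> lists (tape_alphabet A M)" "length ss = tm_tapes M"
    obtain d w m where dwm: "tnext (dec q) ss = (d, w, m)" by (metis prod_cases3)
    have d: "d \<in> tderivs c" using tderivs_closed[OF dec_in, of q ss] dwm by simp
    show "fst (tm_trans M q ss) < tm_states M"
      using e(3)[OF d] dwm by (simp add: M_def tr_def)
    show "length (snd (tm_trans M q ss)) = tm_tapes M"
      using dwm ss by (simp add: M_def tr_def)
    show "snd (tm_trans M q ss) \<in> lists (tape_alphabet A M \<times> UNIV)"
    proof (cases "dec q = TSkip")
      case True
      then show ?thesis using ss by (auto simp: M_def tr_def)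
    next
      case False
      have "snd (tm_trans M q ss) = map2 (\<lambda>j a. (wsym (w j) a, m)) [0..<k] ss"
        using False dwm by (simp add: M_def tr_def)
      then show ?thesis using ss(1) wsym_in
        by (auto simp: in_set_zip in_lists_conv_set)
    qed
  qed (use assms in \<open>auto simp: M_def\<close>)
  moreover have "\<exists>t'\<le>Suc t. fst ((tm_step M ^^ t') (tm_init M x)) = (if acc (reads k s) then 1 else 2)"
    if run: "trun k c (init_sconf x) t s" for x t s
  proof -
    obtain n where n: "n \<le> t" "tsteps k n (c, init_sconf x) (TSkip, s)"
      using run unfolding trun_def by blast
    have sim: "d \<in> tderivs c \<and> (tm_step M ^^ j) (tm_init M x) = (e d, conf_tapes k s')"
      if "tsteps k j (c, init_sconf x) (d, s')" for j d s'
      using that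
    proof (induction j arbitrary: d s')
      case 0
      then show ?case using conf_tapes_init[OF assms(2), of x] e(2) tderivs_self[of c]
        by (auto simp: tm_init_def M_def)
    next
      case (Suc j)
      then obtain d1 s1 where 1: "tsteps k j (c, init_sconf x) (d1, s1)" "tstep k (d1, s1) (d, s')"
        by auto
      obtain w m where wm: "tnext d1 (reads k s1) = (d, w, m)" "s' = sact w m s1" "d1 \<noteq> TSkip"
        using 1(2) unfolding tstep_def by (auto split: prod.splits)
      have d1: "d1 \<in> tderivs c" "(tm_step M ^^ j) (tm_init M x) = (e d1, conf_tapes k s1)"
        using Suc.IH[OF 1(1)] by auto
      have "tm_step M (e d1, conf_tapes k s1) = (e d, conf_tapes k s')"
        using e(4)[OF d1(1)] dec_e[OF d1(1)] wm conf_tapes_sact[of k s1 w m]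
        by (simp add: tm_step_def M_def tr_def reads_conf_tapes)
      then show ?case using d1 tderivs_closed[OF d1(1), of "reads k s1"] wm by simp
    qed
    have "(tm_step M ^^ n) (tm_init M x) = (e TSkip, conf_tapes k s)" using sim[OF n(2)] by simp
    then have "fst ((tm_step M ^^ Suc n) (tm_init M x)) = (if acc (reads k s) then 1 else 2)"
      using e(4)[OF tderivs_TSkip] dec_e[OF tderivs_TSkip]
      by (simp add: tm_step_def M_def tr_def reads_conf_tapes)
    then show ?thesis using n(1) by (intro exI[of _ "Suc n"]) auto
  qed
  ultimately show ?thesis using that by blast
qed

section \<open>Unary registers with a bit array, and their compilation to tape programs\<close>

section \<open>Register programs\<close>

datatype 'b test = Less nat nat | Arr nat | Inp nat "'b tsym \<Rightarrow> bool"

text \<open>The array has no command that clears a cell: saturation only ever adds pairs.\<close>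

datatype 'b com =
    Skip
  | Inc nat
  | Zero nat
  | SetA nat
  | Seq "'b com" "'b com" (infixr ";;" 60)
  | If "'b test" "'b com" "'b com"
  | While "'b test" "'b com"

text \<open>The registers and the set of marked cells of one unbounded bit array.\<close>

type_synonym state = "(nat \<Rightarrow> nat) \<times> nat set"

fun test_val :: "'b list \<Rightarrow> 'b test \<Rightarrow> state \<Rightarrow> bool" where
  "test_val x (Less r q) s \<longleftrightarrow> fst s r < fst s q"
| "test_val x (Arr r) s \<longleftrightarrow> fst s r \<in> snd s"
| "test_val x (Inp r P) s \<longleftrightarrow> P (fst (input_tape x) (int (fst s r)))"

inductive exec :: "'b list \<Rightarrow> 'b com \<Rightarrow> state \<Rightarrow> nat \<Rightarrow> state \<Rightarrow> bool" for x where
  "exec x Skip s 1 s"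
| "exec x (Inc r) (R, A) 1 (R(r := Suc (R r)), A)"
| "exec x (Zero r) (R, A) 1 (R(r := 0), A)"
| "exec x (SetA r) (R, A) 1 (R, insert (R r) A)"
| "exec x c s t1 s1 \<Longrightarrow> exec x d s1 t2 s2 \<Longrightarrow> exec x (c ;; d) s (t1 + t2 + 1) s2"
| "exec x (if test_val x b s then c else d) s t s1 \<Longrightarrow> exec x (If b c d) s (t + 1) s1"
| "\<not> test_val x b s \<Longrightarrow> exec x (While b c) s 1 s"
| "test_val x b s \<Longrightarrow> exec x c s t1 s1 \<Longrightarrow> exec x (While b c) s1 t2 s2 \<Longrightarrow>
     exec x (While b c) s (t1 + t2 + 1) s2"

fun test_regs :: "'b test \<Rightarrow> nat set" where
  "test_regs (Less r q) = {r, q}"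
| "test_regs (Arr r) = {r}"
| "test_regs (Inp r P) = {r}"

fun com_regs :: "'b com \<Rightarrow> nat set" where
  "com_regs Skip = {}"
| "com_regs (Inc r) = {r}"
| "com_regs (Zero r) = {r}"
| "com_regs (SetA r) = {r}"
| "com_regs (c ;; d) = com_regs c \<union> com_regs d"
| "com_regs (If b c d) = test_regs b \<union> com_regs c \<union> com_regs d"
| "com_regs (While b c) = test_regs b \<union> com_regs c"

lemma finite_com_regs: "finite (com_regs c)"
proof (induction c)
  case (If b c d)
  then show ?case by (cases b) auto
next
  case (While b c)
  then show ?case by (cases b) auto
qed auto

text \<open>Registers are kept in unary, so their size is the distance the heads travel; growing by
  at most one per unit of time, they keep each elementary command linear in the initial size plus
  the time elapsed.\<close>

lemma exec_growth: "exec x c s t s' \<Longrightarrow> fst s' r \<le> fst s r + t"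
  by (induction rule: exec.induct) auto

text \<open>Tape 0 holds the input, tape 1 the array and tape \<open>r + 2\<close> the register \<open>r\<close> in unary.\<close>

definition state_conf :: "'b list \<Rightarrow> state \<Rightarrow> int \<Rightarrow> 'b sconf" where
  "state_conf x s h =
     ((\<lambda>j. if j = 0 then fst (input_tape x)
        else if j = 1 then (\<lambda>i. if 0 \<le> i \<and> nat i \<in> snd s then Work 0 else Blank)
        else (\<lambda>i. if 0 \<le> i \<and> i < int (fst s (j - 2)) then Work 0 else Blank)), h)"

lemma state_conf_init: "state_conf x (\<lambda>_. 0, {}) 0 = init_sconf x"
  by (auto simp: state_conf_def init_sconf_def fun_eq_iff)

definition reg_at :: "nat \<Rightarrow> 'b tsym list \<Rightarrow> bool" where
  "reg_at r ss \<longleftrightarrow> ss ! (r + 2) \<noteq> Blank"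

lemma reg_at_conf [simp]:
  "r + 2 < k \<Longrightarrow> reg_at r (reads k (state_conf x s h)) \<longleftrightarrow> 0 \<le> h \<and> h < int (fst s r)"
  by (simp add: reg_at_def reads_def state_conf_def)

abbreviation "tmove m \<equiv> TAct (\<lambda>_. None) m"

lemma sact_move [simp]: "sact (\<lambda>_. None) m (state_conf x s h) = state_conf x s (h + move_offset m)"
  by (auto simp: sact_def state_conf_def)

lemma trun_tmove:
  "h' = h + move_offset m \<Longrightarrow> trun k (tmove m) (state_conf x s h) 1 (state_conf x s h')"
  using trun_TAct[of k "\<lambda>_. None" m "state_conf x s h"] by simp

definition scan :: "nat \<Rightarrow> 'b tcom" where
  "scan r = TWhile (reg_at r) (tmove MoveR)"

text \<open>Cell -1 of every register tape is blank and serves as the left end mark; the first move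
  to the left is there because the head may stand just behind the last marked cell.\<close>

definition rewind :: "nat \<Rightarrow> 'b tcom" where
  "rewind r = TSeq (tmove MoveL) (TSeq (TWhile (reg_at r) (tmove MoveL)) (tmove MoveR))"

lemma trun_scan:
  assumes "r + 2 < k" "h + d = fst s r"
  shows "trun k (scan r) (state_conf x s (int h)) (3 * d + 1) (state_conf x s (int (fst s r)))"
  using assms(2)
proof (induction d arbitrary: h)
  case 0
  then show ?case using assms(1) by (auto simp: scan_def intro!: trun_TWhile_False)
next
  case (Suc d)
  have "trun k (scan r) (state_conf x s (int h)) (1 + (3 * d + 1) + 2) (state_conf x s (int (fst s r)))"
    unfolding scan_def
  proof (rule trun_TWhile_True)
    show "trun k (tmove MoveR) (state_conf x s (int h)) 1 (state_conf x s (int (Suc h)))"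
      by (rule trun_tmove) (simp add: move_offset_def)
    show "trun k (TWhile (reg_at r) (tmove MoveR)) (state_conf x s (int (Suc h))) (3 * d + 1)
        (state_conf x s (int (fst s r)))"
      using Suc.IH[of "Suc h"] Suc.prems unfolding scan_def by simp
  qed (use Suc.prems assms(1) in simp)
  then show ?case by (rule trun_mono) simp
qed

lemma trun_left:
  assumes "r + 2 < k" "h \<le> fst s r"
  shows "trun k (TWhile (reg_at r) (tmove MoveL)) (state_conf x s (int h - 1)) (3 * h + 1)
    (state_conf x s (- 1))"
  using assms(2)
proof (induction h)
  case 0
  then show ?case using assms(1) by (auto intro!: trun_TWhile_False)
next
  case (Suc h)
  have "trun k (TWhile (reg_at r) (tmove MoveL)) (state_conf x s (int (Suc h) - 1))
    (1 + (3 * h + 1) + 2) (state_conf x s (- 1))"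
  proof (rule trun_TWhile_True)
    show "trun k (tmove MoveL) (state_conf x s (int (Suc h) - 1)) 1 (state_conf x s (int h - 1))"
      by (rule trun_tmove) (simp add: move_offset_def)
  qed (use Suc assms(1) in auto)
  then show ?case by (rule trun_mono) simp
qed

lemma trun_rewind:
  assumes "r + 2 < k" "h \<le> fst s r"
  shows "trun k (rewind r) (state_conf x s (int h)) (3 * h + 5) (state_conf x s 0)"
proof -
  have "trun k (rewind r) (state_conf x s (int h)) (1 + ((3 * h + 1) + 1 + 1) + 1) (state_conf x s 0)"
    unfolding rewind_def
    by (rule trun_TSeq[OF trun_tmove trun_TSeq[OF trun_left[OF assms] trun_tmove]])
      (simp_all add: move_offset_def)
  then show ?thesis by (rule trun_mono) simp
qed

fun test_reg :: "'b test \<Rightarrow> nat" where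
  "test_reg (Less r q) = r"
| "test_reg (Arr r) = r"
| "test_reg (Inp r P) = r"

text \<open>Evaluated with the heads at the value of the tested register \<open>r\<close>: there the
  tape of \<open>q\<close> is marked iff \<open>r\<close> is less than \<open>q\<close>, and the
  array and input tapes show the cell addressed.\<close>

fun test_at :: "'b test \<Rightarrow> 'b tsym list \<Rightarrow> bool" where
  "test_at (Less r q) ss \<longleftrightarrow> reg_at q ss"
| "test_at (Arr r) ss \<longleftrightarrow> ss ! 1 \<noteq> Blank"
| "test_at (Inp r P) ss \<longleftrightarrow> P (ss ! 0)"

lemma test_at_conf:
  assumes "\<forall>r\<in>test_regs b. r + 2 < k"
  shows "test_at b (reads k (state_conf x s (int (fst s (test_reg b))))) \<longleftrightarrow> test_val x b s"
  using assms by (cases b) (auto simp: reads_def state_conf_def reg_at_def)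

lemma test_reg_in: "test_reg b \<in> test_regs b"
  by (cases b) auto

text \<open>Every compiled command starts and ends with the heads at 0. A test is made at the far
  position, so both continuations, and the body of a loop, begin with a rewind, and a loop is
  entered by one scan and left by one rewind.\<close>

fun compile :: "'b com \<Rightarrow> 'b tcom" where
  "compile Skip = TSkip"
| "compile (Inc r) = TSeq (scan r)
     (TSeq (TAct (\<lambda>j. if j = r + 2 then Some True else None) Stay) (rewind r))"
| "compile (Zero r) = TSeq (scan r) (TSeq (tmove MoveL)
     (TSeq (TWhile (reg_at r) (TAct (\<lambda>j. if j = r + 2 then Some False else None) MoveL))
       (tmove MoveR)))"
| "compile (SetA r) = TSeq (scan r)
     (TSeq (TAct (\<lambda>j. if j = 1 then Some True else None) Stay) (rewind r))"
| "compile (c ;; d) = TSeq (compile c) (compile d)"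
| "compile (If b c d) = TSeq (scan (test_reg b)) (TIf (test_at b)
     (TSeq (rewind (test_reg b)) (compile c)) (TSeq (rewind (test_reg b)) (compile d)))"
| "compile (While b c) = TSeq (scan (test_reg b)) (TSeq
     (TWhile (test_at b) (TSeq (rewind (test_reg b)) (TSeq (compile c) (scan (test_reg b)))))
     (rewind (test_reg b)))"

lemma trun_erase:
  assumes "r + 2 < k"
  shows "trun k (TWhile (reg_at r) (TAct (\<lambda>j. if j = r + 2 then Some False else None) MoveL))
    (state_conf x (R(r := v), A) (int v - 1)) (3 * v + 1) (state_conf x (R(r := 0), A) (- 1))"
proof (induction v)
  case 0
  then show ?case using assms by (auto intro!: trun_TWhile_False)
next
  case (Suc v)
  let ?c = "TAct (\<lambda>j. if j = r + 2 then Some False else None) MoveL"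
  have "trun k (TWhile (reg_at r) ?c) (state_conf x (R(r := Suc v), A) (int (Suc v) - 1))
    (1 + (3 * v + 1) + 2) (state_conf x (R(r := 0), A) (- 1))"
  proof (rule trun_TWhile_True)
    have "sact (\<lambda>j. if j = r + 2 then Some False else None) MoveL
        (state_conf x (R(r := Suc v), A) (int (Suc v) - 1))
      = state_conf x (R(r := v), A) (int v - 1)"
      by (auto simp: sact_def state_conf_def move_offset_def fun_eq_iff)
    then show "trun k ?c (state_conf x (R(r := Suc v), A) (int (Suc v) - 1)) 1
      (state_conf x (R(r := v), A) (int v - 1))"
      using trun_TAct by metis
    show "reg_at r (reads k (state_conf x (R(r := Suc v), A) (int (Suc v) - 1)))"
      using assms by simp
  qed (rule Suc.IH)
  then show ?case by (rule trun_mono) simp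
qed

lemma trun_write:
  assumes "r + 2 < k" "R r = v" "v \<le> fst s' r"
    and "sact w Stay (state_conf x (R, A) (int v)) = state_conf x s' (int v)"
  shows "trun k (TSeq (scan r) (TSeq (TAct w Stay) (rewind r))) (state_conf x (R, A) 0)
    (6 * v + 9) (state_conf x s' 0)"
proof -
  have act: "trun k (TAct w Stay) (state_conf x (R, A) (int v)) 1 (state_conf x s' (int v))"
    using trun_TAct[of k w Stay "state_conf x (R, A) (int v)"] assms(4) by simp
  have "trun k (TSeq (scan r) (TSeq (TAct w Stay) (rewind r))) (state_conf x (R, A) 0)
    ((3 * v + 1) + (1 + (3 * v + 5) + 1) + 1) (state_conf x s' 0)"
    by (rule trun_TSeq[OF _ trun_TSeq[OF act trun_rewind]])
      (use trun_scan[of r k 0 v "(R, A)" x] assms in simp_all)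
  then show ?thesis by (rule trun_mono) simp
qed

text \<open>\<open>M\<close> bounds all registers during the run, so one unit of source time costs
  at most \<open>N\<close>; the factor 20 absorbs the scans and rewinds around a test. The second
  conjunct is for the induction: further iterations resume the inner loop at the scanned position,
  not the compiled command with its initial scan.\<close>

lemma trun_compile:
  assumes "exec x c s t s'" "\<forall>r\<in>com_regs c. r + 2 < k" "\<forall>r. fst s r + t \<le> M"
    and N: "20 * (M + 1) \<le> N"
  shows "trun k (compile c) (state_conf x s 0) (t * N) (state_conf x s' 0)
    \<and> (\<forall>b d. c = While b d \<longrightarrow>
        trun k (TWhile (test_at b) (TSeq (rewind (test_reg b)) (TSeq (compile d) (scan (test_reg b)))))
          (state_conf x s (int (fst s (test_reg b)))) (t * N)
          (state_conf x s' (int (fst s' (test_reg b)))))"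
  using assms(1-3)
proof (induction rule: exec.induct)
  case (1 s)
  then show ?case by (auto intro: trun_TSkip)
next
  case (2 r R A)
  have "trun k (compile (Inc r)) (state_conf x (R, A) 0) (6 * R r + 9)
      (state_conf x (R(r := Suc (R r)), A) 0)"
    unfolding compile.simps
    by (rule trun_write)
      (use 2 in \<open>auto simp: sact_def state_conf_def move_offset_def fun_eq_iff\<close>)
  moreover have "R r \<le> M" using 2(2)[rule_format, of r] by simp
  ultimately show ?case using N by (auto elim!: trun_mono simp del: compile.simps)
next
  case (3 r R A)
  let ?v = "R r"
  have "trun k (compile (Zero r)) (state_conf x (R, A) 0)
      ((3 * ?v + 1) + (1 + ((3 * ?v + 1) + 1 + 1) + 1) + 1) (state_conf x (R(r := 0), A) 0)"
    unfolding compile.simps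
  proof (intro trun_TSeq)
    show "trun k (scan r) (state_conf x (R, A) 0) (3 * ?v + 1) (state_conf x (R, A) (int ?v))"
      using trun_scan[of r k 0 ?v "(R, A)" x] 3 by simp
    show "trun k (tmove MoveL) (state_conf x (R, A) (int ?v)) 1 (state_conf x (R, A) (int ?v - 1))"
      by (rule trun_tmove) (simp add: move_offset_def)
    show "trun k (TWhile (reg_at r) (TAct (\<lambda>j. if j = r + 2 then Some False else None) MoveL))
      (state_conf x (R, A) (int ?v - 1)) (3 * ?v + 1) (state_conf x (R(r := 0), A) (- 1))"
      using trun_erase[of r k x R ?v A] 3 by simp
    show "trun k (tmove MoveR) (state_conf x (R(r := 0), A) (- 1)) 1 (state_conf x (R(r := 0), A) 0)"
      by (rule trun_tmove) (simp add: move_offset_def)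
  qed
  moreover have "?v \<le> M" using 3(2)[rule_format, of r] by simp
  ultimately show ?case using N by (auto elim!: trun_mono simp del: compile.simps)
next
  case (4 r R A)
  have "trun k (compile (SetA r)) (state_conf x (R, A) 0) (6 * R r + 9)
      (state_conf x (R, insert (R r) A) 0)"
    unfolding compile.simps
    by (rule trun_write)
      (use 4 in \<open>auto simp: sact_def state_conf_def move_offset_def fun_eq_iff\<close>)
  moreover have "R r \<le> M" using 4(2)[rule_format, of r] by simp
  ultimately show ?case using N by (auto elim!: trun_mono simp del: compile.simps)
next
  case (5 c s t1 s1 d t2 s2)
  have a: "\<forall>r. fst s r + t1 \<le> M"
  proof
    fix r
    show "fst s r + t1 \<le> M" using 5(6)[rule_format, of r] by simp
  qed
  have b: "\<forall>r. fst s1 r + t2 \<le> M"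
  proof
    fix r
    show "fst s1 r + t2 \<le> M"
      using exec_growth[OF 5(1), of r] 5(6)[rule_format, of r] by linarith
  qed
  have "trun k (compile (c ;; d)) (state_conf x s 0)
     (t1 * N + t2 * N + 1) (state_conf x s2 0)"
    unfolding compile.simps
    by (rule trun_TSeq[OF conjunct1[OF 5(3)[OF _ a]] conjunct1[OF 5(4)[OF _ b]]])
      (use 5(5) in simp_all)
  then have "trun k (compile (c ;; d)) (state_conf x s 0) ((t1 + t2 + 1) * N) (state_conf x s2 0)"
    by (rule trun_mono) (use N in \<open>simp add: add_mult_distrib\<close>)
  then show ?case by simp
next
  case (6 b s c d t s1)
  let ?r = "test_reg b" and ?e = "if test_val x b s then c else d"
  have r: "?r + 2 < k" "\<forall>r\<in>test_regs b. r + 2 < k" using 6(3) test_reg_in[of b] by auto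
  have v: "fst s ?r \<le> M" using 6(4)[rule_format, of ?r] by simp
  have a: "\<forall>r. fst s r + t \<le> M"
  proof
    fix r
    show "fst s r + t \<le> M" using 6(4)[rule_format, of r] by simp
  qed
  have regs: "\<forall>r\<in>com_regs ?e. r + 2 < k" using 6(3) by simp
  have "trun k (compile (If b c d)) (state_conf x s 0)
     ((3 * fst s ?r + 1) + (((3 * fst s ?r + 5) + t * N + 1) + 1) + 1) (state_conf x s1 0)"
    unfolding compile.simps
  proof (rule trun_TSeq)
    show "trun k (scan ?r) (state_conf x s 0) (3 * fst s ?r + 1) (state_conf x s (int (fst s ?r)))"
      using trun_scan[of ?r k 0 "fst s ?r" s x] r by simp
    have "trun k (TSeq (rewind ?r) (compile ?e)) (state_conf x s (int (fst s ?r)))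
       ((3 * fst s ?r + 5) + t * N + 1) (state_conf x s1 0)"
      by (rule trun_TSeq[OF trun_rewind[OF r(1) order.refl] conjunct1[OF 6(2)[OF regs a]]])
    then show "trun k (TIf (test_at b) (TSeq (rewind ?r) (compile c)) (TSeq (rewind ?r) (compile d)))
       (state_conf x s (int (fst s ?r)))
       (((3 * fst s ?r + 5) + t * N + 1) + 1) (state_conf x s1 0)"
      using test_at_conf[OF r(2), of x s] by (intro trun_TIf) (cases "test_val x b s", simp_all)
  qed
  then have "trun k (compile (If b c d)) (state_conf x s 0) ((t + 1) * N) (state_conf x s1 0)"
    by (rule trun_mono) (use N v in \<open>simp add: add_mult_distrib\<close>)
  then show ?case by simp
next
  case (7 b s c)
  let ?r = "test_reg b" and ?b = "TSeq (rewind (test_reg b)) (TSeq (compile c) (scan (test_reg b)))"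
  have r: "?r + 2 < k" "\<forall>r\<in>test_regs b. r + 2 < k" using 7(2) test_reg_in[of b] by auto
  have v: "fst s ?r \<le> M" using 7(3)[rule_format, of ?r] by simp
  have w: "trun k (TWhile (test_at b) ?b) (state_conf x s (int (fst s ?r))) 1
      (state_conf x s (int (fst s ?r)))"
    using test_at_conf[OF r(2), of x s] 7(1) by (intro trun_TWhile_False) simp_all
  have "trun k (compile (While b c)) (state_conf x s 0)
     ((3 * fst s ?r + 1) + (1 + (3 * fst s ?r + 5) + 1) + 1) (state_conf x s 0)"
    unfolding compile.simps
    by (rule trun_TSeq[OF _ trun_TSeq[OF w trun_rewind[OF r(1) order.refl]]])
      (use trun_scan[of ?r k 0 "fst s ?r" s x] r in simp)
  then have "trun k (compile (While b c)) (state_conf x s 0) (1 * N) (state_conf x s 0)"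
    by (rule trun_mono) (use N v in simp)
  moreover have "trun k (TWhile (test_at b) ?b) (state_conf x s (int (fst s ?r))) (1 * N)
      (state_conf x s (int (fst s ?r)))"
    by (rule trun_mono[OF w]) (use N in simp)
  ultimately show ?case by simp
next
  case (8 b s c t1 s1 t2 s2)
  let ?r = "test_reg b" and ?b = "TSeq (rewind (test_reg b)) (TSeq (compile c) (scan (test_reg b)))"
  have r: "?r + 2 < k" "\<forall>r\<in>test_regs b. r + 2 < k" using 8(6) test_reg_in[of b] by auto
  have a: "\<forall>r. fst s r + t1 \<le> M"
  proof
    fix r
    show "fst s r + t1 \<le> M" using 8(7)[rule_format, of r] by simp
  qed
  have b: "\<forall>r. fst s1 r + t2 \<le> M"
  proof
    fix r
    show "fst s1 r + t2 \<le> M"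
      using exec_growth[OF 8(2), of r] 8(7)[rule_format, of r] by linarith
  qed
  have v: "fst s ?r \<le> M" "fst s1 ?r \<le> M"
    using a[rule_format, of ?r] b[rule_format, of ?r] by simp_all
  have v2: "fst s2 ?r \<le> M"
    using exec_growth[OF 8(3), of ?r] b[rule_format, of ?r] by linarith
  have body: "trun k ?b (state_conf x s (int (fst s ?r)))
     ((3 * fst s ?r + 5) + (t1 * N + (3 * fst s1 ?r + 1) + 1) + 1)
     (state_conf x s1 (int (fst s1 ?r)))"
    by (rule trun_TSeq[OF trun_rewind[OF r(1) order.refl] trun_TSeq[OF conjunct1[OF 8(4)[OF _ a]]]])
      (use trun_scan[of ?r k 0 "fst s1 ?r" s1 x] r 8(6) in simp_all)
  have w0: "trun k (TWhile (test_at b) ?b) (state_conf x s (int (fst s ?r)))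
     (((3 * fst s ?r + 5) + (t1 * N + (3 * fst s1 ?r + 1) + 1) + 1) + t2 * N + 2)
     (state_conf x s2 (int (fst s2 ?r)))"
    by (rule trun_TWhile_True[OF _ body])
      (use test_at_conf[OF r(2), of x s] 8(1) 8(5)[OF 8(6) b] in simp_all)
  have w: "trun k (TWhile (test_at b) ?b) (state_conf x s (int (fst s ?r)))
     (t1 * N + t2 * N + 6 * M + 10) (state_conf x s2 (int (fst s2 ?r)))"
    by (rule trun_mono[OF w0]) (use v in linarith)
  have "trun k (compile (While b c)) (state_conf x s 0)
     ((3 * fst s ?r + 1) + ((t1 * N + t2 * N + 6 * M + 10) + (3 * fst s2 ?r + 5) + 1) + 1)
     (state_conf x s2 0)"
    unfolding compile.simps
    by (rule trun_TSeq[OF _ trun_TSeq[OF w trun_rewind[OF r(1) order.refl]]])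
      (use trun_scan[of ?r k 0 "fst s ?r" s x] r in simp)
  then have "trun k (compile (While b c)) (state_conf x s 0) ((t1 + t2 + 1) * N) (state_conf x s2 0)"
    by (rule trun_mono) (use v v2 N in \<open>simp add: add_mult_distrib\<close>)
  moreover have "trun k (TWhile (test_at b) ?b) (state_conf x s (int (fst s ?r)))
     ((t1 + t2 + 1) * N) (state_conf x s2 (int (fst s2 ?r)))"
    by (rule trun_mono[OF w]) (use N in \<open>simp add: add_mult_distrib\<close>)
  ultimately show ?case by simp
qed

theorem class_P_com:
  fixes c :: "'b com" and p :: "nat poly"
  assumes "finite A" "L \<subseteq> lists A"
    and "\<And>x. x \<in> lists A \<Longrightarrow>
      \<exists>t R B. exec x c (\<lambda>_. 0, {}) t (R, B) \<and> t \<le> poly p (length x) \<and> (0 < R 0 \<longleftrightarrow> x \<in> L)"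
  shows "L \<in> class_P A"
proof -
  obtain m where m: "\<forall>r\<in>com_regs c. r \<le> m"
    using finite_com_regs[of c] by (auto simp: finite_nat_set_iff_bounded_le)
  define k where "k = m + 3"
  have k: "\<forall>r\<in>com_regs c. r + 2 < k" "1 \<le> k" "0 + 2 < k" using m by (auto simp: k_def)
  obtain M :: "'b tm" where M: "turing_machine A M"
    "\<And>x t s. trun k (compile c) (init_sconf x) t s \<Longrightarrow>
       \<exists>t'\<le>Suc t. fst ((tm_step M ^^ t') (tm_init M x)) = (if reg_at 0 (reads k s) then 1 else 2)"
    by (rule tcom_turing_machine[OF assms(1) k(2), of "compile c" "reg_at 0"]) blast
  define q where "q = p * [:20:] * (p + 1) + 1"
  have "decides_in_time A M L (poly q)"
    unfolding decides_in_time_def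
  proof
    fix x assume x: "x \<in> lists A"
    obtain t R B where run: "exec x c (\<lambda>_. 0, {}) t (R, B)" "t \<le> poly p (length x)"
      "0 < R 0 \<longleftrightarrow> x \<in> L" using assms(3)[OF x] by (elim exE conjE) (rule that)
    \<comment> \<open>All registers start at 0, so by growth they never exceed \<open>t\<close>, and
      \<open>M\<close> can be taken as \<open>t\<close>.\<close>
    have "trun k (compile c) (init_sconf x) (t * (20 * (t + 1))) (state_conf x (R, B) 0)"
      using trun_compile[OF run(1) k(1), of t "20 * (t + 1)"] by (simp add: state_conf_init)
    then obtain t' where t': "t' \<le> Suc (t * (20 * (t + 1)))"
      "fst ((tm_step M ^^ t') (tm_init M x)) =
        (if reg_at 0 (reads k (state_conf x (R, B) 0)) then 1 else 2)" using M(2) by blast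
    have "t * (20 * (t + 1)) \<le> poly p (length x) * (20 * (poly p (length x) + 1))"
      using run(2) by (intro mult_le_mono) auto
    then have "t' \<le> poly q (length x)" using t'(1) by (simp add: q_def algebra_simps)
    then show "\<exists>t\<le>poly q (length x). fst ((tm_step M ^^ t) (tm_init M x)) =
        (if x \<in> L then 1 else 2)"
      using t'(2) run(3) reg_at_conf[OF k(3), of x "(R, B)" 0] by auto
  qed
  then show ?thesis unfolding class_P_def using M(1) assms(2) by blast
qed

section \<open>Tree approximation of paths and the cutting of chords\<close>

section \<open>Geometry of hyperbolic length functions\<close>

text \<open>With \<open>a\<close>, \<open>b\<close>, \<open>c\<close>, \<open>d\<close> the
  similarities along the sides of a quadrilateral and \<open>p\<close>, \<open>q\<close> those along
  its diagonals, the hypotheses are four ultrametric inequalities; the conclusion is the four-point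
  condition of a tree.\<close>

lemma four_point:
  fixes a b c d p q :: nat
  assumes "min a d \<le> p" "min c b \<le> p" "min a c \<le> q" "min d b \<le> q"
  shows "min (a + b) (c + d) \<le> p + q"
  using assms by linarith

context group
begin

lemma list_prod_simps [simp]:
  "list_prod G [] = \<one>" "list_prod G (a # w) = a \<otimes> list_prod G w"
  by (simp_all add: list_prod_def)

lemma list_prod_closed [simp]: "set w \<subseteq> carrier G \<Longrightarrow> list_prod G w \<in> carrier G"
  by (induction w) auto

lemma list_prod_append [simp]:
  "set v \<subseteq> carrier G \<Longrightarrow> set w \<subseteq> carrier G \<Longrightarrow>
     list_prod G (v @ w) = list_prod G v \<otimes> list_prod G w"
  by (induction v) (auto simp: m_assoc)

lemma list_prod_replicate_one [simp]: "list_prod G (replicate n \<one>) = \<one>"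
  by (induction n) auto

end

text \<open>Gromov's inequality at the base point 1, with products doubled to stay in the natural
  numbers; so \<open>\<Delta>\<close> stands for twice the hyperbolicity constant.
  \<open>len_step\<close> provides geodesics in place of a generating set.\<close>

locale hyperbolic_length = group G for G (structure) +
  fixes len :: "'a \<Rightarrow> nat" and \<Delta> :: nat
  assumes len_zero: "g \<in> carrier G \<Longrightarrow> len g = 0 \<longleftrightarrow> g = \<one>"
    and len_mult: "\<lbrakk>g \<in> carrier G; h \<in> carrier G\<rbrakk> \<Longrightarrow> len (g \<otimes> h) \<le> len g + len h"
    and len_inv: "g \<in> carrier G \<Longrightarrow> len (inv g) = len g"
    and len_step: "\<lbrakk>g \<in> carrier G; len g = Suc n\<rbrakk> \<Longrightarrow>
      \<exists>h\<in>carrier G. \<exists>a\<in>carrier G. g = h \<otimes> a \<and> len h = n \<and> len a \<le> 1"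
    and finite_ball: "finite {g \<in> carrier G. len g \<le> r}"
    and hyperbolic: "\<lbrakk>x \<in> carrier G; y \<in> carrier G; z \<in> carrier G\<rbrakk> \<Longrightarrow>
      min (len x + len y - len (inv x \<otimes> y)) (len y + len z - len (inv y \<otimes> z))
        \<le> len x + len z - len (inv x \<otimes> z) + \<Delta>"
begin

definition dist :: "'a \<Rightarrow> 'a \<Rightarrow> nat" where
  "dist x y = len (inv x \<otimes> y)"

text \<open>Twice the Gromov product with respect to the identity; the subtraction never truncates.\<close>

definition gp :: "'a \<Rightarrow> 'a \<Rightarrow> nat" where
  "gp x y = len x + len y - dist x y"

lemma dist_sym: "x \<in> carrier G \<Longrightarrow> y \<in> carrier G \<Longrightarrow> dist x y = dist y x"
  using len_inv[of "inv x \<otimes> y"] by (simp add: dist_def inv_mult_group)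

lemma dist_triangle:
  assumes "x \<in> carrier G" "y \<in> carrier G" "z \<in> carrier G"
  shows "dist x z \<le> dist x y + dist y z"
proof -
  have "inv x \<otimes> z = (inv x \<otimes> y) \<otimes> (inv y \<otimes> z)"
    using assms by (metis inv_closed inv_solve_left m_assoc m_closed)
  then show ?thesis using len_mult[of "inv x \<otimes> y" "inv y \<otimes> z"] assms by (simp add: dist_def)
qed

lemma dist_refl: "x \<in> carrier G \<Longrightarrow> dist x x = 0"
  using len_zero[of \<one>] by (simp add: dist_def)

lemma dist_one: "x \<in> carrier G \<Longrightarrow> dist \<one> x = len x"
  by (simp add: dist_def)

lemma dist_le: "x \<in> carrier G \<Longrightarrow> y \<in> carrier G \<Longrightarrow> dist x y \<le> len x + len y"
  using dist_triangle[of x \<one> y] dist_sym[of x \<one>] by (simp add: dist_one)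

lemma len_le: "x \<in> carrier G \<Longrightarrow> y \<in> carrier G \<Longrightarrow> len x \<le> len y + dist x y"
  using dist_triangle[of \<one> y x] dist_sym[of x y] by (simp add: dist_one)

lemma gp_sym: "x \<in> carrier G \<Longrightarrow> y \<in> carrier G \<Longrightarrow> gp x y = gp y x"
  by (simp add: gp_def dist_sym)

lemma gp_le: "x \<in> carrier G \<Longrightarrow> y \<in> carrier G \<Longrightarrow> gp x y \<le> 2 * len x"
  using len_le[of y x] dist_sym[of x y] by (simp add: gp_def)

lemma gp_dist: "x \<in> carrier G \<Longrightarrow> y \<in> carrier G \<Longrightarrow> gp x y + dist x y = len x + len y"
  using dist_le[of x y] by (simp add: gp_def)

lemma gp_hyperbolic:
  "\<lbrakk>x \<in> carrier G; y \<in> carrier G; z \<in> carrier G\<rbrakk> \<Longrightarrow> min (gp x y) (gp y z) \<le> gp x z + \<Delta>"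
  using hyperbolic by (simp add: gp_def dist_def)

text \<open>The chain is split at a power of two and the parts are joined by one use of
  hyperbolicity, so the error is counted by the depth of the splitting and not by the number of
  links.\<close>

lemma gp_chain:
  assumes "(x, y) \<in> {(x, y). x \<in> carrier G \<and> y \<in> carrier G \<and> \<tau> \<le> gp x y} ^^ m" "0 < m" "m \<le> 2 ^ k"
  shows "x \<in> carrier G \<and> y \<in> carrier G \<and> \<tau> \<le> gp x y + k * \<Delta>"
  using assms
proof (induction k arbitrary: x y m)
  case 0
  then have "m = 1" by simp
  then show ?case using 0 by simp
next
  case (Suc k)
  let ?R = "{(x, y). x \<in> carrier G \<and> y \<in> carrier G \<and> \<tau> \<le> gp x y}"
  show ?case
  proof (cases "m \<le> 2 ^ k")
    case True
    then show ?thesis using Suc.IH[OF Suc.prems(1,2)] by auto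
  next
    case False
    then have "(x, y) \<in> ?R ^^ (2 ^ k) O ?R ^^ (m - 2 ^ k)"
      using Suc.prems(1) by (simp flip: relpow_add)
    then obtain z where z: "(x, z) \<in> ?R ^^ (2 ^ k)" "(z, y) \<in> ?R ^^ (m - 2 ^ k)"
      by auto
    have "m - 2 ^ k \<le> 2 ^ k" "0 < m - 2 ^ k" using False Suc.prems(3) by auto
    note h = Suc.IH[OF z(1) _ order.refl] Suc.IH[OF z(2) this(2,1)]
    then show ?thesis using gp_hyperbolic[of x z y] by auto
  qed
qed

text \<open>Approximate the metric on the points of a path by a tree metric: replace the Gromov product by the
  largest \<open>\<tau>\<close> such that the two points are joined by a chain of consecutive Gromov products at least
  \<open>\<tau>\<close>. Halving chains shows that this costs only \<open>\<Delta>\<close> times the logarithm of their length.\<close>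

lemma tree_approximation:
  fixes P :: "nat \<Rightarrow> 'a"
  assumes P: "\<And>i. i \<le> n \<Longrightarrow> P i \<in> carrier G" and k: "(n + 1)\<^sup>2 \<le> 2 ^ k"
  obtains e :: "nat \<Rightarrow> nat \<Rightarrow> int" where
    "\<And>i j. i \<le> n \<Longrightarrow> j \<le> n \<Longrightarrow> e i j \<le> int (dist (P i) (P j))"
    "\<And>i j. i \<le> n \<Longrightarrow> j \<le> n \<Longrightarrow> int (dist (P i) (P j)) \<le> e i j + int (k * \<Delta>)"
    "\<And>i j. i \<le> n \<Longrightarrow> j \<le> n \<Longrightarrow> e i j = e j i"
    "\<And>i. i \<le> n \<Longrightarrow> e i i = 0"
    "\<And>x y z w. x \<le> n \<Longrightarrow> y \<le> n \<Longrightarrow> z \<le> n \<Longrightarrow> w \<le> n \<Longrightarrow>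
       e x z + e y w \<le> max (e x y + e z w) (e x w + e y z)"
proof -
  define R where "R \<tau> = {(i, j). i \<le> n \<and> j \<le> n \<and> \<tau> \<le> gp (P i) (P j)}" for \<tau>
  define s where "s i j = (GREATEST \<tau>. (i, j) \<in> (R \<tau>)\<^sup>+)" for i j
  have fin: "finite (R \<tau>)" and card: "card (R \<tau>) \<le> (n + 1)\<^sup>2" for \<tau>
  proof -
    have sub: "R \<tau> \<subseteq> {..n} \<times> {..n}" by (auto simp: R_def)
    show "finite (R \<tau>)" by (rule finite_subset[OF sub]) simp
    show "card (R \<tau>) \<le> (n + 1)\<^sup>2"
      using card_mono[OF _ sub] by (simp add: power2_eq_square)
  qed
  have image: "(P i, P j) \<in> {(x, y). x \<in> carrier G \<and> y \<in> carrier G \<and> \<tau> \<le> gp x y} ^^ m"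
    if "(i, j) \<in> R \<tau> ^^ m" for i j \<tau> m
    using that
  proof (induction m arbitrary: j)
    case (Suc m)
    then obtain l where "(i, l) \<in> R \<tau> ^^ m" "(l, j) \<in> R \<tau>" by auto
    then show ?case using Suc.IH P by (auto simp: R_def intro!: relcompI)
  qed auto
  \<comment> \<open>A chain can be shortened to at most \<open>card (R \<tau>)\<close> links; the
    crude bound on this cardinality is the origin of the square in the hypothesis on
    \<open>k\<close>.\<close>
  have chain: "\<tau> \<le> gp (P i) (P j) + k * \<Delta>" if tr: "(i, j) \<in> (R \<tau>)\<^sup>+" for i j \<tau>
  proof -
    obtain m where m: "0 < m" "m \<le> card (R \<tau>)" "(i, j) \<in> R \<tau> ^^ m"
      using tr trancl_finite_eq_relpow[OF fin] by auto
    then have "m \<le> 2 ^ k" using card k by (meson le_trans)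
    then show ?thesis using gp_chain[OF image[OF m(3)] m(1)] by blast
  qed
  have ne: "(i, j) \<in> (R (gp (P i) (P j)))\<^sup>+" if "i \<le> n" "j \<le> n" for i j
    using that by (auto simp: R_def)
  have s_in: "(i, j) \<in> (R (s i j))\<^sup>+" if "i \<le> n" "j \<le> n" for i j
    unfolding s_def
    by (rule GreatestI_nat[where P = "\<lambda>\<tau>. (i, j) \<in> (R \<tau>)\<^sup>+", OF ne[OF that]]) (rule chain)
  have s_max: "\<tau> \<le> s i j" if "(i, j) \<in> (R \<tau>)\<^sup>+" for i j \<tau>
    unfolding s_def
    by (rule Greatest_le_nat[where P = "\<lambda>\<tau>. (i, j) \<in> (R \<tau>)\<^sup>+", OF that]) (rule chain)
  have R_mono: "(R \<tau>)\<^sup>+ \<subseteq> (R \<tau>')\<^sup>+" if "\<tau>' \<le> \<tau>" for \<tau> \<tau>'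
    by (rule subsetI, erule trancl_mono) (use that in \<open>auto simp: R_def\<close>)
  have s_sym: "s i j = s j i" if "i \<le> n" "j \<le> n" for i j
  proof -
    have "sym (R \<tau>)" for \<tau> using gp_sym P by (auto simp: R_def sym_def)
    then have "sym ((R \<tau>)\<^sup>+)" for \<tau> by (rule sym_trancl)
    then show ?thesis unfolding s_def by (metis symE)
  qed
  have s_ultra: "min (s i j) (s j l) \<le> s i l" if "i \<le> n" "j \<le> n" "l \<le> n" for i j l
  proof (rule s_max)
    have "(i, j) \<in> (R (min (s i j) (s j l)))\<^sup>+"
      by (rule subsetD[OF R_mono s_in]) (use that in simp_all)
    moreover have "(j, l) \<in> (R (min (s i j) (s j l)))\<^sup>+"
      by (rule subsetD[OF R_mono s_in]) (use that in simp_all)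
    ultimately show "(i, l) \<in> (R (min (s i j) (s j l)))\<^sup>+" by (rule trancl_trans)
  qed
  have s_ge: "gp (P i) (P j) \<le> s i j" if "i \<le> n" "j \<le> n" for i j
    using s_max[OF ne[OF that]] .
  have s_le: "s i j \<le> gp (P i) (P j) + k * \<Delta>" if "i \<le> n" "j \<le> n" for i j
    using chain[OF s_in[OF that]] .
  \<comment> \<open>Chains from \<open>i\<close> back to \<open>i\<close> cannot beat the doubled
    length, since already their first link is bounded by it; this gives the tree metric a zero
    diagonal.\<close>
  have s_diag: "s i i = 2 * len (P i)" if i: "i \<le> n" for i
  proof (rule antisym)
    obtain l where "(i, l) \<in> R (s i i)" using s_in[OF i i] by (meson tranclD)
    then show "s i i \<le> 2 * len (P i)" using gp_le[of "P i" "P l"] P by (auto simp: R_def)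
    show "2 * len (P i) \<le> s i i"
      using s_ge[OF i i] P[OF i] by (simp add: gp_def dist_refl)
  qed
  \<comment> \<open>Reading \<open>s\<close> as twice the depth at which two branches part, this is
    the distance in a tree rooted at 1.\<close>
  define e where "e i j = int (len (P i)) + int (len (P j)) - int (s i j)" for i j
  show ?thesis
  proof
    fix i j assume ij: "i \<le> n" "j \<le> n"
    have "int (gp (P i) (P j)) + int (dist (P i) (P j)) = int (len (P i)) + int (len (P j))"
      using gp_dist[OF P[OF ij(1)] P[OF ij(2)]] by (simp flip: of_nat_add)
    then show "e i j \<le> int (dist (P i) (P j))" "int (dist (P i) (P j)) \<le> e i j + int (k * \<Delta>)"
      using s_ge[OF ij] s_le[OF ij] unfolding e_def by linarith+
    show "e i j = e j i" using s_sym[OF ij] by (simp add: e_def)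
  next
    fix i assume "i \<le> n"
    then show "e i i = 0" by (simp add: e_def s_diag)
  next
    fix x y z w assume a: "x \<le> n" "y \<le> n" "z \<le> n" "w \<le> n"
    have "min (s x y + s z w) (s x w + s y z) \<le> s x z + s y w"
      by (rule four_point)
        (use s_ultra[of x y z] s_ultra[of x w z] s_ultra[of y x w] s_ultra[of y z w]
          s_sym[of y x] s_sym[of w z] a in \<open>simp_all add: min.commute\<close>)
    then show "e x z + e y w \<le> max (e x y + e z w) (e x w + e y z)"
      unfolding e_def by linarith
  qed
qed

text \<open>Shortness is measured in the tree metric, where the bound \<open>2 * L\<close>
  reproduces itself under cutting; measured by \<open>dist\<close>, an error would be added at every
  cut. The error \<open>k * \<Delta>\<close> is paid only once, on returning to
  \<open>dist\<close>.\<close>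

lemma chord_splitting:
  fixes P :: "nat \<Rightarrow> 'a"
  assumes P: "\<And>i. i \<le> n \<Longrightarrow> P i \<in> carrier G"
    and step: "\<And>i. i < n \<Longrightarrow> dist (P i) (P (Suc i)) \<le> L" and k: "(n + 1)\<^sup>2 \<le> 2 ^ k"
  obtains short :: "nat \<Rightarrow> nat \<Rightarrow> bool" where
    "\<And>i j. i \<le> n \<Longrightarrow> j \<le> n \<Longrightarrow> short i j \<Longrightarrow> dist (P i) (P j) \<le> 2 * L + k * \<Delta>"
    "\<And>i j. i \<le> n \<Longrightarrow> j \<le> n \<Longrightarrow> P i = P j \<Longrightarrow> short i j"
    "\<And>i j. Suc i < j \<Longrightarrow> j \<le> n \<Longrightarrow> short i j \<Longrightarrow> \<exists>m. i < m \<and> m < j \<and> short i m \<and> short m j"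
proof -
  obtain e where e: "\<And>i j. i \<le> n \<Longrightarrow> j \<le> n \<Longrightarrow> e i j \<le> int (dist (P i) (P j))"
    "\<And>i j. i \<le> n \<Longrightarrow> j \<le> n \<Longrightarrow> int (dist (P i) (P j)) \<le> e i j + int (k * \<Delta>)"
    "\<And>i j. i \<le> n \<Longrightarrow> j \<le> n \<Longrightarrow> e i j = e j i"
    "\<And>i. i \<le> n \<Longrightarrow> e i i = 0"
    "\<And>x y z w. x \<le> n \<Longrightarrow> y \<le> n \<Longrightarrow> z \<le> n \<Longrightarrow> w \<le> n \<Longrightarrow>
       e x z + e y w \<le> max (e x y + e z w) (e x w + e y z)"
    using tree_approximation[of n P k] P k by blast
  have e_step: "e i (Suc i) \<le> int L" if "i < n" for i
    using e(1)[of i "Suc i"] step[OF that] that by simp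
  define short where "short i j \<longleftrightarrow> e i j \<le> 2 * int L" for i j
  show ?thesis
  proof
    fix i j assume ij: "i \<le> n" "j \<le> n"
    show "dist (P i) (P j) \<le> 2 * L + k * \<Delta>" if "short i j"
      using e(2)[OF ij] that unfolding short_def by linarith
    show "short i j" if "P i = P j"
      using e(1)[OF ij] that dist_refl[OF P[OF ij(2)]] by (simp add: short_def)
  next
    fix i j assume ij: "Suc i < j" "j \<le> n" "short i j"
    show "\<exists>m. i < m \<and> m < j \<and> short i m \<and> short m j"
    proof (cases "e i j \<le> int L")
      case True
      \<comment> \<open>The four-point condition with a repeated point is the triangle
        inequality.\<close>
      have "e (Suc i) j + e i i \<le> max (e (Suc i) i + e i j) (e (Suc i) i + e i j)"
        using e(5)[of "Suc i" i j i] e(3)[of i j] ij by simp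
      then have "e (Suc i) j \<le> 2 * int L"
        using e(3)[of "Suc i" i] e_step[of i] e(4)[of i] True ij by simp
      then show ?thesis using e_step[of i] ij by (intro exI[of _ "Suc i"]) (simp add: short_def)
    next
      case False
      \<comment> \<open>Find the step \<open>u, Suc u\<close> where the path crosses the midpoint between \<open>i\<close> and \<open>j\<close>.\<close>
      define f where "f m = e m i - e m j" for m
      have fj: "f j > 0" using e(3)[of i j] e(4)[of j] False ij by (simp add: f_def)
      have fi: "\<not> f i > 0" using e(4)[of i] False ij by (simp add: f_def)
      have "\<exists>u\<ge>i. u < j \<and> \<not> f u > 0 \<and> f (Suc u) > 0"
      proof -
        define v where "v = (LEAST v. i \<le> v \<and> f v > 0)"
        have v: "i \<le> v" "f v > 0" "v \<le> j"
          using LeastI[of "\<lambda>v. i \<le> v \<and> f v > 0" j] Least_le[of "\<lambda>v. i \<le> v \<and> f v > 0" j] fj ij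
          by (auto simp: v_def)
        then have "i < v" using fi by (cases "v = i") auto
        then obtain u where u: "v = Suc u" "i \<le> u" by (cases v) auto
        then have "\<not> f u > 0" using not_less_Least[of u "\<lambda>v. i \<le> v \<and> f v > 0"] by (auto simp: v_def)
        then show ?thesis using u v by (intro exI[of _ u]) auto
      qed
      then obtain u where u: "i \<le> u" "u < j" "f u \<le> 0" "f (Suc u) > 0" by force
      let ?v = "Suc u"
      \<comment> \<open>Across the midpoint the first sum in the maximum is strictly smaller than
        the left side, so the second one counts. Hence \<open>e i ?v + e u j\<close> is at most
        \<open>3 * L\<close>, and the smaller summand selects the cutting point.\<close>
      have "e i ?v + e u j \<le> max (e i u + e ?v j) (e i j + e u ?v)"
        using e(5)[of i u ?v j] u ij by simp
      moreover have "e i u + e ?v j < e i ?v + e u j"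
        using u(3,4) e(3)[of i u] e(3)[of i ?v] u ij by (simp add: f_def)
      ultimately have sum: "e i ?v + e u j \<le> e i j + int L"
        using e_step[of u] u ij by linarith
      show ?thesis
      proof (cases "e i ?v \<le> e u j")
        case True
        \<comment> \<open>If the step ended at \<open>j\<close>, then \<open>e i j\<close> would be
          at most \<open>e u j\<close>, hence at most \<open>L\<close>, and this case is already
          settled.\<close>
        have "?v \<noteq> j" using sum True False u ij by auto
        moreover have "e ?v j < e i ?v" using u(4) e(3)[of i ?v] u ij by (simp add: f_def)
        ultimately show ?thesis using u sum True False ij
          by (intro exI[of _ ?v]) (auto simp: short_def)
      next
        case c: False
        have "u \<noteq> i" using sum c False u ij by auto
        moreover have "e i u \<le> e u j" using u(3) e(3)[of i u] u ij by (simp add: f_def)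
        ultimately show ?thesis using u sum c False ij
          by (intro exI[of _ u]) (auto simp: short_def)
      qed
    qed
  qed
qed

section \<open>Geodesic words and fellow travelling\<close>

lemma len_list_prod:
  assumes "set w \<subseteq> {a \<in> carrier G. len a \<le> L}"
  shows "len (list_prod G w) \<le> L * length w"
  using assms
proof (induction w)
  case Nil
  then show ?case using len_zero[of \<one>] by simp
next
  case (Cons a w)
  then have "set w \<subseteq> carrier G" by auto
  then show ?case using Cons len_mult[of a "list_prod G w"] by auto
qed

definition geodesic :: "'a list \<Rightarrow> 'a \<Rightarrow> bool" where
  "geodesic w g \<longleftrightarrow> set w \<subseteq> {a \<in> carrier G. len a \<le> 1} \<and> length w = len g \<and> list_prod G w = g"

lemma geodesic_closed: "geodesic w g \<Longrightarrow> set w \<subseteq> carrier G \<and> g \<in> carrier G"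
  unfolding geodesic_def using list_prod_closed by blast

lemma ex_geodesic: "g \<in> carrier G \<Longrightarrow> \<exists>w. geodesic w g"
proof (induction "len g" arbitrary: g)
  case 0
  then show ?case using len_zero by (intro exI[of _ "[]"]) (auto simp: geodesic_def)
next
  case (Suc n)
  then obtain h a where ha: "h \<in> carrier G" "a \<in> carrier G" "g = h \<otimes> a" "len h = n" "len a \<le> 1"
    using len_step by metis
  then obtain w where w: "geodesic w h" using Suc.hyps(1) by metis
  have "geodesic (w @ [a]) g"
    using w ha Suc.hyps(2) geodesic_closed[OF w] unfolding geodesic_def by auto
  then show ?case by blast
qed

lemma geodesic_one: "geodesic w \<one> \<longleftrightarrow> w = []"
  using len_zero[of \<one>] by (auto simp: geodesic_def)

text \<open>Prefix and suffix have at most their number of letters as length, and together at least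
  \<open>len g\<close>; so both bounds are attained. Beyond its end the word rests at
  \<open>g\<close>, which is why \<open>min\<close> appears.\<close>

lemma geodesic_prefix:
  assumes "geodesic w g"
  shows "len (list_prod G (take t w)) = min t (len g)"
    and "dist (list_prod G (take t w)) g = len g - min t (len g)"
proof -
  let ?p = "list_prod G (take t w)" and ?s = "list_prod G (drop t w)"
  have sub: "set (take t w) \<subseteq> {a \<in> carrier G. len a \<le> 1}" "set (drop t w) \<subseteq> {a \<in> carrier G. len a \<le> 1}"
    using assms unfolding geodesic_def by (meson set_take_subset set_drop_subset subset_trans)+
  then have c: "set (take t w) \<subseteq> carrier G" "set (drop t w) \<subseteq> carrier G" by auto
  have g: "g = ?p \<otimes> ?s" using list_prod_append[OF c] assms by (simp add: geodesic_def)
  have "dist ?p g = len ?s" using c unfolding g dist_def by (simp flip: m_assoc)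
  moreover have "len ?s \<le> len g - min t (len g)" "len ?p \<le> min t (len g)"
    using len_list_prod[OF sub(2)] len_list_prod[OF sub(1)] assms by (auto simp: geodesic_def)
  moreover have "len g \<le> len ?p + len ?s" unfolding g using c by (simp add: len_mult)
  ultimately show "len ?p = min t (len g)" "dist ?p g = len g - min t (len g)" by auto
qed

text \<open>From one prefix through \<open>g\<close> and \<open>h\<close> to the other prefix is a
  chain of three Gromov products, hence two uses of hyperbolicity and the error
  \<open>2 * \<Delta>\<close>. The outer two products are known exactly because prefixes lie on
  geodesics from 1.\<close>

lemma fellow_travel:
  assumes u: "geodesic u g" and v: "geodesic v h" and L: "dist g h \<le> L"
  shows "dist (list_prod G (take t u)) (list_prod G (take t v)) \<le> L + 2 * \<Delta>"
proof -
  let ?x = "list_prod G (take t u)" and ?y = "list_prod G (take t v)"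
  have gh: "g \<in> carrier G" "h \<in> carrier G" using u v geodesic_closed by auto
  have x: "?x \<in> carrier G" "?y \<in> carrier G"
    using u v geodesic_closed by (meson list_prod_closed set_take_subset subset_trans)+
  define p q where "p = min t (len g)" and "q = min t (len h)"
  have "gp ?x g = 2 * p"
    using gp_dist[OF x(1) gh(1)] geodesic_prefix[OF u, of t] by (simp add: p_def)
  moreover have "gp h ?y = 2 * q"
    using gp_dist[OF gh(2) x(2)] geodesic_prefix[OF v, of t] dist_sym[OF gh(2) x(2)]
    by (simp add: q_def)
  moreover have "gp g h + dist g h = len g + len h" "gp ?x ?y + dist ?x ?y = p + q"
    using gp_dist[OF gh] gp_dist[OF x] geodesic_prefix(1)[OF u, of t] geodesic_prefix(1)[OF v, of t]
    by (simp_all add: p_def q_def)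
  moreover have "min (gp ?x g) (gp g h) \<le> gp ?x h + \<Delta>" "min (gp ?x h) (gp h ?y) \<le> gp ?x ?y + \<Delta>"
    using gp_hyperbolic[OF x(1) gh] gp_hyperbolic[OF x(1) gh(2) x(2)] .
  moreover have "p \<le> q + dist g h" "q \<le> p + dist g h" "p \<le> len g" "q \<le> len h"
    using len_le[OF gh] len_le[OF gh(2,1)] dist_sym[OF gh] by (auto simp: p_def q_def)
  ultimately show ?thesis using L by linarith
qed

end

section \<open>Identification of short words, and filling of closed paths by chords\<close>

section \<open>Completeness of the closure rules\<close>

text \<open>Numbers below \<open>V\<close> represent a node, in the leading part, followed by a word of base-\<open>B\<close> digits.
  Numbers below \<open>M\<close> have no leading part and are excluded from the rules.\<close>

locale closure_system = hyperbolic_length +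
  fixes L :: nat and dig :: "'a \<Rightarrow> nat" and B :: nat and M :: nat and V :: nat and C :: "(nat \<times> nat) set"
  assumes L: "1 \<le> L" and B: "1 \<le> B"
begin

text \<open>Rungs between geodesics with endpoints at distance at most \<open>L\<close> have length
  at most \<open>L + 2 * \<Delta>\<close>; the additional 1 is for the diagonals that cut the
  squares of a ladder into triangles.\<close>

definition digits :: "'a set" where
  "digits = {g \<in> carrier G. len g \<le> L + 2 * \<Delta> + 1}"

definition app :: "nat \<Rightarrow> 'a \<Rightarrow> nat" where
  "app s a = s * B + dig a"

definition code :: "nat \<Rightarrow> 'a list \<Rightarrow> nat" where
  "code s w = foldl app s w"

definition closed_system :: bool where
  "closed_system \<longleftrightarrow>
     (\<forall>s m t. (s, m) \<in> C \<longrightarrow> (m, t) \<in> C \<longrightarrow> s < V \<longrightarrow> m < V \<longrightarrow> t < V \<longrightarrow> (s, t) \<in> C) \<and>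
     (\<forall>s t a. M \<le> s \<longrightarrow> M \<le> t \<longrightarrow> a \<in> digits \<longrightarrow> app s a < V \<longrightarrow> app t a < V \<longrightarrow>
        (s, t) \<in> C \<longleftrightarrow> (app s a, app t a) \<in> C) \<and>
     (\<forall>s a b. M \<le> s \<longrightarrow> s < V \<longrightarrow> a \<in> digits \<longrightarrow> b \<in> digits \<longrightarrow> a \<otimes> b \<in> digits \<longrightarrow>
        app (app s a) b < V \<longrightarrow> app s (a \<otimes> b) < V \<longrightarrow>
        (app (app s a) b, app s (a \<otimes> b)) \<in> C \<and> (app s (a \<otimes> b), app (app s a) b) \<in> C)"

text \<open>The rules are available only below \<open>V\<close>. \<open>n\<close> is the number of
  digits that may still be appended to \<open>s\<close>, and the lemmas below state how many they
  consume.\<close>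

definition room :: "nat \<Rightarrow> nat \<Rightarrow> bool" where
  "room s n \<longleftrightarrow> M \<le> s \<and> (\<forall>w. set w \<subseteq> digits \<longrightarrow> length w \<le> n \<longrightarrow> code s w < V)"

definition eqv :: "nat \<Rightarrow> nat \<Rightarrow> bool" where
  "eqv s t \<longleftrightarrow> (s, t) \<in> C \<and> (t, s) \<in> C"

lemma digits_closed: "a \<in> digits \<Longrightarrow> a \<in> carrier G"
  by (simp add: digits_def)

lemma digits_sub: "digits \<subseteq> carrier G"
  by (auto simp: digits_def)

lemma short_digit: "a \<in> carrier G \<Longrightarrow> len a \<le> L \<Longrightarrow> a \<in> digits"
  by (simp add: digits_def)

lemma one_digit [simp]: "\<one> \<in> digits"
  using len_zero[of \<one>] by (simp add: digits_def)

lemma code_simps [simp]: "code s [] = s" "code s (a # w) = code (app s a) w"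
  by (simp_all add: code_def)

lemma code_append [simp]: "code s (v @ w) = code (code s v) w"
  by (simp add: code_def)

lemma app_ge: "s \<le> app s a"
proof -
  have "s * 1 \<le> s * B" using B by (rule mult_le_mono2)
  then show ?thesis unfolding app_def by linarith
qed

lemma code_ge: "s \<le> code s w"
proof (induction w arbitrary: s)
  case (Cons a w)
  have "app s a \<le> code (app s a) w" by (rule Cons)
  with app_ge[of s a] show ?case by simp
qed simp

lemma room_mono: "room s n \<Longrightarrow> m \<le> n \<Longrightarrow> room s m"
  unfolding room_def by auto

lemma room_less: "room s n \<Longrightarrow> s < V"
  unfolding room_def by (metis code_simps(1) empty_set empty_subsetI le0 list.size(3))

lemma room_code:
  assumes "room s n" "set w \<subseteq> digits" "length w + m \<le> n"
  shows "room (code s w) m"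
  unfolding room_def
proof (intro conjI allI impI)
  show "M \<le> code s w" using assms(1) code_ge[of s w] unfolding room_def by linarith
  fix v assume "set v \<subseteq> digits" "length v \<le> m"
  then have "set (w @ v) \<subseteq> digits" "length (w @ v) \<le> n" using assms by auto
  then have "code s (w @ v) < V" using assms(1) unfolding room_def by blast
  then show "code (code s w) v < V" by simp
qed

lemma room_app: "room s n \<Longrightarrow> a \<in> digits \<Longrightarrow> Suc m \<le> n \<Longrightarrow> room (app s a) m"
  using room_code[of s n "[a]" m] by simp

context
  assumes closed: closed_system
begin

lemma C_trans: "(s, m) \<in> C \<Longrightarrow> (m, t) \<in> C \<Longrightarrow> s < V \<Longrightarrow> m < V \<Longrightarrow> t < V \<Longrightarrow> (s, t) \<in> C"
  using closed unfolding closed_system_def by blast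

lemma C_app: "M \<le> s \<Longrightarrow> M \<le> t \<Longrightarrow> a \<in> digits \<Longrightarrow> app s a < V \<Longrightarrow> app t a < V \<Longrightarrow> (s, t) \<in> C \<longleftrightarrow> (app s a, app t a) \<in> C"
  using closed unfolding closed_system_def by blast

lemma eqv_trans: "eqv s m \<Longrightarrow> eqv m t \<Longrightarrow> s < V \<Longrightarrow> m < V \<Longrightarrow> t < V \<Longrightarrow> eqv s t"
  unfolding eqv_def using C_trans by blast

lemma eqv_sym: "eqv s t \<Longrightarrow> eqv t s"
  unfolding eqv_def by blast

lemma C_code:
  assumes "(s, t) \<in> C" "room s n" "room t n" "set w \<subseteq> digits" "length w \<le> n"
  shows "(code s w, code t w) \<in> C"
  using assms
proof (induction w arbitrary: s t n)
  case (Cons a w)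
  have a: "a \<in> digits" using Cons.prems by simp
  have r: "room (app s a) (length w)" "room (app t a) (length w)"
    using Cons.prems by (auto intro!: room_app)
  have "(app s a, app t a) \<in> C" using C_app[OF _ _ a] r Cons.prems(1-3) room_less unfolding room_def by blast
  then show ?case using Cons.IH r Cons.prems by auto
qed simp

lemma eqv_code:
  "eqv s t \<Longrightarrow> room s n \<Longrightarrow> room t n \<Longrightarrow> set w \<subseteq> digits \<Longrightarrow> length w \<le> n \<Longrightarrow> eqv (code s w) (code t w)"
  unfolding eqv_def using C_code by blast

lemma eqv_app: "eqv s t \<Longrightarrow> room s 1 \<Longrightarrow> room t 1 \<Longrightarrow> a \<in> digits \<Longrightarrow> eqv (app s a) (app t a)"
  using eqv_code[of s t 1 "[a]"] by simp

lemma eqv_mult: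
  assumes "room s 2" "a \<in> digits" "b \<in> digits" "a \<otimes> b \<in> digits"
  shows "eqv (app (app s a) b) (app s (a \<otimes> b))"
proof -
  have "app (app s a) b < V" "app s (a \<otimes> b) < V" "s < V" "M \<le> s"
    using assms room_less[OF room_code[of s 2 "[a, b]" 0]] room_less[OF room_app[of s 2 _ 0]] room_less
    by (auto simp: room_def)
  then show ?thesis using closed assms unfolding closed_system_def eqv_def by blast
qed

text \<open>The table entry for \<open>\<one> \<otimes> \<one>\<close> compares two trivial digits
  with one; removing the common last digit leaves the claim.\<close>

lemma eqv_one:
  assumes "room s 2"
  shows "eqv (app s \<one>) s"
proof -
  have "eqv (app (app s \<one>) \<one>) (app s \<one>)" using eqv_mult[OF assms one_digit one_digit] by simp
  moreover have "app (app s \<one>) \<one> < V" "app s \<one> < V"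
    using room_less[OF room_code[OF assms, of "[\<one>, \<one>]" 0]] room_less[OF room_app[OF assms, of \<one> 0]]
    by auto
  moreover have "M \<le> s" "M \<le> app s \<one>" using assms app_ge[of s \<one>] by (auto simp: room_def)
  ultimately show ?thesis using C_app[OF _ _ one_digit] unfolding eqv_def by blast
qed

text \<open>Reflexivity is not among the rules; it is recovered by going to
  \<open>app s \<one>\<close> and back.\<close>

lemma eqv_refl:
  assumes "room s 2"
  shows "eqv s s"
proof -
  have "app s \<one> < V" "s < V"
    using room_less[OF room_app[OF assms, of \<one> 0]] room_less[OF assms] by simp_all
  then show ?thesis using eqv_trans[OF eqv_sym eqv_one[OF assms]] eqv_one[OF assms] by blast
qed

lemma eqv_replicate_one:
  assumes "room s (m + 2)"
  shows "eqv (code s (replicate m \<one>)) s"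
  using assms
proof (induction m arbitrary: s)
  case 0
  have "room s 2" using 0 by (rule room_mono) simp
  then show ?case using eqv_refl by simp
next
  case (Suc m)
  have r: "room (app s \<one>) (m + 2)" "room s 2" using Suc.prems by (auto intro: room_app room_mono)
  have "code (app s \<one>) (replicate m \<one>) < V"
    by (rule room_less[OF room_code[OF r(1), of _ 0]]) auto
  then show ?case using eqv_trans[OF Suc.IH[OF r(1)] eqv_one[OF r(2)]] r room_less by simp
qed

text \<open>A ladder of squares: the rung \<open>h\<close> is carried along two words of equal length.\<close>

lemma eqv_ladder:
  assumes "length u = length v" "set u \<subseteq> digits" "set v \<subseteq> digits" "h \<in> digits"
    and "room s (length u + 3)"
    and "\<And>t. t \<le> length u \<Longrightarrow> inv (list_prod G (take t v)) \<otimes> h \<otimes> list_prod G (take t u) \<in> digits"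
    and "\<And>t. t < length u \<Longrightarrow> inv (list_prod G (take t v)) \<otimes> h \<otimes> list_prod G (take (Suc t) u) \<in> digits"
  shows "eqv (code (app s h) u) (app (code s v) (inv (list_prod G v) \<otimes> h \<otimes> list_prod G u))"
  using assms
proof (induction u v arbitrary: s h rule: list_induct2)
  case Nil
  have "room (app s h) 2" using Nil by (auto intro: room_app)
  then show ?case using Nil eqv_refl by (simp add: digits_closed)
next
  case (Cons a u b v)
  have uv: "set u \<subseteq> carrier G" "set v \<subseteq> carrier G" "a \<in> carrier G" "b \<in> carrier G" "h \<in> carrier G"
    "a \<in> digits" "b \<in> digits" using Cons.prems digits_sub by auto
  \<comment> \<open>The next rung: \<open>b\<close> followed by \<open>h'\<close> and
    \<open>h\<close> followed by \<open>a\<close> are the two ways across the square.\<close>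
  define h' where "h' = inv b \<otimes> h \<otimes> a"
  have h': "h' \<in> digits" using Cons.prems(5)[of 1] uv by (simp add: h'_def)
  have ha: "h \<otimes> a \<in> digits" using Cons.prems(6)[of 0] uv by simp
  have bh': "b \<otimes> h' = h \<otimes> a" using uv by (simp add: h'_def inv_solve_left m_assoc flip: m_assoc)
  have shift: "inv (list_prod G (b # v')) \<otimes> h \<otimes> list_prod G (a # u')
      = inv (list_prod G v') \<otimes> h' \<otimes> list_prod G u'" if "set u' \<subseteq> carrier G" "set v' \<subseteq> carrier G" for u' v'
    using that uv by (simp add: h'_def inv_mult_group m_assoc)
  have c: "set (take t u) \<subseteq> carrier G" "set (take t v) \<subseteq> carrier G" for t
    using uv by (meson set_take_subset subset_trans)+
  let ?n = "length u + 3"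
  have r: "room s (Suc ?n)" using Cons.prems(4) by simp
  have rs: "room (app (app s h) a) (length u)" "room (app s (h \<otimes> a)) (length u)"
    "room (app (app s b) h') (length u)" "room (app s b) ?n"
    using r Cons.prems(3) uv ha h' room_code[OF r, of "[h, a]" "length u"]
      room_code[OF r, of "[b, h']" "length u"] by (auto intro: room_app)
  have "room s 2" using r by (rule room_mono) simp
  \<comment> \<open>The square is two triangles with the common diagonal
    \<open>h \<otimes> a\<close>, each an entry of the multiplication table.\<close>
  then have "eqv (app (app s h) a) (app s (h \<otimes> a))" "eqv (app (app s b) h') (app s (h \<otimes> a))"
    using eqv_mult[of s h a] eqv_mult[of s b h'] Cons.prems(3) uv ha h' bh' by auto
  then have "eqv (app (app s h) a) (app (app s b) h')"
    using eqv_trans eqv_sym room_less rs by blast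
  then have 1: "eqv (code (app (app s h) a) u) (code (app (app s b) h') u)"
    using eqv_code rs Cons.prems(1) by simp
  have 2: "eqv (code (app (app s b) h') u) (app (code (app s b) v) (inv (list_prod G v) \<otimes> h' \<otimes> list_prod G u))"
  proof (rule Cons.IH[OF _ _ h' rs(4)])
    fix t
    show "inv (list_prod G (take t v)) \<otimes> h' \<otimes> list_prod G (take t u) \<in> digits" if "t \<le> length u"
      using Cons.prems(5)[of "Suc t"] that shift[OF c, of t t] by simp
    show "inv (list_prod G (take t v)) \<otimes> h' \<otimes> list_prod G (take (Suc t) u) \<in> digits" if "t < length u"
      using Cons.prems(6)[of "Suc t"] that shift[OF c, of t "Suc t"] by simp
  qed (use Cons.prems in auto)
  have last: "inv (list_prod G v) \<otimes> h' \<otimes> list_prod G u \<in> digits"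
    using Cons.prems(5)[of "length (a # u)"] shift[OF uv(1,2)] Cons.hyps by simp
  have "code (app (app s h) a) u < V" "code (app (app s b) h') u < V"
    using room_less[OF room_code[OF rs(1), of u 0]] room_less[OF room_code[OF rs(3), of u 0]]
      Cons.prems(1) by auto
  moreover have "app (code (app s b) v) (inv (list_prod G v) \<otimes> h' \<otimes> list_prod G u) < V"
    using room_less[OF room_app[OF room_code[OF rs(4), of v 1] last, of 0]] Cons by simp
  ultimately show ?case using eqv_trans[OF 1 2] shift[OF uv(1,2)] by simp
qed

lemma geodesic_digits: "geodesic w g \<Longrightarrow> set w \<subseteq> digits"
  unfolding geodesic_def digits_def by auto

text \<open>A ladder between the two geodesics, padded to equal length by trivial digits. It starts
  with the rung 1 and ends with the rung \<open>inv y\<close>, which cancels against the digit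
  \<open>y\<close>.\<close>

lemma eqv_geodesic_step:
  assumes u: "geodesic u g" and v: "geodesic v (g \<otimes> y)" and y: "y \<in> carrier G" "len y \<le> L"
    and room: "room s (len g + L + 6)"
  shows "eqv (app (code s u) y) (code s v)"
proof -
  let ?T = "len g + L"
  have g: "g \<in> carrier G" using geodesic_closed[OF u] by simp
  have T: "len g \<le> ?T" "len (g \<otimes> y) \<le> ?T" using len_mult[OF g y(1)] y by auto
  define u' where "u' = u @ replicate (?T - length u) \<one>"
  define v' where "v' = v @ replicate (?T - length v) \<one>"
  have len': "length u' = ?T" "length v' = ?T"
    using u v T by (auto simp: u'_def v'_def geodesic_def)
  have uvc: "set u \<subseteq> carrier G" "set v \<subseteq> carrier G" using u v geodesic_closed by auto
  have dig': "set u' \<subseteq> digits" "set v' \<subseteq> digits"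
    using geodesic_digits[OF u] geodesic_digits[OF v] by (auto simp: u'_def v'_def)
  have dig: "set u \<subseteq> digits" "set v \<subseteq> digits" "y \<in> digits"
    using geodesic_digits[OF u] geodesic_digits[OF v] short_digit y by auto
  have ones: "set (replicate n \<one>) \<subseteq> carrier G" for n by auto
  have tk: "list_prod G (take t u') = list_prod G (take t u)"
    "list_prod G (take t v') = list_prod G (take t v)" for t
    using uvc ones set_take_subset[of t u] set_take_subset[of t v] list_prod_append
    by (auto simp: u'_def v'_def take_replicate subset_trans)
  have tkc: "list_prod G (take t u) \<in> carrier G" "list_prod G (take t v) \<in> carrier G" for t
    using uvc by (meson list_prod_closed set_take_subset subset_trans)+
  have pr: "list_prod G u' = g" "list_prod G v' = g \<otimes> y"
    using tk(1)[of ?T] tk(2)[of ?T] u v T len' by (simp_all add: geodesic_def)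
  have "inv g \<otimes> (g \<otimes> y) = y" using g y by (simp flip: m_assoc)
  then have "dist g (g \<otimes> y) \<le> L" using y by (simp add: dist_def)
  note ft = fellow_travel[OF u v this]
  have rung: "inv (list_prod G (take t v)) \<otimes> list_prod G (take t u) \<in> digits" for t
    using ft[of t] tkc[of t] dist_sym[of "list_prod G (take t v)" "list_prod G (take t u)"]
    by (simp add: digits_def dist_def)
  have rung': "inv (list_prod G (take t v)) \<otimes> list_prod G (take (Suc t) u) \<in> digits" for t
  proof -
    have "dist (list_prod G (take t u)) (list_prod G (take (Suc t) u)) \<le> 1"
    proof (cases "t < length u")
      case True
      have a: "u ! t \<in> carrier G" "len (u ! t) \<le> 1"
        using True u by (auto simp: geodesic_def subset_iff)
      have "list_prod G (take (Suc t) u) = list_prod G (take t u) \<otimes> u ! t"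
        using True a(1) uvc(1) set_take_subset[of t u]
        by (subst take_Suc_conv_app_nth) (auto simp: subset_trans)
      then show ?thesis using a tkc by (simp add: dist_def flip: m_assoc)
    next
      case False
      then show ?thesis using dist_refl[OF tkc(1)[of t]] by simp
    qed
    then have "dist (list_prod G (take t v)) (list_prod G (take (Suc t) u)) \<le> L + 2 * \<Delta> + 1"
      using ft[of t] dist_triangle[OF tkc(2)[of t] tkc(1)[of t] tkc(1)[of "Suc t"]]
        dist_sym[OF tkc(1)[of t] tkc(2)[of t]] by linarith
    then show ?thesis using tkc by (simp add: digits_def dist_def)
  qed
  have lad: "eqv (code (app s \<one>) u') (app (code s v') (inv (g \<otimes> y) \<otimes> \<one> \<otimes> g))"
    using eqv_ladder[OF _ dig' one_digit, of s, unfolded pr] len' room_mono[OF room]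
      rung rung' tk tkc by simp
  have iy: "inv (g \<otimes> y) \<otimes> \<one> \<otimes> g = inv y" using g y by (simp add: inv_mult_group m_assoc)
  have iyd: "inv y \<in> digits" using y len_inv[of y] by (intro short_digit) auto
  have pad: "eqv (code s u') (code s u)" "eqv (code s v') (code s v)"
    unfolding u'_def v'_def code_append
    using u v T dig by (auto simp: geodesic_def intro!: eqv_replicate_one room_code[OF room])
  have R: "room (code s u') 3" "room (code s u) 3" "room (code s v') 3" "room (code s v) 3"
    "room (app s \<one>) (?T + 3)" "room s 2" "room s (?T + 3)"
    using dig dig' len' u v T
    by (auto simp: geodesic_def intro!: room_code[OF room] room_app[OF room] intro: room_mono[OF room])
  have R2: "room (code (app s \<one>) u') 3" by (rule room_code[OF R(5)]) (use dig' len' in auto)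
  have R3: "room (app (code s v') (inv y)) 2" by (rule room_app[OF R(3) iyd]) simp
  have 1: "eqv (app (code s u) y) (app (code s u') y)"
    by (rule eqv_app[OF eqv_sym[OF pad(1)]]) (use R dig in \<open>auto intro: room_mono\<close>)
  have "eqv (code (app s \<one>) u') (code s u')"
    by (rule eqv_code[OF eqv_one[OF R(6)] R(5) R(7)]) (use dig' len' in auto)
  then have 2: "eqv (app (code s u') y) (app (code (app s \<one>) u') y)"
    by (rule eqv_app[OF eqv_sym]) (use R R2 dig in \<open>auto intro: room_mono\<close>)
  have 3: "eqv (app (code (app s \<one>) u') y) (app (app (code s v') (inv y)) y)"
    by (rule eqv_app[OF lad[unfolded iy]]) (use R2 R3 dig in \<open>auto intro: room_mono\<close>)
  have "eqv (app (app (code s v') (inv y)) y) (app (code s v') (inv y \<otimes> y))"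
    by (rule eqv_mult) (use R iyd dig y in \<open>auto intro: room_mono\<close>)
  then have 4: "eqv (app (app (code s v') (inv y)) y) (app (code s v') \<one>)" using y by simp
  have 5: "eqv (app (code s v') \<one>) (code s v')" by (rule eqv_one) (use R in \<open>auto intro: room_mono\<close>)
  have V: "app (code s u) y < V" "app (code s u') y < V" "app (code (app s \<one>) u') y < V"
    "app (app (code s v') (inv y)) y < V" "app (code s v') \<one> < V" "code s v' < V" "code s v < V"
    using room_less[OF room_app[OF R(2) dig(3), of 0]] room_less[OF room_app[OF R(1) dig(3), of 0]]
      room_less[OF room_app[OF R2 dig(3), of 0]] room_less[OF room_app[OF R3 dig(3), of 0]]
      room_less[OF room_app[OF R(3) one_digit, of 0]] room_less R by auto
  show ?thesis using 1 2 3 4 5 pad(2) V by (meson eqv_trans)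
qed

text \<open>The letters are absorbed one at a time into the geodesic of the prefix read so far. Such
  a geodesic is no longer than \<open>L\<close> times the number of letters, which is the main term
  of the room required.\<close>

lemma eqv_geodesic:
  assumes "set w \<subseteq> {a \<in> carrier G. len a \<le> L}" "geodesic v (list_prod G w)"
    and "room s (L * length w + L + 6)"
  shows "eqv (code s w) (code s v)"
  using assms
proof (induction w arbitrary: v rule: rev_induct)
  case Nil
  then have "v = []" "room s 2" by (auto simp: geodesic_one intro: room_mono)
  then show ?case using eqv_refl by simp
next
  case (snoc y w)
  have w: "set w \<subseteq> {a \<in> carrier G. len a \<le> L}" "set w \<subseteq> carrier G" "y \<in> carrier G" "len y \<le> L"
    using snoc.prems by auto
  obtain u where u: "geodesic u (list_prod G w)" using ex_geodesic[OF list_prod_closed[OF w(2)]] by blast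
  have lw: "len (list_prod G w) \<le> L * length w" by (rule len_list_prod[OF w(1)])
  have L1: "length w \<le> L * length w" using L by simp
  have room: "room s (L * length w + L + 6)" by (rule room_mono[OF snoc.prems(3)]) simp
  have "eqv (app (code s u) y) (code s v)"
    by (rule eqv_geodesic_step[OF u _ w(3,4)]) (use snoc.prems(2) w lw room in \<open>auto intro: room_mono\<close>)
  moreover have "room (code s w) 6"
  proof (rule room_code[OF snoc.prems(3)])
    have "L * length (w @ [y]) + L = L * length w + 2 * L" by simp
    then show "length w + 6 \<le> L * length (w @ [y]) + L + 6" using L1 by linarith
  qed (use w short_digit in auto)
  moreover have "room (code s u) 6" "room (code s v) 6"
    using w lw u snoc.prems(2) len_mult[of "list_prod G w" y]
    by (auto intro!: room_code[OF snoc.prems(3)] simp: geodesic_def subset_iff digits_def)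
  moreover note R = calculation(2-4)
  moreover have "eqv (app (code s w) y) (app (code s u) y)"
    by (rule eqv_app[OF snoc.IH[OF w(1) u room]]) (use R w short_digit in \<open>auto intro: room_mono\<close>)
  moreover have "app (code s w) y < V" "app (code s u) y < V"
    using room_less[OF room_app[OF R(1), of y 0]] room_less[OF room_app[OF R(2), of y 0]] short_digit w
    by auto
  ultimately show ?case using eqv_trans room_less by auto
qed

text \<open>Only single edges are supposed to lie in \<open>C\<close>. Induction on the extent of a
  short chord composes the pairs of its two parts; the whole path is a short chord since its
  endpoints coincide, and the geodesic of that chord is empty.\<close>

theorem closed_path:
  fixes P :: "nat \<Rightarrow> 'a" and rt :: "nat \<Rightarrow> nat"
  assumes P: "\<And>i. i \<le> n \<Longrightarrow> P i \<in> carrier G" and "P 0 = P n" "0 < n"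
    and step: "\<And>i. i < n \<Longrightarrow> dist (P i) (P (Suc i)) \<le> L"
    and k: "(n + 1)\<^sup>2 \<le> 2 ^ k"
    and edge: "\<And>i. i < n \<Longrightarrow> (app (rt i) (inv (P i) \<otimes> P (Suc i)), rt (Suc i)) \<in> C"
    and room: "\<And>i. i \<le> n \<Longrightarrow> room (rt i) (L * (2 * (2 * L + k * \<Delta>) + 2) + 6)"
  shows "(rt 0, rt n) \<in> C"
proof -
  obtain short where short:
    "\<And>i j. i \<le> n \<Longrightarrow> j \<le> n \<Longrightarrow> short i j \<Longrightarrow> dist (P i) (P j) \<le> 2 * L + k * \<Delta>"
    "\<And>i j. i \<le> n \<Longrightarrow> j \<le> n \<Longrightarrow> P i = P j \<Longrightarrow> short i j"
    "\<And>i j. Suc i < j \<Longrightarrow> j \<le> n \<Longrightarrow> short i j \<Longrightarrow> \<exists>m. i < m \<and> m < j \<and> short i m \<and> short m j"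
    using chord_splitting[of n P L k] P step k by blast
  let ?R = "2 * L + k * \<Delta>"
  \<comment> \<open>Two adjacent chords form a word of at most \<open>2 * ?R\<close> letters;
    \<open>eqv_geodesic\<close> for words with one letter more needs exactly this room.\<close>
  let ?N = "L * (2 * ?R + 2) + 6"
  have eq: "eqv (code (rt i) w) (code (rt i) v)"
    if "i \<le> n" "set w \<subseteq> {a \<in> carrier G. len a \<le> L}" "geodesic v (list_prod G w)" "length w \<le> 2 * ?R + 1"
    for i w v
  proof (rule eqv_geodesic[OF that(2,3)])
    have "L * length w \<le> L * (2 * ?R + 1)" by (rule mult_le_mono2[OF that(4)])
    then show "room (rt i) (L * length w + L + 6)"
      by (intro room_mono[OF room[OF that(1)]]) (simp add: algebra_simps)
  qed
  have "2 * r + 1 \<le> L * (2 * r + 2) + 6" for r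
    using mult_le_mono1[OF L, of "2 * r + 2"] by simp
  then have big: "2 * ?R + 1 \<le> ?N" .
  have lt: "code (rt i) w < V" if "i \<le> n" "set w \<subseteq> digits" "length w \<le> 2 * ?R + 1" for i w
    using room[OF that(1)] that big unfolding room_def by auto
  \<comment> \<open>Read as: some path from node \<open>i\<close> to node \<open>j\<close> has the
    value of the chord, spelled by any of its geodesics.\<close>
  have main: "(code (rt i) w, rt j) \<in> C"
    if "i < j" "j \<le> n" "short i j" "geodesic w (inv (P i) \<otimes> P j)" for i j w
    using that
  proof (induction "j - i" arbitrary: i j w rule: less_induct)
    case less
    have i: "i \<le> n" using less.prems by simp
    have lw: "length w \<le> ?R"
      using less.prems short(1)[of i j] by (simp add: geodesic_def dist_def)
    have wV: "code (rt i) w < V" by (rule lt[OF i geodesic_digits[OF less.prems(4)]]) (use lw in simp)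
    have rV: "rt l < V" if "l \<le> n" for l using lt[OF that, of "[]"] by simp
    show ?case
    proof (cases "Suc i = j")
      case True
      let ?a = "inv (P i) \<otimes> P j"
      have a: "?a \<in> carrier G" "len ?a \<le> L"
        using P[of i] P[of j] step[of i] less.prems True by (auto simp: dist_def)
      have "eqv (code (rt i) [?a]) (code (rt i) w)"
        by (rule eq[OF i]) (use a less.prems in auto)
      moreover have "app (rt i) ?a < V"
        using lt[OF i, of "[?a]"] a short_digit by simp
      ultimately show ?thesis
        using C_trans[of "code (rt i) w" "app (rt i) ?a" "rt j"] wV rV edge[of i] True less.prems
        by (auto simp: eqv_def)
    next
      case False
      then obtain m where m: "i < m" "m < j" "short i m" "short m j"
        using short(3)[of i j] less.prems by auto
      have Pc: "P i \<in> carrier G" "P m \<in> carrier G" "P j \<in> carrier G" "m \<le> n"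
        using P less.prems m by auto
      obtain w1 where w1: "geodesic w1 (inv (P i) \<otimes> P m)" using ex_geodesic Pc by (meson inv_closed m_closed)
      obtain w2 where w2: "geodesic w2 (inv (P m) \<otimes> P j)" using ex_geodesic Pc by (meson inv_closed m_closed)
      have l: "length w1 \<le> ?R" "length w2 \<le> ?R"
        using short(1)[of i m] short(1)[of m j] m w1 w2 less.prems by (auto simp: geodesic_def dist_def)
      have d: "set w1 \<subseteq> digits" "set w2 \<subseteq> digits" using geodesic_digits w1 w2 by auto
      have 1: "(code (rt i) w1, rt m) \<in> C" by (rule less.hyps) (use m less.prems w1 in auto)
      have 2: "(code (rt m) w2, rt j) \<in> C" by (rule less.hyps) (use m less.prems w2 in auto)
      \<comment> \<open>The second chord is appended on both sides of the first pair, so that the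
        second pair can follow by transitivity.\<close>
      have 3: "(code (code (rt i) w1) w2, code (rt m) w2) \<in> C"
        by (rule C_code[OF 1 room_code[OF room[OF i] d(1), of "length w2"] room_mono[OF room[OF Pc(4)]] d(2)])
          (use l big in auto)
      have V: "code (rt i) (w1 @ w2) < V" "code (rt m) w2 < V"
        using lt[OF i, of "w1 @ w2"] lt[OF Pc(4), of w2] d l by auto
      have 4: "(code (rt i) (w1 @ w2), rt j) \<in> C"
        using C_trans[OF 3 2] V rV less.prems by simp
      have "list_prod G (w1 @ w2) = inv (P i) \<otimes> P j"
        using w1 w2 geodesic_closed[OF w1] geodesic_closed[OF w2] Pc
        by (simp add: geodesic_def m_assoc inv_solve_left flip: m_assoc)
      then have "eqv (code (rt i) (w1 @ w2)) (code (rt i) w)"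
        by (intro eq[OF i]) (use w1 w2 l less.prems L in \<open>auto simp: geodesic_def\<close>)
      then show ?thesis
        using C_trans[of "code (rt i) w" "code (rt i) (w1 @ w2)" "rt j"] 4 wV V rV less.prems
        by (auto simp: eqv_def)
    qed
  qed
  have "geodesic [] (inv (P 0) \<otimes> P n)" using assms(2) P[of n] by (simp add: geodesic_one)
  then show ?thesis using main[of 0 n "[]"] short(2)[of 0 n] assms(2,3) by simp
qed

end

end

section \<open>Total correctness with time bounds\<close>

section \<open>Timed correctness of register programs\<close>

text \<open>Registers only; changes of the array are described by postconditions.\<close>

fun mods :: "'b com \<Rightarrow> nat set" where
  "mods Skip = {}"
| "mods (Inc r) = {r}"
| "mods (Zero r) = {r}"
| "mods (SetA r) = {}"
| "mods (c ;; d) = mods c \<union> mods d"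
| "mods (If b c d) = mods c \<union> mods d"
| "mods (While b c) = mods c"

lemma exec_mods: "exec x c s t s' \<Longrightarrow> r \<notin> mods c \<Longrightarrow> fst s' r = fst s r"
  by (induction rule: exec.induct) (auto split: if_splits)

definition ok :: "'b list \<Rightarrow> 'b com \<Rightarrow> nat \<Rightarrow> state \<Rightarrow> (state \<Rightarrow> bool) \<Rightarrow> bool" where
  "ok x c k s Q \<longleftrightarrow> (\<exists>s' t. exec x c s t s' \<and> t \<le> k \<and> Q s')"

lemma ok_conseq:
  assumes "ok x c k s Q" "k \<le> k'" "\<And>R A. Q (R, A) \<Longrightarrow> (\<And>r. r \<notin> mods c \<Longrightarrow> R r = fst s r) \<Longrightarrow> Q' (R, A)"
  shows "ok x c k' s Q'"
proof -
  obtain s' t where s': "exec x c s t s'" "t \<le> k" "Q s'" using assms(1) unfolding ok_def by blast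
  then have "Q' s'" using assms(3)[of "fst s'" "snd s'"] exec_mods[OF s'(1)] by simp
  then show ?thesis unfolding ok_def using s' assms(2) le_trans by blast
qed

lemma ok_Skip: "Q s \<Longrightarrow> 1 \<le> k \<Longrightarrow> ok x Skip k s Q"
  unfolding ok_def using exec.intros(1) by blast

lemma ok_Inc: "Q (R(r := Suc (R r)), A) \<Longrightarrow> 1 \<le> k \<Longrightarrow> ok x (Inc r) k (R, A) Q"
  unfolding ok_def using exec.intros(2) by blast

lemma ok_Zero: "Q (R(r := 0), A) \<Longrightarrow> 1 \<le> k \<Longrightarrow> ok x (Zero r) k (R, A) Q"
  unfolding ok_def using exec.intros(3) by blast

lemma ok_SetA: "Q (R, insert (R r) A) \<Longrightarrow> 1 \<le> k \<Longrightarrow> ok x (SetA r) k (R, A) Q"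
  unfolding ok_def using exec.intros(4) by blast

lemma ok_Seq:
  assumes "ok x c k1 s Q'" "\<And>R A. Q' (R, A) \<Longrightarrow> (\<And>r. r \<notin> mods c \<Longrightarrow> R r = fst s r) \<Longrightarrow> ok x d k2 (R, A) Q"
  shows "ok x (c ;; d) (k1 + k2 + 1) s Q"
proof -
  obtain s1 t1 where 1: "exec x c s t1 s1" "t1 \<le> k1" "Q' s1" using assms(1) unfolding ok_def by blast
  then have "ok x d k2 s1 Q" using assms(2)[of "fst s1" "snd s1"] exec_mods[OF 1(1)] by simp
  then obtain s2 t2 where 2: "exec x d s1 t2 s2" "t2 \<le> k2" "Q s2" unfolding ok_def by blast
  have "t1 + t2 + 1 \<le> k1 + k2 + 1" using 1 2 by simp
  then show ?thesis unfolding ok_def using exec.intros(5)[OF 1(1) 2(1)] 2(3) by blast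
qed

lemma ok_If:
  assumes "test_val x b s \<Longrightarrow> ok x c k s Q" "\<not> test_val x b s \<Longrightarrow> ok x d k s Q"
  shows "ok x (If b c d) (k + 1) s Q"
proof -
  obtain s' t where s': "exec x (if test_val x b s then c else d) s t s'" "t \<le> k" "Q s'"
    using assms unfolding ok_def by (cases "test_val x b s") auto
  then have "exec x (If b c d) s (t + 1) s'" "t + 1 \<le> k + 1" using exec.intros(6)[OF s'(1)] by auto
  then show ?thesis unfolding ok_def using s'(3) by blast
qed

lemma ok_While_False: "\<not> test_val x b s \<Longrightarrow> Q s \<Longrightarrow> 1 \<le> k \<Longrightarrow> ok x (While b c) k s Q"
  unfolding ok_def using exec.intros(7) by blast

lemma ok_While_True:
  assumes "test_val x b s" "ok x c k1 s Q'" "\<And>s'. Q' s' \<Longrightarrow> ok x (While b c) k2 s' Q"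
  shows "ok x (While b c) (k1 + k2 + 1) s Q"
proof -
  obtain s1 t1 where 1: "exec x c s t1 s1" "t1 \<le> k1" "Q' s1" using assms(2) unfolding ok_def by blast
  obtain s2 t2 where 2: "exec x (While b c) s1 t2 s2" "t2 \<le> k2" "Q s2"
    using assms(3)[OF 1(3)] unfolding ok_def by blast
  have "t1 + t2 + 1 \<le> k1 + k2 + 1" using 1 2 by simp
  then show ?thesis unfolding ok_def using exec.intros(8)[OF assms(1) 1(1) 2(1)] 2(3) by blast
qed

definition For :: "nat \<Rightarrow> nat \<Rightarrow> 'b com \<Rightarrow> 'b com" where
  "For i y c = Zero i ;; While (Less i y) (c ;; Inc i)"

lemma mods_For [simp]: "mods (For i y c) = insert i (mods c)"
  by (auto simp: For_def)

text \<open>The invariant is required of the state after the counter has advanced, hence the update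
  of \<open>i\<close> in the condition on the body.\<close>

lemma ok_For:
  assumes "i \<notin> mods c" "y \<notin> mods c" "i \<noteq> y"
    and "Inv 0 (R(i := 0), A)"
    and step: "\<And>j R' A'. j < R y \<Longrightarrow> Inv j (R', A') \<Longrightarrow> R' i = j \<Longrightarrow>
      (\<And>r. r \<notin> insert i (mods c) \<Longrightarrow> R' r = R r) \<Longrightarrow>
      ok x c k (R', A') (\<lambda>(R'', A''). Inv (Suc j) (R''(i := Suc j), A''))"
  shows "ok x (For i y c) (R y * (k + 3) + 3) (R, A) (\<lambda>s. Inv (R y) s \<and> fst s i = R y)"
proof -
  let ?Q = "\<lambda>s. Inv (R y) s \<and> fst s i = R y"
  have loop: "ok x (While (Less i y) (c ;; Inc i)) (d * (k + 3) + 1) (R', A') ?Q"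
    if "Inv j (R', A')" "R' i = j" "\<forall>r. r \<notin> insert i (mods c) \<longrightarrow> R' r = R r" "j + d = R y" for d j R' A'
    using that
  proof (induction d arbitrary: j R' A')
    case 0
    then show ?case using assms(2,3) by (auto intro!: ok_While_False)
  next
    case (Suc d)
    let ?Q' = "\<lambda>s. Inv (Suc j) s \<and> fst s i = Suc j \<and> (\<forall>r. r \<notin> insert i (mods c) \<longrightarrow> fst s r = R r)"
    have y: "R' y = R y" using Suc.prems(3) assms by simp
    have "ok x (c ;; Inc i) (k + 1 + 1) (R', A') ?Q'"
    proof (rule ok_Seq)
      show "ok x c k (R', A') (\<lambda>(R'', A''). Inv (Suc j) (R''(i := Suc j), A''))"
        by (rule step) (use Suc.prems in auto)
      fix R1 A1
      assume a: "case (R1, A1) of (R'', A'') \<Rightarrow> Inv (Suc j) (R''(i := Suc j), A'')"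
        "\<And>r. r \<notin> mods c \<Longrightarrow> R1 r = fst (R', A') r"
      then have "R1 i = j" using assms(1) Suc.prems(2) by simp
      then show "ok x (Inc i) 1 (R1, A1) ?Q'"
        using a Suc.prems(3) by (intro ok_Inc) auto
    qed
    then have "ok x (While (Less i y) (c ;; Inc i)) ((k + 1 + 1) + (d * (k + 3) + 1) + 1) (R', A') ?Q"
    proof (rule ok_While_True[rotated])
      fix s' assume "?Q' s'"
      then show "ok x (While (Less i y) (c ;; Inc i)) (d * (k + 3) + 1) s' ?Q"
        using Suc.IH[of "Suc j" "fst s'" "snd s'"] Suc.prems by simp
    qed (use Suc.prems y in simp)
    then show ?case by (rule ok_conseq) (auto simp: algebra_simps)
  qed
  have "ok x (For i y c) (1 + (R y * (k + 3) + 1) + 1) (R, A) ?Q"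
    unfolding For_def
  proof (rule ok_Seq)
    show "ok x (Zero i) 1 (R, A) (\<lambda>s. s = (R(i := 0), A))" by (rule ok_Zero) simp_all
    show "ok x (While (Less i y) (c ;; Inc i)) (R y * (k + 3) + 1) (R', A') ?Q"
      if "(R', A') = (R(i := 0), A)" for R' A'
      using loop[of 0 R' A' "R y"] that assms(3,4) by simp
  qed
  then show ?thesis by (rule ok_conseq) simp_all
qed

section \<open>Arithmetic on registers and the addresses of pairs\<close>

definition sets :: "'b list \<Rightarrow> 'b com \<Rightarrow> nat \<Rightarrow> (nat \<Rightarrow> nat) \<Rightarrow> nat \<Rightarrow> nat \<Rightarrow> bool" where
  "sets x c k R a v \<longleftrightarrow> (\<forall>A. ok x c k (R, A) (\<lambda>(R', A'). A' = A \<and> R' a = v))"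

lemma sets_mono: "sets x c k R a v \<Longrightarrow> k \<le> k' \<Longrightarrow> v = v' \<Longrightarrow> sets x c k' R a v'"
  unfolding sets_def by (blast intro: ok_conseq)

lemma sets_Zero: "sets x (Zero a) 1 R a 0"
  unfolding sets_def by (auto intro: ok_Zero)

lemma sets_Seq:
  assumes "sets x c k1 R b v" "\<And>R'. R' b = v \<Longrightarrow> (\<And>r. r \<notin> mods c \<Longrightarrow> R' r = R r) \<Longrightarrow> sets x d k2 R' a w"
  shows "sets x (c ;; d) (k1 + k2 + 1) R a w"
  unfolding sets_def
proof
  fix A :: "nat set"
  show "ok x (c ;; d) (k1 + k2 + 1) (R, A) (\<lambda>(R', A'). A' = A \<and> R' a = w)"
    by (rule ok_Seq[OF assms(1)[unfolded sets_def, rule_format]])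
      (use assms(2) in \<open>auto simp: sets_def\<close>)
qed

fun incs :: "nat \<Rightarrow> nat \<Rightarrow> 'b com" where
  "incs 0 r = Skip"
| "incs (Suc n) r = Inc r ;; incs n r"

lemma mods_incs: "mods (incs n r) \<subseteq> {r}"
  by (induction n) auto

lemma sets_incs: "sets x (incs n a) (2 * n + 1) R a (R a + n)"
proof (induction n arbitrary: R)
  case 0
  then show ?case unfolding sets_def by (auto intro: ok_Skip)
next
  case (Suc n)
  have "sets x (Inc a) 1 R a (Suc (R a))" unfolding sets_def by (auto intro: ok_Inc)
  then have "sets x (Inc a ;; incs n a) (1 + (2 * n + 1) + 1) R a (R a + Suc n)"
  proof (rule sets_Seq)
    fix R' assume "R' a = Suc (R a)"
    then show "sets x (incs n a) (2 * n + 1) R' a (R a + Suc n)" using Suc[of R'] by simp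
  qed
  then show ?case unfolding incs.simps by (rule sets_mono) simp_all
qed

text \<open>The factor \<open>n\<close> is a constant, such as the base, and is unrolled into the
  program text.\<close>

definition addmul :: "nat \<Rightarrow> nat \<Rightarrow> nat \<Rightarrow> nat \<Rightarrow> 'b com" where
  "addmul i a y n = For i y (incs n a)"

lemma mods_addmul: "mods (addmul i a y n) \<subseteq> {i, a}"
  using mods_incs[of n a] by (auto simp: addmul_def)

lemma sets_addmul:
  assumes "i \<noteq> a" "i \<noteq> y" "a \<noteq> y"
  shows "sets x (addmul i a y n) (R y * (2 * n + 4) + 3) R a (R a + R y * n)"
  unfolding sets_def
proof
  fix A :: "nat set"
  let ?Inv = "\<lambda>j (R', A'). A' = A \<and> R' a = R a + j * n"
  have "ok x (For i y (incs n a)) (R y * ((2 * n + 1) + 3) + 3) (R, A) (\<lambda>s. ?Inv (R y) s \<and> fst s i = R y)"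
  proof (rule ok_For)
    fix j R' A' assume "?Inv j (R', A')"
    then show "ok x (incs n a) (2 * n + 1) (R', A') (\<lambda>(R'', A''). ?Inv (Suc j) (R''(i := Suc j), A''))"
      using sets_incs[of x n a R', unfolded sets_def, rule_format, of A']
      by - (erule ok_conseq, use assms in auto)
  qed (use assms mods_incs[of n a] in auto)
  then show "ok x (addmul i a y n) (R y * (2 * n + 4) + 3) (R, A) (\<lambda>(R', A'). A' = A \<and> R' a = R a + R y * n)"
    unfolding addmul_def by (rule ok_conseq) auto
qed

text \<open>For \<open>n = B\<close> this appends the digit \<open>d\<close> to a number; for
  \<open>n = 1\<close> it copies a register or takes its successor.\<close>

definition affine :: "nat \<Rightarrow> nat \<Rightarrow> nat \<Rightarrow> nat \<Rightarrow> 'b com" where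
  "affine a y n d = Zero a ;; addmul 14 a y n ;; incs d a"

lemma mods_affine: "mods (affine a y n d) \<subseteq> {14, a}"
  using mods_incs[of d a] mods_addmul[of 14 a y n] by (auto simp: affine_def)

lemma sets_affine:
  assumes "a \<noteq> 14" "y \<noteq> 14" "a \<noteq> y"
  shows "sets x (affine a y n d) (R y * (2 * n + 4) + 2 * d + 7) R a (R y * n + d)"
proof -
  have "sets x (affine a y n d) (1 + (R y * (2 * n + 4) + 3 + (2 * d + 1) + 1) + 1) R a (R y * n + d)"
    unfolding affine_def
  proof (rule sets_Seq[OF sets_Zero])
    fix R' assume R': "R' a = 0" "\<And>r. r \<notin> mods (Zero a) \<Longrightarrow> R' r = R r"
    have "sets x (addmul 14 a y n) (R' y * (2 * n + 4) + 3) R' a (R' a + R' y * n)"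
      by (rule sets_addmul) (use assms in auto)
    then have "sets x (addmul 14 a y n) (R y * (2 * n + 4) + 3) R' a (R y * n)"
      using R' assms by simp
    then show "sets x (addmul 14 a y n ;; incs d a) (R y * (2 * n + 4) + 3 + (2 * d + 1) + 1) R' a (R y * n + d)"
      by (rule sets_Seq) (metis sets_incs)
  qed
  then show ?thesis by (rule sets_mono) auto
qed

text \<open>Consecutive squares leave a gap wide enough for \<open>s\<close>, which gives an
  injection computable by additions and one product, without the division by 2 of Cantor's
  pairing.\<close>

definition pr :: "nat \<Rightarrow> nat \<Rightarrow> nat" where
  "pr s t = (s + t) * (s + t) + s"

lemma pr_inj: "pr s t = pr s' t' \<Longrightarrow> s = s' \<and> t = t'"
proof -
  have less: "pr s t < pr s' t'" if "s + t < s' + t'" for s t s' t'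
  proof -
    have "pr s t < (s + t + 1) * (s + t + 1)" by (simp add: pr_def)
    also have "\<dots> \<le> (s' + t') * (s' + t')" by (rule mult_le_mono) (use that in auto)
    finally show ?thesis by (simp add: pr_def)
  qed
  assume a: "pr s t = pr s' t'"
  then have "s + t = s' + t'" using less by (metis nat_neq_iff)
  then show ?thesis using a by (simp add: pr_def)
qed

definition address :: "nat \<Rightarrow> nat \<Rightarrow> 'b com" where
  "address u v = Zero 13 ;; addmul 14 13 u 1 ;; addmul 14 13 v 1 ;; Zero 12 ;; addmul 14 12 u 1 ;;
     For 15 13 (addmul 14 12 13 1)"

lemma mods_address: "mods (address u v) \<subseteq> {12, 13, 14, 15}"
  using mods_addmul[of 14 13 u 1] mods_addmul[of 14 13 v 1] mods_addmul[of 14 12 u 1]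
    mods_addmul[of 14 12 13 1] by (auto simp: address_def)

lemma sets_address:
  assumes "u \<notin> {12, 13, 14, 15}" "v \<notin> {12, 13, 14, 15}" "R u + R v \<le> z"
  shows "sets x (address u v) (z * (6 * z + 6) + 12 * z + 30) R 12 (pr (R u) (R v))"
proof -
  let ?y = "R u + R v"
  note M = mods_addmul[THEN subsetD]
  have "sets x (address u v) (1 + ((R u * (2 * 1 + 4) + 3) + ((R v * (2 * 1 + 4) + 3) + (1 +
      ((R u * (2 * 1 + 4) + 3) + (?y * ((?y * (2 * 1 + 4) + 3) + 3) + 3) + 1) + 1) + 1) + 1) + 1) R 12 (pr (R u) (R v))"
    unfolding address_def
  proof (rule sets_Seq[OF sets_Zero], goal_cases)
    case (1 R1)
    have "sets x (addmul 14 13 u 1) (R u * (2 * 1 + 4) + 3) R1 13 (R u)"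
      using sets_addmul[of 14 13 u x 1 R1] 1 assms by simp
    then show ?case
    proof (rule sets_Seq, goal_cases)
      case (1 R2)
      have fr2: "R2 r = R r" if "r \<notin> {12, 13, 14, 15}" for r
        using 1(2)[of r] \<open>\<And>r. r \<notin> mods (Zero 13) \<Longrightarrow> R1 r = R r\<close>[of r] that M[of r 14 13 u 1] by auto
      have "sets x (addmul 14 13 v 1) (R v * (2 * 1 + 4) + 3) R2 13 ?y"
        using sets_addmul[of 14 13 v x 1 R2] 1(1) fr2[of v] assms by simp
      then show ?case
      proof (rule sets_Seq, goal_cases)
        case (1 R3)
        have fr3: "R3 r = R r" if "r \<notin> {12, 13, 14, 15}" for r
          using 1(2)[of r] fr2[of r] that M[of r 14 13 v 1] by auto
        have y3: "R3 13 = ?y" by (rule 1(1))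
        show ?case
        proof (rule sets_Seq[OF sets_Zero], goal_cases)
          case (1 R4)
          have y4: "R4 13 = ?y" using 1(2)[of 13] y3 by simp
          have "sets x (addmul 14 12 u 1) (R u * (2 * 1 + 4) + 3) R4 12 (R u)"
            using sets_addmul[of 14 12 u x 1 R4] 1 fr3[of u] assms by simp
          then show ?case
          proof (rule sets_Seq, goal_cases)
            case (1 R5)
            have y: "R5 13 = ?y" using 1(2)[of 13] y4 M[of 13 14 12 u 1] by auto
            show ?case
              unfolding sets_def
            proof
              fix A :: "nat set"
              let ?Inv = "\<lambda>j (R', A'). A' = A \<and> R' 12 = R u + j * ?y"
              have "ok x (For 15 13 (addmul 14 12 13 1)) (R5 13 * ((?y * (2 * 1 + 4) + 3) + 3) + 3) (R5, A)
                (\<lambda>s. ?Inv (R5 13) s \<and> fst s 15 = R5 13)"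
              proof (rule ok_For, goal_cases)
                case (5 j R' A')
                have "R' 13 = ?y" using 5(4)[of 13] y M[of 13 14 12 13 1] by auto
                then have "sets x (addmul 14 12 13 1) (?y * (2 * 1 + 4) + 3) R' 12 (R' 12 + ?y * 1)"
                  using sets_addmul[of 14 12 13 x 1 R'] by simp
                from this[unfolded sets_def, rule_format, of A'] 5(2) show ?case
                  by - (erule ok_conseq, auto)
              qed (use 1(1) in \<open>auto dest: M\<close>)
              then show "ok x (For 15 13 (addmul 14 12 13 1)) (?y * ((?y * (2 * 1 + 4) + 3) + 3) + 3) (R5, A)
                (\<lambda>(R', A'). A' = A \<and> R' 12 = pr (R u) (R v))"
                by (rule ok_conseq) (auto simp: y pr_def)
            qed
          qed
        qed
      qed
    qed
  qed
  moreover have "?y * ?y \<le> z * z" using assms(3) by (rule mult_le_mono[OF _ assms(3)])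
  ultimately show ?thesis using assms(3) by - (erule sets_mono, auto simp: algebra_simps)
qed

section \<open>Programs that only add pairs to the array\<close>

definition pairs :: "nat set \<Rightarrow> (nat \<times> nat) set" where
  "pairs A = {(s, t). pr s t \<in> A}"

lemma pairs_insert: "pairs (insert (pr s t) A) = insert (s, t) (pairs A)"
  by (auto simp: pairs_def dest: pr_inj)

lemma pairs_empty [simp]: "pairs {} = {}"
  by (simp add: pairs_def)

text \<open>The post-condition only asks for \<open>S\<close> to be included, so that it is not affected by in-place updates
  of the array during nested loops; \<open>W\<close> carries soundness and \<open>C\<close> the contents on entry.\<close>

definition adds :: "'b list \<Rightarrow> (nat \<times> nat) set \<Rightarrow> (nat \<times> nat) set \<Rightarrow> nat set \<Rightarrow> (nat \<Rightarrow> nat) \<Rightarrow>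
    'b com \<Rightarrow> nat \<Rightarrow> (nat \<times> nat) set \<Rightarrow> bool" where
  "adds x W C F f c k S \<longleftrightarrow> mods c \<inter> F = {} \<and>
     (\<forall>R A. (\<forall>r\<in>F. R r = f r) \<longrightarrow> C \<subseteq> pairs A \<longrightarrow> pairs A \<subseteq> W \<longrightarrow>
        ok x c k (R, A) (\<lambda>(R', A'). pairs A \<subseteq> pairs A' \<and> pairs A' \<subseteq> W \<and> S \<subseteq> pairs A'))"

lemma registers_unchanged:
  assumes "\<forall>r\<in>F. R r = f r" "\<And>r. r \<notin> N \<Longrightarrow> R' r = R r" "N \<inter> F = {}"
  shows "\<forall>r\<in>F. R' r = f r"
proof
  fix r assume "r \<in> F"
  then show "R' r = f r" using assms(1) assms(2)[of r] assms(3) by auto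
qed

lemma adds_mono:
  assumes "adds x W C F f c k S" "k \<le> k'" "S' \<subseteq> S"
  shows "adds x W C F f c k' S'"
  unfolding adds_def
proof (intro conjI allI impI)
  show "mods c \<inter> F = {}" using assms(1) by (simp add: adds_def)
  fix R A assume "\<forall>r\<in>F. R r = f r" "C \<subseteq> pairs A" "pairs A \<subseteq> W"
  then have "ok x c k (R, A) (\<lambda>(R', A'). pairs A \<subseteq> pairs A' \<and> pairs A' \<subseteq> W \<and> S \<subseteq> pairs A')"
    using assms(1) by (simp add: adds_def)
  then show "ok x c k' (R, A) (\<lambda>(R', A'). pairs A \<subseteq> pairs A' \<and> pairs A' \<subseteq> W \<and> S' \<subseteq> pairs A')"
    by (rule ok_conseq) (use assms in auto)
qed

lemma adds_Skip: "adds x W C F f Skip 1 {}"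
  by (auto simp: adds_def intro: ok_Skip)

lemma adds_Seq:
  assumes "adds x W C F f c k1 S1" "adds x W C F f d k2 S2"
  shows "adds x W C F f (c ;; d) (k1 + k2 + 1) (S1 \<union> S2)"
  unfolding adds_def
proof (intro conjI allI impI)
  show "mods (c ;; d) \<inter> F = {}" using assms by (auto simp: adds_def)
  fix R A assume a: "\<forall>r\<in>F. R r = f r" "C \<subseteq> pairs A" "pairs A \<subseteq> W"
  show "ok x (c ;; d) (k1 + k2 + 1) (R, A)
    (\<lambda>(R', A'). pairs A \<subseteq> pairs A' \<and> pairs A' \<subseteq> W \<and> S1 \<union> S2 \<subseteq> pairs A')"
  proof (rule ok_Seq)
    show "ok x c k1 (R, A) (\<lambda>(R', A'). pairs A \<subseteq> pairs A' \<and> pairs A' \<subseteq> W \<and> S1 \<subseteq> pairs A')"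
      using assms(1) a by (simp add: adds_def)
    fix R1 A1 assume 1: "case (R1, A1) of (R', A') \<Rightarrow> pairs A \<subseteq> pairs A' \<and> pairs A' \<subseteq> W \<and> S1 \<subseteq> pairs A'"
      "\<And>r. r \<notin> mods c \<Longrightarrow> R1 r = fst (R, A) r"
    have "\<forall>r\<in>F. R1 r = f r"
      by (rule registers_unchanged[OF a(1), of "mods c"]) (use 1(2) assms(1) in \<open>auto simp: adds_def\<close>)
    then have "ok x d k2 (R1, A1) (\<lambda>(R', A'). pairs A1 \<subseteq> pairs A' \<and> pairs A' \<subseteq> W \<and> S2 \<subseteq> pairs A')"
      using assms(2) a 1 by (auto simp: adds_def)
    then show "ok x d k2 (R1, A1) (\<lambda>(R', A'). pairs A \<subseteq> pairs A' \<and> pairs A' \<subseteq> W \<and> S1 \<union> S2 \<subseteq> pairs A')"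
      by (rule ok_conseq) (use 1 in auto)
  qed
qed

lemma adds_For:
  assumes "y \<in> F" "i \<notin> F" "i \<notin> mods c"
    and body: "\<And>j. j < f y \<Longrightarrow> adds x W C (insert i F) (f(i := j)) c k (S j)"
    and "mods c \<inter> F = {}"
  shows "adds x W C F f (For i y c) (f y * (k + 3) + 3) (\<Union>j<f y. S j)"
  unfolding adds_def
proof (intro conjI allI impI)
  show "mods (For i y c) \<inter> F = {}" using assms by auto
  fix R A assume a: "\<forall>r\<in>F. R r = f r" "C \<subseteq> pairs A" "pairs A \<subseteq> W"
  let ?Inv = "\<lambda>n (R' :: nat \<Rightarrow> nat, A'). pairs A \<subseteq> pairs A' \<and> pairs A' \<subseteq> W \<and> (\<Union>j<n. S j) \<subseteq> pairs A'"
  have y: "R y = f y" using a assms by simp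
  have iy: "y \<notin> mods c" "i \<noteq> y" using assms(1,2,5) by auto
  have "ok x (For i y c) (R y * (k + 3) + 3) (R, A) (\<lambda>s. ?Inv (R y) s \<and> fst s i = R y)"
  proof (rule ok_For)
    fix j R' A'
    assume b: "j < R y" "?Inv j (R', A')" "R' i = j" "\<And>r. r \<notin> insert i (mods c) \<Longrightarrow> R' r = R r"
    have "\<forall>r\<in>F. R' r = f r"
      by (rule registers_unchanged[OF a(1), of "insert i (mods c)"]) (use b(4) assms in auto)
    then have "\<forall>r\<in>insert i F. R' r = (f(i := j)) r" using b(3) assms(2) by auto
    then have "ok x c k (R', A') (\<lambda>(R'', A''). pairs A' \<subseteq> pairs A'' \<and> pairs A'' \<subseteq> W \<and> S j \<subseteq> pairs A'')"
      using body[of j] b a y by (auto simp: adds_def)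
    then show "ok x c k (R', A') (\<lambda>(R'', A''). ?Inv (Suc j) (R''(i := Suc j), A''))"
    proof (rule ok_conseq[OF _ order.refl])
      fix R1 :: "nat \<Rightarrow> nat" and A1
      assume "case (R1, A1) of (R'', A'') \<Rightarrow> pairs A' \<subseteq> pairs A'' \<and> pairs A'' \<subseteq> W \<and> S j \<subseteq> pairs A''"
      then have 1: "pairs A' \<subseteq> pairs A1" "pairs A1 \<subseteq> W" "S j \<subseteq> pairs A1" by auto
      have 2: "pairs A \<subseteq> pairs A'" "(\<Union>l<j. S l) \<subseteq> pairs A'" using b(2) by auto
      have "(\<Union>l<Suc j. S l) = S j \<union> (\<Union>l<j. S l)" by (simp add: lessThan_Suc)
      then show "case (R1, A1) of (R'', A'') \<Rightarrow> ?Inv (Suc j) (R''(i := Suc j), A'')"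
        using 1 2 by (simp only: prod.case) (meson Un_least subset_trans)
    qed
  qed (use assms(3) iy a in simp_all)
  then show "ok x (For i y c) (f y * (k + 3) + 3) (R, A)
     (\<lambda>(R', A'). pairs A \<subseteq> pairs A' \<and> pairs A' \<subseteq> W \<and> (\<Union>j<f y. S j) \<subseteq> pairs A')"
    by (rule ok_conseq) (auto simp: y)
qed

lemma adds_let:
  assumes "\<And>R. (\<forall>r\<in>F. R r = f r) \<Longrightarrow> sets x c k1 R w v" "mods c \<inter> F = {}"
    and "adds x W C (insert w F) (f(w := v)) d k2 S" "w \<notin> F"
  shows "adds x W C F f (c ;; d) (k1 + k2 + 1) S"
  unfolding adds_def
proof (intro conjI allI impI)
  show "mods (c ;; d) \<inter> F = {}" using assms by (auto simp: adds_def)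
  fix R A assume a: "\<forall>r\<in>F. R r = f r" "C \<subseteq> pairs A" "pairs A \<subseteq> W"
  show "ok x (c ;; d) (k1 + k2 + 1) (R, A)
    (\<lambda>(R', A'). pairs A \<subseteq> pairs A' \<and> pairs A' \<subseteq> W \<and> S \<subseteq> pairs A')"
  proof (rule ok_Seq)
    show "ok x c k1 (R, A) (\<lambda>(R', A'). A' = A \<and> R' w = v)"
      using assms(1)[OF a(1)] by (simp add: sets_def)
    fix R1 A1 assume 1: "case (R1, A1) of (R', A') \<Rightarrow> A' = A \<and> R' w = v"
      "\<And>r. r \<notin> mods c \<Longrightarrow> R1 r = fst (R, A) r"
    have "\<forall>r\<in>F. R1 r = f r"
      by (rule registers_unchanged[OF a(1), of "mods c"]) (use 1(2) assms(2) in auto)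
    then have "\<forall>r\<in>insert w F. R1 r = (f(w := v)) r" using 1(1) assms(4) by auto
    then show "ok x d k2 (R1, A1) (\<lambda>(R', A'). pairs A \<subseteq> pairs A' \<and> pairs A' \<subseteq> W \<and> S \<subseteq> pairs A')"
      using assms(3) a 1 by (auto simp: adds_def)
  qed
qed

lemma adds_If:
  assumes "\<And>R A. (\<forall>r\<in>F. R r = f r) \<Longrightarrow> test_val x b (R, A) \<longleftrightarrow> P"
    and "P \<Longrightarrow> adds x W C F f c k S" "mods c \<inter> F = {}" "1 \<le> k"
  shows "adds x W C F f (If b c Skip) (k + 1) (if P then S else {})"
  unfolding adds_def
proof (intro conjI allI impI)
  show "mods (If b c Skip) \<inter> F = {}" using assms by auto
  fix R A assume a: "\<forall>r\<in>F. R r = f r" "C \<subseteq> pairs A" "pairs A \<subseteq> W"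
  show "ok x (If b c Skip) (k + 1) (R, A)
    (\<lambda>(R', A'). pairs A \<subseteq> pairs A' \<and> pairs A' \<subseteq> W \<and> (if P then S else {}) \<subseteq> pairs A')"
    by (rule ok_If)
      (use assms(1)[OF a(1)] assms(2,4) a in \<open>auto simp: adds_def intro: ok_Skip\<close>)
qed

lemma adds_Ifnot:
  assumes "\<And>R A. (\<forall>r\<in>F. R r = f r) \<Longrightarrow> test_val x b (R, A) \<longleftrightarrow> \<not> P"
    and "P \<Longrightarrow> adds x W C F f c k S" "mods c \<inter> F = {}" "1 \<le> k"
  shows "adds x W C F f (If b Skip c) (k + 1) (if P then S else {})"
  unfolding adds_def
proof (intro conjI allI impI)
  show "mods (If b Skip c) \<inter> F = {}" using assms by auto
  fix R A assume a: "\<forall>r\<in>F. R r = f r" "C \<subseteq> pairs A" "pairs A \<subseteq> W"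
  show "ok x (If b Skip c) (k + 1) (R, A)
    (\<lambda>(R', A'). pairs A \<subseteq> pairs A' \<and> pairs A' \<subseteq> W \<and> (if P then S else {}) \<subseteq> pairs A')"
    by (rule ok_If)
      (use assms(1)[OF a(1)] assms(2,4) a in \<open>auto simp: adds_def intro: ok_Skip\<close>)
qed

fun seqs :: "'b com list \<Rightarrow> 'b com" where
  "seqs [] = Skip"
| "seqs (c # cs) = c ;; seqs cs"

lemma mods_seqs: "mods (seqs cs) = (\<Union>c\<in>set cs. mods c)"
  by (induction cs) auto

lemma adds_seqs:
  assumes "\<And>a. a \<in> set as \<Longrightarrow> adds x W C F f (g a) k (S a)"
  shows "adds x W C F f (seqs (map g as)) (length as * (k + 1) + 1) (\<Union>a\<in>set as. S a)"
  using assms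
proof (induction as)
  case Nil
  then show ?case using adds_Skip by simp
next
  case (Cons a as)
  have "adds x W C F f (g a ;; seqs (map g as)) (k + (length as * (k + 1) + 1) + 1) (S a \<union> (\<Union>a\<in>set as. S a))"
    by (rule adds_Seq) (use Cons in auto)
  then show ?case by (rule_tac adds_mono) auto
qed

definition pair_cost :: "nat \<Rightarrow> nat" where
  "pair_cost z = z * (6 * z + 6) + 12 * z + 33"

lemma pair_cost_pos: "1 \<le> pair_cost z"
  by (simp add: pair_cost_def)

definition mark :: "nat \<Rightarrow> nat \<Rightarrow> 'b com" where
  "mark u v = address u v ;; SetA 12"

definition ifmarked :: "nat \<Rightarrow> nat \<Rightarrow> 'b com \<Rightarrow> 'b com" where
  "ifmarked u v c = address u v ;; If (Arr 12) c Skip"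

lemma mods_mark: "mods (mark u v) \<subseteq> {12, 13, 14, 15}"
  using mods_address[of u v] by (auto simp: mark_def)

lemma mods_ifmarked: "mods (ifmarked u v c) \<subseteq> {12, 13, 14, 15} \<union> mods c"
  using mods_address[of u v] by (auto simp: ifmarked_def)

lemma adds_mark:
  assumes "u \<in> F" "v \<in> F" "F \<inter> {12, 13, 14, 15} = {}" "f u + f v \<le> z" "(f u, f v) \<in> W"
  shows "adds x W C F f (mark u v) (pair_cost z) {(f u, f v)}"
  unfolding adds_def
proof (intro conjI allI impI)
  show "mods (mark u v) \<inter> F = {}" using mods_mark assms by blast
  fix R A assume a: "\<forall>r\<in>F. R r = f r" "C \<subseteq> pairs A" "pairs A \<subseteq> W"
  have uv: "u \<notin> {12, 13, 14, 15}" "v \<notin> {12, 13, 14, 15}" using assms by auto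
  have "ok x (mark u v) ((z * (6 * z + 6) + 12 * z + 30) + 1 + 1) (R, A)
    (\<lambda>(R', A'). A' = insert (pr (f u) (f v)) A)"
    unfolding mark_def
  proof (rule ok_Seq)
    show "ok x (address u v) (z * (6 * z + 6) + 12 * z + 30) (R, A) (\<lambda>(R', A'). A' = A \<and> R' 12 = pr (f u) (f v))"
      using sets_address[OF uv, of R z x] a assms by (simp add: sets_def)
  qed (auto intro!: ok_SetA)
  then show "ok x (mark u v) (pair_cost z) (R, A)
     (\<lambda>(R', A'). pairs A \<subseteq> pairs A' \<and> pairs A' \<subseteq> W \<and> {(f u, f v)} \<subseteq> pairs A')"
    by (rule ok_conseq) (use a assms in \<open>auto simp: pair_cost_def pairs_insert\<close>)
qed

text \<open>The array may have grown since entry, so the test is known only from two sides: a marked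
  pair lies in \<open>W\<close>, which justifies what the body adds, and an unmarked pair is not in
  \<open>C\<close>, so nothing is owed.\<close>

lemma adds_ifmarked:
  assumes "u \<in> F" "v \<in> F" "F \<inter> {12, 13, 14, 15} = {}" "f u + f v \<le> z"
    and "(f u, f v) \<in> W \<Longrightarrow> adds x W C F f c k S" "mods c \<inter> F = {}" "1 \<le> k"
  shows "adds x W C F f (ifmarked u v c) (pair_cost z + k) (if (f u, f v) \<in> C then S else {})"
  unfolding adds_def
proof (intro conjI allI impI)
  show "mods (ifmarked u v c) \<inter> F = {}" using mods_ifmarked assms by blast
  fix R A assume a: "\<forall>r\<in>F. R r = f r" "C \<subseteq> pairs A" "pairs A \<subseteq> W"
  have uv: "u \<notin> {12, 13, 14, 15}" "v \<notin> {12, 13, 14, 15}" using assms by auto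
  let ?S = "if (f u, f v) \<in> C then S else {}"
  have "ok x (ifmarked u v c) ((z * (6 * z + 6) + 12 * z + 30) + (k + 1) + 1) (R, A)
    (\<lambda>(R', A'). pairs A \<subseteq> pairs A' \<and> pairs A' \<subseteq> W \<and> ?S \<subseteq> pairs A')"
    unfolding ifmarked_def
  proof (rule ok_Seq)
    show "ok x (address u v) (z * (6 * z + 6) + 12 * z + 30) (R, A) (\<lambda>(R', A'). A' = A \<and> R' 12 = pr (f u) (f v))"
      using sets_address[OF uv, of R z x] a assms by (simp add: sets_def)
    fix R1 A1
    assume 1: "case (R1, A1) of (R', A') \<Rightarrow> A' = A \<and> R' 12 = pr (f u) (f v)"
      "\<And>r. r \<notin> mods (address u v) \<Longrightarrow> R1 r = fst (R, A) r"
    have f: "\<forall>r\<in>F. R1 r = f r"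
      by (rule registers_unchanged[OF a(1), of "mods (address u v)"])
        (use 1(2) mods_address[of u v] assms(3) in auto)
    show "ok x (If (Arr 12) c Skip) (k + 1) (R1, A1)
      (\<lambda>(R', A'). pairs A \<subseteq> pairs A' \<and> pairs A' \<subseteq> W \<and> ?S \<subseteq> pairs A')"
    proof (rule ok_If)
      assume "test_val x (Arr 12) (R1, A1)"
      then have "(f u, f v) \<in> W" using 1 a by (auto simp: pairs_def)
      from assms(5)[OF this] f 1 a
      have "ok x c k (R1, A1) (\<lambda>(R', A'). pairs A \<subseteq> pairs A' \<and> pairs A' \<subseteq> W \<and> S \<subseteq> pairs A')"
        by (auto simp: adds_def)
      then show "ok x c k (R1, A1) (\<lambda>(R', A'). pairs A \<subseteq> pairs A' \<and> pairs A' \<subseteq> W \<and> ?S \<subseteq> pairs A')"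
        by (rule ok_conseq) auto
    next
      assume "\<not> test_val x (Arr 12) (R1, A1)"
      then have "(f u, f v) \<notin> C" using 1 a by (auto simp: pairs_def)
      then show "ok x Skip k (R1, A1) (\<lambda>(R', A'). pairs A \<subseteq> pairs A' \<and> pairs A' \<subseteq> W \<and> ?S \<subseteq> pairs A')"
        using a 1 assms(7) by (intro ok_Skip) auto
    qed
  qed
  then show "ok x (ifmarked u v c) (pair_cost z + k) (R, A)
     (\<lambda>(R', A'). pairs A \<subseteq> pairs A' \<and> pairs A' \<subseteq> W \<and> ?S \<subseteq> pairs A')"
    by (rule ok_conseq) (auto simp: pair_cost_def)
qed

section \<open>Saturation under the closure rules\<close>

section \<open>The saturation program\<close>

text \<open>\<open>U\<close> allows for two uses: completeness has the rules only for numbers below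
  \<open>V\<close>, while soundness takes \<open>U\<close> to be all numbers, since the program may
  write pairs beyond \<open>V\<close>.\<close>

definition rules_closed :: "nat \<Rightarrow> nat \<Rightarrow> nat list \<Rightarrow> (nat \<times> nat \<times> nat) list \<Rightarrow> nat set \<Rightarrow> (nat \<times> nat) set \<Rightarrow> bool" where
  "rules_closed M B ds ts U Z \<longleftrightarrow>
     (\<forall>s\<in>U. \<forall>m\<in>U. \<forall>t\<in>U. (s, m) \<in> Z \<longrightarrow> (m, t) \<in> Z \<longrightarrow> (s, t) \<in> Z) \<and>
     (\<forall>a\<in>set ds. \<forall>s\<in>U. \<forall>t\<in>U. M \<le> s \<longrightarrow> M \<le> t \<longrightarrow> s * B + a \<in> U \<longrightarrow> t * B + a \<in> U \<longrightarrow>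
        (s, t) \<in> Z \<longleftrightarrow> (s * B + a, t * B + a) \<in> Z) \<and>
     (\<forall>(a, b, c)\<in>set ts. \<forall>s\<in>U. M \<le> s \<longrightarrow> (s * B + a) * B + b \<in> U \<longrightarrow> s * B + c \<in> U \<longrightarrow>
        ((s * B + a) * B + b, s * B + c) \<in> Z \<and> (s * B + c, (s * B + a) * B + b) \<in> Z)"

text \<open>Written with the same nesting of unions and conditionals as the loops and tests of the
  program, so that the rules for \<open>adds\<close> produce it directly.\<close>

definition one_step :: "nat \<Rightarrow> nat \<Rightarrow> nat list \<Rightarrow> (nat \<times> nat \<times> nat) list \<Rightarrow> nat \<Rightarrow> (nat \<times> nat) set \<Rightarrow> (nat \<times> nat) set" where
  "one_step M B ds ts V C =
     (\<Union>s<V. \<Union>m<V. \<Union>t<V. if (s, m) \<in> C then if (m, t) \<in> C then {(s, t)} else {} else {}) \<union>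
     ((\<Union>s<V. \<Union>t<V. if M \<le> s then if M \<le> t then \<Union>a\<in>set ds.
        (if (s, t) \<in> C then {(s * B + a, t * B + a)} else {}) \<union>
        (if (s * B + a, t * B + a) \<in> C then {(s, t)} else {}) else {} else {}) \<union>
     (\<Union>s<V. if M \<le> s then \<Union>(a, b, c)\<in>set ts.
        {((s * B + a) * B + b, s * B + c)} \<union> {(s * B + c, (s * B + a) * B + b)} else {}))"

text \<open>\<open>C\<close> is the array before a round and \<open>C'\<close> after it; if nothing
  new appeared below \<open>V\<close>, everything the rules demand there was present
  already.\<close>

lemma closed_one_step:
  assumes "one_step M B ds ts V C \<subseteq> C'" "C' \<inter> {..<V} \<times> {..<V} = C \<inter> {..<V} \<times> {..<V}"
  shows "rules_closed M B ds ts {..<V} (C \<inter> {..<V} \<times> {..<V})"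
proof -
  have in1: "(s, t) \<in> C \<inter> {..<V} \<times> {..<V}" if "(s, t) \<in> one_step M B ds ts V C" "s < V" "t < V" for s t
    using assms that by blast
  show ?thesis
    unfolding rules_closed_def
  proof (intro conjI ballI impI, goal_cases)
    case (1 s m t)
    then show ?case by (intro in1) (auto simp: one_step_def split: if_splits)
  next
    case (2 a s t)
    show ?case
    proof
      assume "(s, t) \<in> C \<inter> {..<V} \<times> {..<V}"
      then show "(s * B + a, t * B + a) \<in> C \<inter> {..<V} \<times> {..<V}"
        using 2 by (intro in1) (auto simp: one_step_def split: if_splits)
    next
      assume "(s * B + a, t * B + a) \<in> C \<inter> {..<V} \<times> {..<V}"
      then show "(s, t) \<in> C \<inter> {..<V} \<times> {..<V}"
        using 2 by (intro in1) (auto simp: one_step_def split: if_splits)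
    qed
  next
    case (3 x)
    obtain a b c where x: "x = (a, b, c)" by (cases x)
    show ?case
      unfolding x prod.case
    proof (intro ballI impI conjI)
      fix s assume s: "s \<in> {..<V}" "M \<le> s" "(s * B + a) * B + b \<in> {..<V}" "s * B + c \<in> {..<V}"
      have "(\<Union>(a, b, c)\<in>set ts. {((s * B + a) * B + b, s * B + c)} \<union> {(s * B + c, (s * B + a) * B + b)})
          \<subseteq> one_step M B ds ts V C"
        using s(1,2) unfolding one_step_def by auto
      moreover have "(a, b, c) \<in> set ts" using 3 x by simp
      ultimately have "((s * B + a) * B + b, s * B + c) \<in> one_step M B ds ts V C"
        "(s * B + c, (s * B + a) * B + b) \<in> one_step M B ds ts V C" by blast+
      then show "((s * B + a) * B + b, s * B + c) \<in> C \<inter> {..<V} \<times> {..<V}"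
        "(s * B + c, (s * B + a) * B + b) \<in> C \<inter> {..<V} \<times> {..<V}"
        using in1 s by auto
    qed
  qed
qed

definition sumreg :: "nat \<Rightarrow> nat \<Rightarrow> nat \<Rightarrow> 'b com" where
  "sumreg a p q = affine a p 1 0 ;; addmul 14 a q 1"

lemma mods_sumreg: "mods (sumreg a p q) \<subseteq> {14, a}"
  using mods_affine[of a p 1 0] mods_addmul[of 14 a q 1] by (auto simp: sumreg_def)

lemma sets_sumreg:
  assumes "a \<noteq> 14" "p \<noteq> 14" "q \<noteq> 14" "a \<noteq> p" "a \<noteq> q"
  shows "sets x (sumreg a p q) ((R p + R q) * 6 + 11) R a (R p + R q)"
proof -
  have "sets x (sumreg a p q) ((R p * (2 * 1 + 4) + 2 * 0 + 7) + (R q * (2 * 1 + 4) + 3) + 1) R a (R p + R q)"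
    unfolding sumreg_def
  proof (rule sets_Seq[OF sets_affine])
    fix R' assume R': "R' a = R p * 1 + 0" "\<And>r. r \<notin> mods (affine a p 1 0) \<Longrightarrow> R' r = R r"
    have "R' q = R q" using R'(2)[of q] mods_affine[of a p 1 0] assms by auto
    then show "sets x (addmul 14 a q 1) (R q * (2 * 1 + 4) + 3) R' a (R p + R q)"
      using sets_addmul[of 14 a q x 1 R'] R' assms by simp
  qed (use assms in auto)
  then show ?thesis by (rule sets_mono) auto
qed

text \<open>Registers: 0 answer, 1 input length, 2 \<open>M\<close>, 3 \<open>V\<close>, 4 and 5 starts of the current and the previous
  block, 6 input position, 7 to 11 loop indices, 12 to 18 scratch (the address of a pair is computed in
  12), 21 to 23 nodes of the graph, from 30 on loop indices for computing \<open>V\<close>.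

  Parameters: base \<open>B\<close>, digits \<open>ds\<close> and the digit \<open>e\<close> of the identity, multiplication table \<open>ts\<close>, the
  letters \<open>ls\<close> with their digits and those of their inverses, and the exponent \<open>p\<close> in \<open>V = M ^ p\<close>.\<close>

locale ssp_program =
  fixes B e :: nat and ds :: "nat list" and ts :: "(nat \<times> nat \<times> nat) list"
    and ls :: "('l \<times> nat \<times> nat) list" and p :: nat
  assumes e: "e \<le> B" and ds: "\<And>a. a \<in> set ds \<Longrightarrow> a \<le> B"
    and ts: "\<And>a b c. (a, b, c) \<in> set ts \<Longrightarrow> a \<le> B \<and> b \<le> B \<and> c \<le> B"
    and ls: "\<And>l d d'. (l, d, d') \<in> set ls \<Longrightarrow> d \<le> B \<and> d' \<le> B"
begin

definition emit :: "nat \<Rightarrow> nat \<Rightarrow> nat \<Rightarrow> 'l option com" where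
  "emit u v d = sumreg 18 2 u ;; affine 16 18 B d ;; sumreg 17 2 v ;; mark 16 17"

definition emit_cost :: "nat \<Rightarrow> nat" where
  "emit_cost z = 12 * z + z * (2 * B + 4) + 2 * B + 50 + pair_cost (z * B + B + z)"

lemma mods_emit: "mods (emit u v d) \<subseteq> {12..18}"
  using mods_sumreg[of 18 2 u] mods_sumreg[of 17 2 v] mods_affine[of 16 18 B d] mods_mark[of 16 17]
  by (auto simp: emit_def)

lemma adds_emit:
  assumes "2 \<in> F" "u \<in> F" "v \<in> F" "F \<inter> {12..18} = {}" "f 2 + f u \<le> z" "f 2 + f v \<le> z" "d \<le> B"
    and "((f 2 + f u) * B + d, f 2 + f v) \<in> W"
  shows "adds x W C F f (emit u v d) (emit_cost z) {((f 2 + f u) * B + d, f 2 + f v)}"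
proof -
  let ?s = "f 2 + f u" and ?t = "f 2 + f v"
  have nin: "{12, 13, 14, 15, 16, 17, 18} \<inter> F = {}" using assms(4) by auto
  have uv: "u \<noteq> 14" "v \<noteq> 14" "u \<noteq> 16" "v \<noteq> 16" "u \<noteq> 17" "v \<noteq> 17" "u \<noteq> 18" "v \<noteq> 18"
    using nin assms(1-3) by auto
  have main: "adds x W C F f (emit u v d)
    ((?s * 6 + 11) + ((?s * (2 * B + 4) + 2 * d + 7) + ((?t * 6 + 11) + pair_cost (z * B + B + z) + 1) + 1) + 1)
    {(?s * B + d, ?t)}"
    unfolding emit_def
  proof (rule adds_let[where w = 18 and v = ?s], goal_cases)
    case (1 R)
    then show ?case using sets_sumreg[of 18 2 u x R] uv assms by simp
  next
    case 3
    show ?case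
    proof (rule adds_let[where w = 16 and v = "?s * B + d"], goal_cases)
      case (1 R)
      then show ?case using sets_affine[of 16 18 x B d R] by simp
    next
      case 3
      show ?case
      proof (rule adds_let[where w = 17 and v = ?t], goal_cases)
        case (1 R)
        then show ?case using sets_sumreg[of 17 2 v x R] uv assms by simp
      next
        case 3
        let ?F = "insert 17 (insert 16 (insert 18 F))"
        let ?f = "f(18 := ?s, 16 := ?s * B + d, 17 := ?t)"
        have "?s * B + d + ?t \<le> z * B + B + z"
          by (intro add_le_mono mult_le_mono1 assms(5-7))
        then have "adds x W C ?F ?f (mark 16 17) (pair_cost (z * B + B + z)) {(?f 16, ?f 17)}"
          by (intro adds_mark) (use nin assms(8) in simp_all)
        then show ?case by simp
      qed (use nin mods_sumreg[of 17 2 v] in auto)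
    qed (use nin mods_affine[of 16 18 B d] in auto)
  qed (use nin mods_sumreg[of 18 2 u] in auto)
  have cost: "(?s * 6 + 11) + ((?s * (2 * B + 4) + 2 * d + 7) + ((?t * 6 + 11) + pair_cost (z * B + B + z) + 1) + 1) + 1
      \<le> (z * 6 + 11) + ((z * (2 * B + 4) + 2 * B + 7) + ((z * 6 + 11) + pair_cost (z * B + B + z) + 1) + 1) + 1"
    by (intro add_le_mono mult_le_mono1 mult_le_mono2 assms(5-7)) simp_all
  show ?thesis
    by (rule adds_mono[OF main order_trans[OF cost]]) (simp_all add: emit_cost_def)
qed

definition trans_step :: "'l option com" where
  "trans_step = For 7 3 (For 8 3 (For 9 3 (ifmarked 7 8 (ifmarked 8 9 (mark 7 9)))))"

definition shift_at :: "nat \<Rightarrow> 'l option com" where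
  "shift_at a = affine 16 7 B a ;; affine 17 9 B a ;; ifmarked 7 9 (mark 16 17) ;; ifmarked 16 17 (mark 7 9)"

definition shift_step :: "'l option com" where
  "shift_step = For 7 3 (For 9 3 (If (Less 7 2) Skip (If (Less 9 2) Skip (seqs (map shift_at ds)))))"

definition rel_at :: "nat \<times> nat \<times> nat \<Rightarrow> 'l option com" where
  "rel_at = (\<lambda>(a, b, c). affine 18 7 B a ;; affine 16 18 B b ;; affine 17 7 B c ;; mark 16 17 ;; mark 17 16)"

definition rel_step :: "'l option com" where
  "rel_step = For 7 3 (If (Less 7 2) Skip (seqs (map rel_at ts)))"

definition loop_cost :: "nat \<Rightarrow> nat \<Rightarrow> nat" where
  "loop_cost V k = V * (k + 3) + 3"

text \<open>Bounds the sum of the two numbers of any pair addressed, at most two digits beyond a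
  number below \<open>V\<close>; the cost of computing an address depends on this sum.\<close>

definition max_sum :: "nat \<Rightarrow> nat" where
  "max_sum V = 2 * ((V * B + B) * B + B) + 2 * V"

definition affine_cost :: "nat \<Rightarrow> nat" where
  "affine_cost V = (V * B + B + V) * (2 * B + 4) + 2 * B + 7"

definition trans_cost :: "nat \<Rightarrow> nat" where
  "trans_cost V = loop_cost V (loop_cost V (loop_cost V (3 * pair_cost (max_sum V))))"

definition shift_cost :: "nat \<Rightarrow> nat" where
  "shift_cost V = loop_cost V (loop_cost V (length ds * ((2 * affine_cost V + 4 * pair_cost (max_sum V) + 3) + 1) + 1 + 1 + 1))"

definition rel_cost :: "nat \<Rightarrow> nat" where
  "rel_cost V = loop_cost V (length ts * ((3 * affine_cost V + 2 * pair_cost (max_sum V) + 4) + 1) + 1 + 1)"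

lemma sets_affine_le:
  assumes "a \<noteq> 14" "y \<noteq> 14" "a \<noteq> y" "R y \<le> V * B + B + V" "d \<le> B"
  shows "sets x (affine a y B d) (affine_cost V) R a (R y * B + d)"
proof (rule sets_mono[OF sets_affine[OF assms(1-3)]])
  have "R y * (2 * B + 4) \<le> (V * B + B + V) * (2 * B + 4)" by (rule mult_le_mono1[OF assms(4)])
  then show "R y * (2 * B + 4) + 2 * d + 7 \<le> affine_cost V"
    unfolding affine_cost_def by (intro add_le_mono mult_le_mono2 assms(5)) simp_all
qed simp

lemma add_le_double: "a \<le> q \<Longrightarrow> b \<le> q \<Longrightarrow> a + b \<le> 2 * q + r" for a b q r :: nat
  by simp

lemma max_sum_ge: "2 * (V * B + B) + 2 * V \<le> max_sum V"
proof -
  have "V * B + B \<le> (V * B + B) * B + B" by (cases B) auto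
  then show ?thesis unfolding max_sum_def by (rule add_le_mono1[OF mult_le_mono2])
qed

lemma adds_trans_step:
  assumes "3 \<in> F" "F \<inter> {7..18} = {}" "f 3 = V"
    and W: "\<And>s m t. (s, m) \<in> W \<Longrightarrow> (m, t) \<in> W \<Longrightarrow> (s, t) \<in> W"
  shows "adds x W C F f trans_step (trans_cost V)
    (\<Union>s<V. \<Union>m<V. \<Union>t<V. if (s, m) \<in> C then if (m, t) \<in> C then {(s, t)} else {} else {})"
proof -
  have nin: "{7, 8, 9, 10, 11, 12, 13, 14, 15, 16, 17, 18} \<inter> F = {}" using assms(2) by auto
  let ?c1 = "ifmarked 8 9 (mark 7 9) :: 'l option com"
  let ?c = "ifmarked 7 8 ?c1 :: 'l option com"
  let ?z = "pair_cost (max_sum V)"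
  have m: "mods (mark 7 9 :: 'l option com) \<subseteq> {12, 13, 14, 15}" "mods ?c1 \<subseteq> {12, 13, 14, 15}"
    "mods ?c \<subseteq> {12, 13, 14, 15}"
    using mods_mark[of 7 9] mods_ifmarked[of 8 9 "mark 7 9"] mods_ifmarked[of 7 8 ?c1] by blast+
  have inner: "adds x W C (insert 9 (insert 8 (insert 7 F))) (f(7 := s, 8 := n, 9 := t)) ?c (?z + (?z + ?z))
    (if (s, n) \<in> C then if (n, t) \<in> C then {(s, t)} else {} else {})"
    if "s < V" "n < V" "t < V" for s n t
  proof -
    let ?F = "insert 9 (insert 8 (insert 7 F))" and ?f = "f(7 := s, 8 := n, 9 := t)"
    have d: "?F \<inter> {12, 13, 14, 15} = {}" using nin by auto
    have le: "s + n \<le> max_sum V" "n + t \<le> max_sum V" "s + t \<le> max_sum V"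
      using that by (auto simp: max_sum_def)
    have "adds x W C ?F ?f ?c (?z + (?z + ?z))
      (if (?f 7, ?f 8) \<in> C then if (?f 8, ?f 9) \<in> C then {(?f 7, ?f 9)} else {} else {})"
    proof (rule adds_ifmarked)
      assume 1: "(?f 7, ?f 8) \<in> W"
      show "adds x W C ?F ?f ?c1 (?z + ?z) (if (?f 8, ?f 9) \<in> C then {(?f 7, ?f 9)} else {})"
      proof (rule adds_ifmarked)
        assume "(?f 8, ?f 9) \<in> W"
        then have "(?f 7, ?f 9) \<in> W" using W 1 by blast
        then show "adds x W C ?F ?f (mark 7 9) ?z {(?f 7, ?f 9)}"
          by (intro adds_mark) (use d le in auto)
      qed (use d le m pair_cost_pos in auto)
    qed (use d le m pair_cost_pos in \<open>auto intro: trans_le_add1\<close>)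
    then show ?thesis by (rule adds_mono) auto
  qed
  have "adds x W C F f trans_step (f 3 * ((f 3 * ((f 3 * ((?z + (?z + ?z)) + 3) + 3) + 3) + 3) + 3) + 3)
    (\<Union>s<f 3. \<Union>m<f 3. \<Union>t<f 3. if (s, m) \<in> C then if (m, t) \<in> C then {(s, t)} else {} else {})"
    unfolding trans_step_def
  proof (rule adds_For, goal_cases)
    case (4 s)
    have "adds x W C (insert 7 F) (f(7 := s)) (For 8 3 (For 9 3 ?c))
      ((f(7 := s)) 3 * (((f(7 := s)) 3 * ((?z + (?z + ?z)) + 3) + 3) + 3) + 3)
      (\<Union>m<(f(7 := s)) 3. \<Union>t<(f(7 := s)) 3. if (s, m) \<in> C then if (m, t) \<in> C then {(s, t)} else {} else {})"
    proof (rule adds_For, goal_cases)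
      case (4 n)
      have "adds x W C (insert 8 (insert 7 F)) (f(7 := s, 8 := n)) (For 9 3 ?c)
        ((f(7 := s, 8 := n)) 3 * ((?z + (?z + ?z)) + 3) + 3)
        (\<Union>t<(f(7 := s, 8 := n)) 3. if (s, n) \<in> C then if (n, t) \<in> C then {(s, t)} else {} else {})"
      proof (rule adds_For, goal_cases)
        case (4 t)
        then show ?case using inner[of s n t] \<open>s < f 3\<close> \<open>n < _\<close> assms(3) by simp
      qed (use nin assms(1) m in auto)
      then show ?case by simp
    qed (use nin assms(1) m in auto)
    then show ?case by simp
  qed (use nin assms(1) m in auto)
  then show ?thesis
    by (rule adds_mono) (simp_all add: assms(3) trans_cost_def loop_cost_def)
qed

lemma mods_shift_at: "mods (shift_at a) \<subseteq> {12, 13, 14, 15, 16, 17, 18}"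
  using mods_affine[of 16 7 B a] mods_affine[of 17 9 B a] mods_mark[of 16 17] mods_mark[of 7 9]
    mods_ifmarked[of 7 9 "mark 16 17"] mods_ifmarked[of 16 17 "mark 7 9"]
  unfolding shift_at_def mods.simps by blast

lemma adds_shift_at:
  assumes "{2, 3, 7, 9} \<subseteq> F" "F \<inter> {12..18} = {}" "f 7 = s" "f 9 = t" "s < V" "t < V" "a \<le> B"
    and W: "(s, t) \<in> W \<longleftrightarrow> (s * B + a, t * B + a) \<in> W"
  shows "adds x W C F f (shift_at a) (2 * affine_cost V + 4 * pair_cost (max_sum V) + 3)
    ((if (s, t) \<in> C then {(s * B + a, t * B + a)} else {}) \<union>
     (if (s * B + a, t * B + a) \<in> C then {(s, t)} else {}))"
proof -
  have nin: "{12, 13, 14, 15, 16, 17, 18} \<inter> F = {}" using assms(2) by auto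
  let ?z = "pair_cost (max_sum V)" and ?k = "affine_cost V"
  let ?S = "(if (s, t) \<in> C then {(s * B + a, t * B + a)} else {}) \<union>
     (if (s * B + a, t * B + a) \<in> C then {(s, t)} else {})"
  have "s * B + a \<le> V * B + B" "t * B + a \<le> V * B + B"
    using assms(5-7) by (intro add_le_mono mult_le_mono1; simp)+
  then have le: "s + t \<le> max_sum V" "(s * B + a) + (t * B + a) \<le> max_sum V"
    using assms(5,6) max_sum_ge[of V] order_trans[OF add_le_double max_sum_ge] by auto
  have "adds x W C F f (shift_at a) (?k + (?k + ((?z + ?z) + (?z + ?z) + 1) + 1) + 1) ?S"
    unfolding shift_at_def
  proof (rule adds_let[where w = 16 and v = "s * B + a"], goal_cases)
    case (1 R)
    then show ?case using sets_affine_le[of 16 7 R V a x] assms by simp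
  next
    case 3
    show ?case
    proof (rule adds_let[where w = 17 and v = "t * B + a"], goal_cases)
      case (1 R)
      then show ?case using sets_affine_le[of 17 9 R V a x] assms by simp
    next
      case 3
      let ?F = "insert 17 (insert 16 F)" and ?f = "f(16 := s * B + a, 17 := t * B + a)"
      have d: "?F \<inter> {12, 13, 14, 15} = {}" using nin by auto
      have v: "?f 7 = s" "?f 9 = t" "?f 16 = s * B + a" "?f 17 = t * B + a"
        using assms(3,4) by auto
      have F: "7 \<in> ?F" "9 \<in> ?F" "16 \<in> ?F" "17 \<in> ?F" using assms(1) by auto
      have 1: "adds x W C ?F ?f (ifmarked 7 9 (mark 16 17)) (?z + ?z)
        (if (?f 7, ?f 9) \<in> C then {(?f 16, ?f 17)} else {})"
      proof (rule adds_ifmarked, goal_cases)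
        case 5
        then have "(?f 16, ?f 17) \<in> W" unfolding v using W by simp
        then show ?case by (intro adds_mark F d) (use v le in simp_all)
      qed (use F d v le mods_mark[of 16 17] pair_cost_pos in auto)
      have 2: "adds x W C ?F ?f (ifmarked 16 17 (mark 7 9)) (?z + ?z)
        (if (?f 16, ?f 17) \<in> C then {(?f 7, ?f 9)} else {})"
      proof (rule adds_ifmarked, goal_cases)
        case 5
        then have "(?f 7, ?f 9) \<in> W" unfolding v using W by simp
        then show ?case by (intro adds_mark F d) (use v le in simp_all)
      qed (use F d v le mods_mark[of 7 9] pair_cost_pos in auto)
      show ?case using adds_Seq[OF 1 2] unfolding v .
    qed (use nin mods_affine[of 17 9 B a] in auto)
  qed (use nin mods_affine[of 16 7 B a] in auto)
  then show ?thesis by (rule adds_mono) auto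
qed

lemma adds_shift_step:
  assumes "{2, 3} \<subseteq> F" "F \<inter> {7..18} = {}" "f 2 = M" "f 3 = V"
    and W: "\<And>s t a. a \<in> set ds \<Longrightarrow> M \<le> s \<Longrightarrow> M \<le> t \<Longrightarrow> (s, t) \<in> W \<longleftrightarrow> (s * B + a, t * B + a) \<in> W"
  shows "adds x W C F f shift_step (shift_cost V)
    (\<Union>s<V. \<Union>t<V. if M \<le> s then if M \<le> t then \<Union>a\<in>set ds.
        (if (s, t) \<in> C then {(s * B + a, t * B + a)} else {}) \<union>
        (if (s * B + a, t * B + a) \<in> C then {(s, t)} else {}) else {} else {})"
proof -
  have nin: "{7, 8, 9, 10, 11, 12, 13, 14, 15, 16, 17, 18} \<inter> F = {}" using assms(2) by auto
  let ?K = "length ds * ((2 * affine_cost V + 4 * pair_cost (max_sum V) + 3) + 1) + 1"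
  let ?S = "\<lambda>s t. if M \<le> s then if M \<le> t then \<Union>a\<in>set ds.
        (if (s, t) \<in> C then {(s * B + a, t * B + a)} else {}) \<union>
        (if (s * B + a, t * B + a) \<in> C then {(s, t)} else {}) else {} else {}"
  let ?q = "seqs (map shift_at ds)"
  let ?c = "If (Less 7 2) Skip (If (Less 9 2) Skip ?q)"
  have m: "mods ?q \<subseteq> {12, 13, 14, 15, 16, 17, 18}"
    unfolding mods_seqs using mods_shift_at by (simp add: UN_subset_iff)
  have inner: "adds x W C (insert 9 (insert 7 F)) (f(7 := s, 9 := t)) ?c (?K + 1 + 1) (?S s t)"
    if "s < V" "t < V" for s t
  proof -
    show ?thesis
    proof (rule adds_Ifnot, goal_cases)
      case 2
      show ?case
      proof (rule adds_Ifnot, goal_cases)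
        case 2
        show ?case
          by (rule adds_seqs, rule adds_shift_at) (use nin assms that ds W \<open>M \<le> s\<close> 2 in auto)
      qed (use assms m nin in auto)
    qed (use assms m nin in auto)
  qed
  have "adds x W C F f shift_step (f 3 * ((f 3 * ((?K + 1 + 1) + 3) + 3) + 3) + 3) (\<Union>s<f 3. \<Union>t<f 3. ?S s t)"
    unfolding shift_step_def
  proof (rule adds_For, goal_cases)
    case (4 s)
    have "adds x W C (insert 7 F) (f(7 := s)) (For 9 3 ?c) ((f(7 := s)) 3 * ((?K + 1 + 1) + 3) + 3)
      (\<Union>t<(f(7 := s)) 3. ?S s t)"
    proof (rule adds_For, goal_cases)
      case (4 t)
      then show ?case using inner[of s t] \<open>s < f 3\<close> assms(4) by simp
    qed (use nin assms(1) m in auto)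
    then show ?case by simp
  qed (use nin assms(1) m in auto)
  then show ?thesis
    unfolding assms(4) by (rule adds_mono) (simp_all add: shift_cost_def loop_cost_def)
qed

lemma mods_rel_at: "mods (rel_at y) \<subseteq> {12, 13, 14, 15, 16, 17, 18}"
  using mods_affine[of 18 7 B] mods_affine[of 16 18 B] mods_affine[of 17 7 B] mods_mark[of 16 17]
    mods_mark[of 17 16]
  unfolding rel_at_def by (cases y) (simp, blast)

lemma adds_rel_at:
  assumes "{2, 3, 7} \<subseteq> F" "F \<inter> {12..18} = {}" "f 7 = s" "s < V" "a \<le> B" "b \<le> B" "c \<le> B"
    and W: "((s * B + a) * B + b, s * B + c) \<in> W" "(s * B + c, (s * B + a) * B + b) \<in> W"
  shows "adds x W C F f (rel_at (a, b, c)) (3 * affine_cost V + 2 * pair_cost (max_sum V) + 4)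
    ({((s * B + a) * B + b, s * B + c)} \<union> {(s * B + c, (s * B + a) * B + b)})"
proof -
  have nin: "{12, 13, 14, 15, 16, 17, 18} \<inter> F = {}" using assms(2) by auto
  let ?z = "pair_cost (max_sum V)" and ?k = "affine_cost V"
  let ?u = "s * B + a" and ?v = "(s * B + a) * B + b" and ?w = "s * B + c"
  have 1: "s * B \<le> V * B" using assms by (auto intro: mult_le_mono1)
  then have u: "?u \<le> V * B + B" using assms(5) by linarith
  then have "?u * B \<le> (V * B + B) * B" by (rule mult_le_mono1)
  then have "?v \<le> (V * B + B) * B + B" using assms(6) by (rule add_le_mono)
  moreover have "?w \<le> (V * B + B) * B + B"
    using add_le_mono[OF 1 assms(7)] by (cases B) auto
  ultimately have le: "?v + ?w \<le> max_sum V" unfolding max_sum_def by (rule add_le_double)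
  have "adds x W C F f (rel_at (a, b, c)) (?k + (?k + (?k + (?z + ?z + 1) + 1) + 1) + 1) ({(?v, ?w)} \<union> {(?w, ?v)})"
    unfolding rel_at_def prod.case
  proof (rule adds_let[where w = 18 and v = ?u], goal_cases)
    case (1 R)
    then show ?case using sets_affine_le[of 18 7 R V a x] assms by simp
  next
    case 3
    show ?case
    proof (rule adds_let[where w = 16 and v = ?v], goal_cases)
      case (1 R)
      then show ?case using sets_affine_le[of 16 18 R V b x] u assms by simp
    next
      case 3
      show ?case
      proof (rule adds_let[where w = 17 and v = ?w], goal_cases)
        case (1 R)
        then show ?case using sets_affine_le[of 17 7 R V c x] assms by simp
      next
        case 3
        let ?F = "insert 17 (insert 16 (insert 18 F))" and ?f = "f(18 := ?u, 16 := ?v, 17 := ?w)"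
        have d: "?F \<inter> {12, 13, 14, 15} = {}" using nin by auto
        have v: "?f 16 = ?v" "?f 17 = ?w" by auto
        have F: "16 \<in> ?F" "17 \<in> ?F" by auto
        have le': "?f 16 + ?f 17 \<le> max_sum V" "?f 17 + ?f 16 \<le> max_sum V"
          using le unfolding v by linarith+
        have W': "(?f 16, ?f 17) \<in> W" "(?f 17, ?f 16) \<in> W" using W unfolding v by simp_all
        show ?case
          using adds_Seq[OF adds_mark[OF F d le'(1) W'(1)] adds_mark[OF F(2,1) d le'(2) W'(2)]]
          unfolding v .
      qed (use nin mods_affine[of 17 7 B c] in auto)
    qed (use nin mods_affine[of 16 18 B b] in auto)
  qed (use nin mods_affine[of 18 7 B a] in auto)
  then show ?thesis by (rule adds_mono) auto
qed

lemma adds_rel_step: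
  assumes "{2, 3} \<subseteq> F" "F \<inter> {7..18} = {}" "f 2 = M" "f 3 = V"
    and W: "\<And>s a b c. (a, b, c) \<in> set ts \<Longrightarrow> M \<le> s \<Longrightarrow>
      ((s * B + a) * B + b, s * B + c) \<in> W \<and> (s * B + c, (s * B + a) * B + b) \<in> W"
  shows "adds x W C F f rel_step (rel_cost V)
    (\<Union>s<V. if M \<le> s then \<Union>(a, b, c)\<in>set ts.
        {((s * B + a) * B + b, s * B + c)} \<union> {(s * B + c, (s * B + a) * B + b)} else {})"
proof -
  have nin: "{7, 8, 9, 10, 11, 12, 13, 14, 15, 16, 17, 18} \<inter> F = {}" using assms(2) by auto
  let ?K = "length ts * ((3 * affine_cost V + 2 * pair_cost (max_sum V) + 4) + 1) + 1"
  let ?S = "\<lambda>s. if M \<le> s then \<Union>y\<in>set ts. (case y of (a, b, c) \<Rightarrow>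
        {((s * B + a) * B + b, s * B + c)} \<union> {(s * B + c, (s * B + a) * B + b)}) else {}"
  let ?q = "seqs (map rel_at ts)"
  have m: "mods ?q \<subseteq> {12, 13, 14, 15, 16, 17, 18}"
    unfolding mods_seqs using mods_rel_at by (simp add: UN_subset_iff)
  have "adds x W C F f rel_step (f 3 * ((?K + 1) + 3) + 3) (\<Union>s<f 3. ?S s)"
    unfolding rel_step_def
  proof (rule adds_For, goal_cases)
    case (4 s)
    show ?case
    proof (rule adds_Ifnot, goal_cases)
      case 2
      show ?case
      proof (rule adds_seqs, goal_cases)
        case (1 y)
        obtain a b c where abc: "y = (a, b, c)" by (cases y)
        show ?case
          unfolding abc prod.case
          by (rule adds_rel_at) (use nin assms \<open>s < f 3\<close> 2 ts[of a b c] W[of a b c s] 1 abc in auto)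
      qed
    qed (use assms m nin in auto)
  qed (use nin assms(1) m in auto)
  then show ?thesis
    unfolding assms(4) by (rule adds_mono) (simp_all add: rel_cost_def loop_cost_def)
qed

lemma adds_one_step:
  assumes "{2, 3} \<subseteq> F" "F \<inter> {7..18} = {}" "f 2 = M" "f 3 = V" "rules_closed M B ds ts UNIV W"
  shows "adds x W C F f (trans_step ;; shift_step ;; rel_step)
    (trans_cost V + (shift_cost V + rel_cost V + 1) + 1) (one_step M B ds ts V C)"
  unfolding one_step_def
  by (intro adds_Seq adds_trans_step adds_shift_step adds_rel_step)
    (use assms in \<open>fastforce simp: rules_closed_def\<close>)+

end

text \<open>The exponent \<open>k\<close> is a constant, so the power is counted by \<open>k\<close>
  nested loops, each with its own counter register; the result is added to register 3.\<close>

fun powc :: "nat \<Rightarrow> 'b com" where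
  "powc 0 = Inc 3"
| "powc (Suc k) = For (30 + k) 2 (powc k)"

fun pow_cost :: "nat \<Rightarrow> nat \<Rightarrow> nat" where
  "pow_cost 0 M = 1"
| "pow_cost (Suc k) M = M * (pow_cost k M + 3) + 3"

lemma mods_powc: "mods (powc k) = insert 3 {30..<30 + k}"
proof (induction k)
  case (Suc k)
  have "{30..<30 + Suc k} = insert (30 + k) {30..<30 + k}" 
    using atLeastLessThanSuc[of 30 "30 + k"] by simp
  then show ?case using Suc by (simp only: powc.simps mods_For insert_commute)
qed simp

lemma sets_powc: "R 2 = M \<Longrightarrow> sets x (powc k) (pow_cost k M) R 3 (R 3 + M ^ k)"
proof (induction k arbitrary: R)
  case 0
  then show ?case unfolding sets_def by (auto intro: ok_Inc)
next
  case (Suc k)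
  show ?case
    unfolding sets_def
  proof
    fix A :: "nat set"
    let ?Inv = "\<lambda>j (R', A'). A' = A \<and> R' 3 = R 3 + j * M ^ k"
    have "ok x (For (30 + k) 2 (powc k)) (R 2 * (pow_cost k M + 3) + 3) (R, A)
      (\<lambda>s. ?Inv (R 2) s \<and> fst s (30 + k) = R 2)"
    proof (rule ok_For)
      fix j R' A' assume a: "?Inv j (R', A')"
        "\<And>r. r \<notin> insert (30 + k) (mods (powc k)) \<Longrightarrow> R' r = R r"
      have "R' 2 = M" using a(2)[of 2] Suc.prems by (auto simp: mods_powc)
      from Suc.IH[of R', OF this, unfolded sets_def, rule_format, of A'] a(1)
      show "ok x (powc k) (pow_cost k M) (R', A') (\<lambda>(R'', A''). ?Inv (Suc j) (R''(30 + k := Suc j), A''))"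
        by - (erule ok_conseq, auto)
    qed (auto simp: mods_powc)
    then show "ok x (powc (Suc k)) (pow_cost (Suc k) M) (R, A)
      (\<lambda>(R', A'). A' = A \<and> R' 3 = R 3 + M ^ Suc k)"
      unfolding powc.simps by (rule ok_conseq) (auto simp: Suc.prems)
  qed
qed

section \<open>Reading the input, building the graph and answering the query\<close>

lemma ok_count:
  "ok x (While (Inp 1 (\<lambda>s. s \<noteq> Blank)) (Inc 1)) (3 * length x + 1) (\<lambda>_. 0, {})
     (\<lambda>s. s = ((\<lambda>_. 0)(1 := length x), {}))"
proof -
  have "ok x (While (Inp 1 (\<lambda>s. s \<noteq> Blank)) (Inc 1)) (3 * d + 1) ((\<lambda>_. 0)(1 := j), {})
     (\<lambda>s. s = ((\<lambda>_. 0)(1 := length x), {}))" if "j + d = length x" for j d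
    using that
  proof (induction d arbitrary: j)
    case 0
    then show ?case by (intro ok_While_False) (auto simp: input_tape_def)
  next
    case (Suc d)
    have "ok x (While (Inp 1 (\<lambda>s. s \<noteq> Blank)) (Inc 1)) (1 + (3 * d + 1) + 1) ((\<lambda>_. 0)(1 := j), {})
     (\<lambda>s. s = ((\<lambda>_. 0)(1 := length x), {}))"
    proof (rule ok_While_True)
      show "ok x (Inc 1) 1 ((\<lambda>_. 0)(1 := j), {}) (\<lambda>s. s = ((\<lambda>_. 0)(1 := Suc j), {}))"
        by (rule ok_Inc) auto
      show "ok x (While (Inp 1 (\<lambda>s. s \<noteq> Blank)) (Inc 1)) (3 * d + 1) s'
        (\<lambda>s. s = ((\<lambda>_. 0)(1 := length x), {}))" if "s' = ((\<lambda>_. 0)(1 := Suc j), {})" for s'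
        unfolding that by (rule Suc.IH) (use Suc.prems in simp)
    qed (use Suc.prems in \<open>auto simp: input_tape_def\<close>)
    then show ?case by (rule ok_conseq) auto
  qed
  from this[of 0 "length x"] show ?thesis by (simp add: fun_upd_idem)
qed

text \<open>A block is a word of the encoded tuple together with its separator.\<close>

fun block_start :: "'l option list \<Rightarrow> nat \<Rightarrow> nat" where
  "block_start x 0 = 0"
| "block_start x (Suc j) = (if x ! j = None then Suc j else block_start x j)"

text \<open>At the end of a complete input \<open>block_start\<close> equals the length, and this is
  where the last word begins.\<close>

fun prev_start :: "'l option list \<Rightarrow> nat \<Rightarrow> nat" where
  "prev_start x 0 = 0"
| "prev_start x (Suc j) = (if x ! j = None then block_start x j else prev_start x j)"

lemma block_start_le: "block_start x j \<le> j"
  by (induction j) auto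

lemma prev_start_le: "prev_start x j \<le> j"
  by (induction j) (auto simp: block_start_le le_SucI)

context ssp_program
begin

definition saturate :: "'l option com" where
  "saturate = For 10 3 (For 11 3 (trans_step ;; shift_step ;; rel_step))"

definition step_cost :: "nat \<Rightarrow> nat" where
  "step_cost V = trans_cost V + (shift_cost V + rel_cost V + 1) + 1"

lemma closed_full: "rules_closed M B ds ts {..<V} ({..<V} \<times> {..<V})"
  by (auto simp: rules_closed_def)

lemma mods_step: "mods (trans_step ;; shift_step ;; rel_step) \<subseteq> {7, 8, 9, 12, 13, 14, 15, 16, 17, 18}"
proof -
  have "mods trans_step \<subseteq> {7, 8, 9, 12, 13, 14, 15, 16, 17, 18}"
    using mods_mark[of 7 9] mods_ifmarked[of 8 9 "mark 7 9"]
      mods_ifmarked[of 7 8 "ifmarked 8 9 (mark 7 9)"]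
    unfolding trans_step_def mods_For by blast
  moreover have "mods shift_step \<subseteq> {7, 8, 9, 12, 13, 14, 15, 16, 17, 18}"
    using mods_shift_at unfolding shift_step_def mods_For mods.simps mods_seqs by force
  moreover have "mods rel_step \<subseteq> {7, 8, 9, 12, 13, 14, 15, 16, 17, 18}"
    using mods_rel_at unfolding rel_step_def mods_For mods.simps mods_seqs by force
  ultimately show ?thesis by simp
qed

text \<open>A round either adds one of the \<open>V * V\<close> pairs below \<open>V\<close> or adds
  none, and then that part of the array was closed; so \<open>V * V\<close> rounds suffice without a
  test for stability.\<close>

lemma ok_saturate:
  assumes W: "rules_closed M B ds ts UNIV W" and R: "R 2 = M" "R 3 = V" and A: "I \<subseteq> pairs A" "pairs A \<subseteq> W"
  shows "ok x saturate (loop_cost V (loop_cost V (step_cost V))) (R, A)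
    (\<lambda>(R', A'). pairs A' \<subseteq> W \<and>
      (\<exists>Z\<subseteq>pairs A'. rules_closed M B ds ts {..<V} Z \<and> I \<inter> {..<V} \<times> {..<V} \<subseteq> Z))"
proof -
  let ?U = "{..<V} \<times> {..<V}"
  let ?c = "trans_step ;; shift_step ;; rel_step"
  \<comment> \<open>Later rounds are only known to stay inside \<open>W\<close>, not to add nothing;
    a closed set \<open>Z\<close> found once therefore remains as a witness, while the growing array
    need not be closed.\<close>
  define complete where
    "complete A' \<longleftrightarrow> (\<exists>Z\<subseteq>pairs A'. rules_closed M B ds ts {..<V} Z \<and> I \<inter> ?U \<subseteq> Z)" for A'
  define Inv where "Inv m A' \<longleftrightarrow> I \<subseteq> pairs A' \<and> pairs A' \<subseteq> W \<and>
    (complete A' \<or> m \<le> card (pairs A' \<inter> ?U))" for m A'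
  have body: "ok x ?c (step_cost V) (R', A') (\<lambda>(R'', A''). Inv (Suc m) A'')"
    if "Inv m A'" "R' 2 = M" "R' 3 = V" for m R' A'
  proof -
    have "adds x W (pairs A') {2, 3} R' ?c (step_cost V) (one_step M B ds ts V (pairs A'))"
      unfolding step_cost_def by (rule adds_one_step) (use that W in auto)
    then have "ok x ?c (step_cost V) (R', A') (\<lambda>(R'', A''). pairs A' \<subseteq> pairs A'' \<and> pairs A'' \<subseteq> W \<and>
      one_step M B ds ts V (pairs A') \<subseteq> pairs A'')"
      using that(1) by (auto simp: adds_def Inv_def)
    then show ?thesis
    proof (rule ok_conseq[OF _ order.refl])
      fix R'' :: "nat \<Rightarrow> nat" and A''
      assume "case (R'', A'') of (R'', A'') \<Rightarrow> pairs A' \<subseteq> pairs A'' \<and> pairs A'' \<subseteq> W \<and>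
        one_step M B ds ts V (pairs A') \<subseteq> pairs A''"
      then have 1: "pairs A' \<subseteq> pairs A''" "pairs A'' \<subseteq> W" "one_step M B ds ts V (pairs A') \<subseteq> pairs A''"
        by auto
      have "complete A'' \<or> Suc m \<le> card (pairs A'' \<inter> ?U)"
      proof (cases "complete A'")
        case True
        then show ?thesis using 1(1) unfolding complete_def by (meson subset_trans)
      next
        case False
        show ?thesis
        proof (cases "pairs A'' \<inter> ?U = pairs A' \<inter> ?U")
          case True
          have "complete A''"
            unfolding complete_def
            by (rule exI[of _ "pairs A' \<inter> ?U"])
              (use closed_one_step[OF 1(3) True] 1(1) that(1) in \<open>auto simp: Inv_def\<close>)
          then show ?thesis ..
        next
          case neq: False
          then have "card (pairs A' \<inter> ?U) < card (pairs A'' \<inter> ?U)"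
            using 1(1) by (intro psubset_card_mono) auto
          then show ?thesis using False that(1) by (auto simp: Inv_def)
        qed
      qed
      then show "case (R'', A'') of (R'', A'') \<Rightarrow> Inv (Suc m) A''"
        using 1 that(1) by (auto simp: Inv_def)
    qed
  qed
  have m: "r \<notin> mods ?c" if "r \<in> {2, 3, 10, 11}" for r using mods_step that by auto
  have "ok x (For 10 3 (For 11 3 ?c)) (R 3 * ((V * (step_cost V + 3) + 3) + 3) + 3) (R, A)
    (\<lambda>s. Inv (R 3 * V) (snd s) \<and> fst s 10 = R 3)"
  proof (rule ok_For)
    fix j R' A'
    assume a: "Inv (j * V) (snd (R', A'))" "\<And>r. r \<notin> insert 10 (mods (For 11 3 ?c)) \<Longrightarrow> R' r = R r"
    have R': "R' 2 = M" "R' 3 = V" using a(2)[of 2] a(2)[of 3] R m by auto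
    have "ok x (For 11 3 ?c) (R' 3 * (step_cost V + 3) + 3) (R', A')
      (\<lambda>s. Inv (j * V + R' 3) (snd s) \<and> fst s 11 = R' 3)"
    proof (rule ok_For)
      fix i R'' A''
      assume b: "Inv (j * V + i) (snd (R'', A''))" "\<And>r. r \<notin> insert 11 (mods ?c) \<Longrightarrow> R'' r = R' r"
      have "R'' 2 = M" "R'' 3 = V" using b(2)[of 2] b(2)[of 3] R' m by auto
      with body[of "j * V + i" A'' R''] b(1)
      show "ok x ?c (step_cost V) (R'', A'') (\<lambda>(R1, A1). Inv (j * V + Suc i) (snd (R1(11 := Suc i), A1)))"
        by simp
    qed (use m a in auto)
    then show "ok x (For 11 3 ?c) (V * (step_cost V + 3) + 3) (R', A')
      (\<lambda>(R'', A''). Inv (Suc j * V) (snd (R''(10 := Suc j), A'')))"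
      by (rule ok_conseq) (use R' in \<open>auto simp: add.commute\<close>)
  qed (use m A in \<open>auto simp: Inv_def\<close>)
  then show ?thesis
    unfolding saturate_def
  proof (rule ok_conseq)
    fix R' A' assume "Inv (R 3 * V) (snd (R' :: nat \<Rightarrow> nat, A')) \<and> fst (R', A') 10 = R 3"
    then have i: "Inv (V * V) A'" using R by simp
    \<comment> \<open>A gain in each of \<open>V * V\<close> rounds would fill the whole square,
      which is itself closed.\<close>
    have "complete A'"
    proof (rule ccontr)
      assume "\<not> complete A'"
      then have "card ?U \<le> card (pairs A' \<inter> ?U)" using i by (simp add: Inv_def)
      then have "pairs A' \<inter> ?U = ?U" by (intro card_seteq) auto
      then have "complete A'" unfolding complete_def using closed_full by (intro exI[of _ ?U]) auto
      then show False using \<open>\<not> complete A'\<close> by simp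
    qed
    then show "case (R', A') of (R', A') \<Rightarrow> pairs A' \<subseteq> W \<and>
      (\<exists>Z\<subseteq>pairs A'. rules_closed M B ds ts {..<V} Z \<and> I \<inter> ?U \<subseteq> Z)"
      using i by (auto simp: Inv_def complete_def)
  qed (simp add: R loop_cost_def)
qed

text \<open>Node \<open>u\<close> is the number \<open>M + u\<close> with the empty word; an edge
  compares the one-digit word \<open>d\<close> at its source with the empty word at its
  target.\<close>

definition enc :: "nat \<Rightarrow> nat \<times> nat \<times> nat \<Rightarrow> nat \<times> nat" where
  "enc M = (\<lambda>(u, d, v). ((M + u) * B + d, M + v))"

text \<open>Node \<open>i\<close> is position \<open>i\<close> of the input read forwards; node \<open>length x + 1 + i\<close> is position \<open>i\<close>
  when the last word is read backwards, with inverted letters.\<close>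

definition letter_edges :: "'l option list \<Rightarrow> nat \<Rightarrow> (nat \<times> nat \<times> nat) set" where
  "letter_edges x i = (\<Union>(l, d, d')\<in>set ls. if x ! i = Some l
     then {(i, d, Suc i)} \<union> {(length x + 2 + i, d', length x + 1 + i)} else {})"

text \<open>The two edges into the node behind a separator are the two values of the exponent: the
  word has been read, or it is jumped over from its beginning.\<close>

definition separator_edges :: "'l option list \<Rightarrow> nat \<Rightarrow> (nat \<times> nat \<times> nat) set" where
  "separator_edges x i = (if x ! i = None then {(i, e, Suc i)} \<union> {(block_start x i, e, Suc i)} else {})"

text \<open>The last edge leads from the beginning of the last word to its end in the backward copy,
  position \<open>length x - 1\<close>. Separators have no backward edges, so reading backwards
  cannot leave that word.\<close>

definition edges :: "'l option list \<Rightarrow> (nat \<times> nat \<times> nat) set" where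
  "edges x = (\<Union>i<length x. separator_edges x i \<union> letter_edges x i) \<union>
     {(prev_start x (length x), e, 2 * length x)}"

definition separator_at :: "'l option com" where
  "separator_at = If (Inp 6 (\<lambda>s. s = Input None)) (emit 6 21 e ;; emit 4 21 e) Skip"

definition letter_at :: "'l \<times> nat \<times> nat \<Rightarrow> 'l option com" where
  "letter_at = (\<lambda>(l, d, d'). If (Inp 6 (\<lambda>s. s = Input (Some l))) (emit 6 21 d ;; emit 23 22 d') Skip)"

definition edges_at :: "'l option com" where
  "edges_at = affine 21 6 1 1 ;; sumreg 22 21 1 ;; affine 23 22 1 1 ;; separator_at ;; seqs (map letter_at ls)"

definition block_at :: "'l option com" where
  "block_at = If (Inp 6 (\<lambda>s. s = Input None)) (affine 5 4 1 0 ;; affine 4 6 1 1) Skip"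

definition edge_cost :: "nat \<Rightarrow> nat" where
  "edge_cost M = (6 * M + 9) + ((6 * M + 11) + ((6 * M + 9) +
     ((2 * emit_cost (2 * M) + 1 + 1) + (length ls * ((2 * emit_cost (2 * M) + 1 + 1) + 1) + 1) + 1) + 1) + 1) + 1"

lemma emit_cost_pos: "1 \<le> emit_cost z"
  by (simp add: emit_cost_def)

lemma mods_edges_at: "mods edges_at \<subseteq> {12..18} \<union> {21, 22, 23}"
proof -
  have "mods (affine 21 6 1 1) \<subseteq> {14, 21}" "mods (affine 23 22 1 1) \<subseteq> {14, 23}" "mods (sumreg 22 21 1) \<subseteq> {14, 22}"
    by (rule mods_affine mods_sumreg)+
  moreover have "mods separator_at \<subseteq> {12..18}"
    using mods_emit by (simp add: separator_at_def)
  moreover have "mods (letter_at y) \<subseteq> {12..18}" for y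
    using mods_emit by (simp add: letter_at_def split: prod.splits)
  then have "mods (seqs (map letter_at ls)) \<subseteq> {12..18}" unfolding mods_seqs by auto
  ultimately show ?thesis unfolding edges_at_def mods.simps by auto
qed

lemma adds_edges_at:
  assumes M: "M = 2 * length x + 2" and i: "i < length x"
    and f: "f 1 = length x" "f 2 = M" "f 4 = block_start x i" "f 6 = i"
    and W: "enc M ` (separator_edges x i \<union> letter_edges x i) \<subseteq> W"
  shows "adds x W {} {1, 2, 4, 6} f edges_at (edge_cost M) (enc M ` (separator_edges x i \<union> letter_edges x i))"
proof -
  let ?n = "length x" and ?F0 = "{1, 2, 4, 6 :: nat}" and ?k = "emit_cost (2 * M)"
  have sym: "fst (input_tape x) (int i) = Input (x ! i)" using i by (simp add: input_tape_def)
  let ?H = "insert 23 (insert 22 (insert 21 ?F0))"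
  let ?g = "f(21 := Suc i, 22 := ?n + 1 + i, 23 := ?n + 2 + i)"
  have v: "?g 1 = ?n" "?g 2 = M" "?g 4 = block_start x i" "?g 6 = i" "?g 21 = Suc i" "?g 22 = ?n + 1 + i"
    "?g 23 = ?n + 2 + i" using f by auto
  have le: "?g 2 + ?g u \<le> 2 * M" if "u \<in> {4, 6, 21, 22, 23}" for u
    using that i f M block_start_le[of x i] by auto
  have emit: "adds x W {} ?H ?g (emit u w d) ?k {enc M (?g u, d, ?g w)}"
    if "u \<in> {4, 6, 21, 22, 23}" "w \<in> {4, 6, 21, 22, 23}" "d \<le> B" "enc M (?g u, d, ?g w) \<in> W" for u w d
  proof -
    have "((?g 2 + ?g u) * B + d, ?g 2 + ?g w) = enc M (?g u, d, ?g w)" unfolding enc_def v(2) by simp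
    moreover have "adds x W {} ?H ?g (emit u w d) ?k {((?g 2 + ?g u) * B + d, ?g 2 + ?g w)}"
      using that calculation by (intro adds_emit le) auto
    ultimately show ?thesis by simp
  qed
  have nin: "mods (emit u w d) \<inter> ?H = {}" for u w d using mods_emit[of u w d] by auto
  have sep: "adds x W {} ?H ?g separator_at (2 * ?k + 1 + 1) (enc M ` separator_edges x i)"
  proof -
    have "adds x W {} ?H ?g separator_at ((?k + ?k + 1) + 1)
      (if x ! i = None then {enc M (?g 6, e, ?g 21)} \<union> {enc M (?g 4, e, ?g 21)} else {})"
      unfolding separator_at_def
    proof (rule adds_If)
      show "test_val x (Inp 6 (\<lambda>s. s = Input None)) (R, A) \<longleftrightarrow> x ! i = None"
        if "\<forall>r\<in>?H. R r = ?g r" for R A using that f sym by simp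
      assume none: "x ! i = None"
      then have "enc M (i, e, Suc i) \<in> W" "enc M (block_start x i, e, Suc i) \<in> W"
        using W by (auto simp: separator_edges_def)
      then show "adds x W {} ?H ?g (emit 6 21 e ;; emit 4 21 e) (?k + ?k + 1)
        ({enc M (?g 6, e, ?g 21)} \<union> {enc M (?g 4, e, ?g 21)})"
        using e by (intro adds_Seq emit) (unfold v, auto)
    qed (use nin emit_cost_pos in auto)
    then show ?thesis
      unfolding v by (rule adds_mono) (auto simp: separator_edges_def)
  qed
  let ?S = "\<lambda>(l, d, d'). enc M ` (if x ! i = Some l then {(i, d, Suc i)} \<union> {(?n + 2 + i, d', ?n + 1 + i)} else {})"
  have let_at: "adds x W {} ?H ?g (letter_at y) (2 * ?k + 1 + 1)
    (?S y)"
    if y: "y \<in> set ls" for y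
  proof -
    obtain l d d' where ldd: "y = (l, d, d')" by (cases y)
    have "adds x W {} ?H ?g (letter_at y) ((?k + ?k + 1) + 1)
      (if x ! i = Some l then {enc M (?g 6, d, ?g 21)} \<union> {enc M (?g 23, d', ?g 22)} else {})"
      unfolding letter_at_def ldd prod.case
    proof (rule adds_If)
      show "test_val x (Inp 6 (\<lambda>s. s = Input (Some l))) (R, A) \<longleftrightarrow> x ! i = Some l"
        if "\<forall>r\<in>?H. R r = ?g r" for R A using that f sym by simp
      assume some: "x ! i = Some l"
      then have "(i, d, Suc i) \<in> letter_edges x i" "(?n + 2 + i, d', ?n + 1 + i) \<in> letter_edges x i"
        using y unfolding letter_edges_def ldd by force+
      then have "enc M (i, d, Suc i) \<in> W" "enc M (?n + 2 + i, d', ?n + 1 + i) \<in> W"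
        using W by auto
      moreover have "d \<le> B" "d' \<le> B" using ls y ldd by auto
      ultimately show "adds x W {} ?H ?g (emit 6 21 d ;; emit 23 22 d') (?k + ?k + 1)
        ({enc M (?g 6, d, ?g 21)} \<union> {enc M (?g 23, d', ?g 22)})"
        by (intro adds_Seq emit) (unfold v, auto)
    qed (use nin emit_cost_pos in auto)
    then show ?thesis
      unfolding v ldd prod.case by (rule adds_mono) auto
  qed
  have all: "adds x W {} ?H ?g (separator_at ;; seqs (map letter_at ls))
    ((2 * ?k + 1 + 1) + (length ls * ((2 * ?k + 1 + 1) + 1) + 1) + 1)
    (enc M ` separator_edges x i \<union> (\<Union>y\<in>set ls. ?S y))"
    by (intro adds_Seq sep adds_seqs let_at)
  have iM: "i \<le> M" "Suc i + ?n \<le> M" using i M by auto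
  have "adds x W {} ?F0 f edges_at (edge_cost M) (enc M ` separator_edges x i \<union> (\<Union>y\<in>set ls. ?S y))"
    unfolding edges_at_def edge_cost_def
  proof (rule adds_let[where w = 21 and v = "Suc i"], goal_cases)
    case (1 R)
    then show ?case by (intro sets_mono[OF sets_affine]) (use f iM in auto)
  next
    case 3
    show ?case
    proof (rule adds_let[where w = 22 and v = "?n + 1 + i"], goal_cases)
      case (1 R)
      then show ?case by (intro sets_mono[OF sets_sumreg]) (use f iM in auto)
    next
      case 3
      show ?case
      proof (rule adds_let[where w = 23 and v = "?n + 2 + i", OF _ _ all], goal_cases)
        case (1 R)
        then show ?case by (intro sets_mono[OF sets_affine]) (use f iM in auto)
      qed (use mods_affine[of 23 22 1 1] in auto)
    qed (use mods_sumreg[of 22 21 1] in auto)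
  qed (use mods_affine[of 21 6 1 1] in auto)
  moreover have "enc M ` letter_edges x i = (\<Union>y\<in>set ls. ?S y)"
    unfolding letter_edges_def by (force split: prod.splits)
  ultimately show ?thesis by (simp only: image_Un)
qed

lemma ok_block_at:
  assumes "R 6 < length x"
  shows "ok x block_at (6 * R 4 + 6 * R 6 + 18) (R, A) (\<lambda>(R', A'). A' = A \<and>
    R' 4 = (if x ! R 6 = None then Suc (R 6) else R 4) \<and> R' 5 = (if x ! R 6 = None then R 4 else R 5))"
proof -
  let ?Q = "\<lambda>(R', A'). A' = A \<and> R' 4 = (if x ! R 6 = None then Suc (R 6) else R 4) \<and>
    R' 5 = (if x ! R 6 = None then R 4 else R 5)"
  have sym: "fst (input_tape x) (int (R 6)) = Input (x ! R 6)" using assms by (simp add: input_tape_def)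
  have "ok x block_at (((R 4 * (2 * 1 + 4) + 2 * 0 + 7) + (R 6 * (2 * 1 + 4) + 2 * 1 + 7) + 1) + 1) (R, A) ?Q"
    unfolding block_at_def
  proof (rule ok_If, goal_cases)
    case none: 1
    have "ok x (affine 5 4 1 0) (R 4 * (2 * 1 + 4) + 2 * 0 + 7) (R, A) (\<lambda>(R', A'). A' = A \<and> R' 5 = R 4)"
      using sets_affine[of 5 4 x 1 0 R] by (simp add: sets_def)
    then show ?case
    proof (rule ok_Seq, goal_cases)
      case one: (1 R1 A1)
      have 6: "R1 6 = R 6" using one(2)[of 6] mods_affine[of 5 4 1 0, THEN subsetD, of 6] by auto
      have "ok x (affine 4 6 1 1) (R1 6 * (2 * 1 + 4) + 2 * 1 + 7) (R1, A1) (\<lambda>(R', A'). A' = A1 \<and> R' 4 = R1 6 * 1 + 1)"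
        using sets_affine[of 4 6 x 1 1 R1] by (simp add: sets_def)
      then show ?case
      proof (rule ok_conseq, goal_cases)
        case (2 R2 A2)
        have "R2 5 = R1 5" using 2(2)[of 5] mods_affine[of 4 6 1 1, THEN subsetD, of 5] by auto
        then show ?case using one(1) 2(1) none sym 6 by simp
      qed (simp add: 6)
    qed
  next
    case 2
    then show ?case using sym by (intro ok_Skip) auto
  qed
  then show ?thesis by (rule ok_conseq) auto
qed

lemma mods_block_at: "mods block_at \<subseteq> {4, 5, 14}"
  using mods_affine[of 5 4 1 0] mods_affine[of 4 6 1 1] by (auto simp: block_at_def)

text \<open>The block registers are updated after the edges of a position are emitted, since a
  separator edge refers to the block it ends.\<close>

definition read_edges :: "'l option com" where
  "read_edges = For 6 1 (edges_at ;; block_at)"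

definition read_cost :: "nat \<Rightarrow> nat \<Rightarrow> nat" where
  "read_cost n M = n * ((edge_cost M + (12 * n + 18) + 1) + 3) + 3"

lemma ok_read_edges:
  assumes M: "M = 2 * length x + 2" and R: "R 1 = length x" "R 2 = M" "R 4 = 0" "R 5 = 0"
    and W: "enc M ` edges x \<subseteq> W" and A: "pairs A \<subseteq> W"
  shows "ok x read_edges (read_cost (length x) M) (R, A) (\<lambda>(R', A'). pairs A' \<subseteq> W \<and>
    R' 4 = block_start x (length x) \<and> R' 5 = prev_start x (length x) \<and>
    enc M ` (\<Union>i<length x. separator_edges x i \<union> letter_edges x i) \<subseteq> pairs A')"
proof -
  let ?E = "\<lambda>i. separator_edges x i \<union> letter_edges x i" and ?n = "length x"
  let ?Inv = "\<lambda>j (R' :: nat \<Rightarrow> nat, A'). pairs A' \<subseteq> W \<and> R' 4 = block_start x j \<and> R' 5 = prev_start x j \<and>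
    enc M ` (\<Union>i<j. ?E i) \<subseteq> pairs A'"
  have me: "r \<notin> mods edges_at" "r \<in> {1, 2} \<Longrightarrow> r \<notin> mods (edges_at ;; block_at)" if "r \<in> {1, 2, 4, 5, 6}" for r
    using mods_edges_at mods_block_at that by auto
  have m6: "6 \<notin> mods (edges_at ;; block_at)" "1 \<notin> mods (edges_at ;; block_at)"
    using mods_edges_at mods_block_at by auto
  have "ok x read_edges (R 1 * ((edge_cost M + (12 * ?n + 18) + 1) + 3) + 3) (R, A)
    (\<lambda>s. ?Inv (R 1) s \<and> fst s 6 = R 1)"
    unfolding read_edges_def
  proof (rule ok_For)
    fix j R' A'
    assume a: "j < R 1" "?Inv j (R', A')" "R' 6 = j"
      "\<And>r. r \<notin> insert 6 (mods (edges_at ;; block_at)) \<Longrightarrow> R' r = R r"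
    have j: "j < ?n" using a R by simp
    have R': "R' 1 = ?n" "R' 2 = M" using a(4)[of 1] a(4)[of 2] me R by auto
    show "ok x (edges_at ;; block_at) (edge_cost M + (12 * ?n + 18) + 1) (R', A')
      (\<lambda>(R'', A''). ?Inv (Suc j) (R''(6 := Suc j), A''))"
    proof (rule ok_Seq)
      have "adds x W {} {1, 2, 4, 6} R' edges_at (edge_cost M) (enc M ` ?E j)"
        by (rule adds_edges_at[OF M j]) (use R' a(2,3) W j in \<open>auto simp: edges_def\<close>)
      then show "ok x edges_at (edge_cost M) (R', A')
        (\<lambda>(R1, A1). pairs A' \<subseteq> pairs A1 \<and> pairs A1 \<subseteq> W \<and> enc M ` ?E j \<subseteq> pairs A1)"
        using a(2) by (simp add: adds_def)
      fix R1 A1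
      assume 1: "case (R1, A1) of (R1, A1) \<Rightarrow> pairs A' \<subseteq> pairs A1 \<and> pairs A1 \<subseteq> W \<and> enc M ` ?E j \<subseteq> pairs A1"
        "\<And>r. r \<notin> mods edges_at \<Longrightarrow> R1 r = fst (R', A') r"
      have R1: "R1 4 = block_start x j" "R1 5 = prev_start x j" "R1 6 = j"
        using 1(2)[of 4] 1(2)[of 5] 1(2)[of 6] me a(2,3) by auto
      have sub: "enc M ` (\<Union>i<Suc j. ?E i) \<subseteq> pairs A1"
      proof -
        have "enc M ` ?E j \<subseteq> pairs A1" "enc M ` (\<Union>i<j. ?E i) \<subseteq> pairs A1"
          using 1(1) a(2) by (simp, simp, meson subset_trans)
        moreover have "(\<Union>i<Suc j. ?E i) = ?E j \<union> (\<Union>i<j. ?E i)" by (simp add: lessThan_Suc)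
        ultimately show ?thesis by (simp only: image_Un[of _ "?E j"] Un_least)
      qed
      have "ok x block_at (6 * R1 4 + 6 * R1 6 + 18) (R1, A1) (\<lambda>(R', A'). A' = A1 \<and>
        R' 4 = (if x ! R1 6 = None then Suc (R1 6) else R1 4) \<and> R' 5 = (if x ! R1 6 = None then R1 4 else R1 5))"
        by (rule ok_block_at) (use R1 j in simp)
      then show "ok x block_at (12 * ?n + 18) (R1, A1) (\<lambda>(R'', A''). ?Inv (Suc j) (R''(6 := Suc j), A''))"
      proof (rule ok_conseq)
        show "6 * R1 4 + 6 * R1 6 + 18 \<le> 12 * ?n + 18" using R1 block_start_le[of x j] j by simp
      qed (use R1 1(1) sub in \<open>simp split: prod.splits\<close>)
    qed
  qed (use R A m6 in simp_all)
  then show ?thesis by (rule ok_conseq) (auto simp: R[unfolded One_nat_def] read_cost_def)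
qed

definition last_edge :: "'l option com" where
  "last_edge = affine 22 1 2 0 ;; emit 5 22 e"

text \<open>Register 0 is still 0, so the first test excludes the empty input; the second rejects
  inputs that do not end with a separator. The pair looked up joins node 0 to the beginning of the
  last word in the backward copy, both with the empty word.\<close>

definition query :: "'l option com" where
  "query = If (Less 0 1) (If (Less 4 1) Skip ((affine 17 5 1 1 ;; addmul 14 17 1 1 ;; addmul 14 17 2 1) ;;
     address 2 17 ;; If (Arr 12) (Inc 0) Skip)) Skip"

definition query_cost :: "nat \<Rightarrow> nat" where
  "query_cost M = ((18 * M + 50) + (((4 * M) * (6 * (4 * M) + 6) + 12 * (4 * M) + 30) + (1 + 1) + 1) + 1) + 1 + 1"

lemma ok_query:
  assumes "R 0 = 0" "R 1 = n" "R 2 = M" "R 4 = b" "R 5 = s" "n \<le> M" "Suc s + n \<le> 2 * M" "s \<le> M"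
  shows "ok x query (query_cost M) (R, A) (\<lambda>(R', A'). A' = A \<and>
    (0 < R' 0 \<longleftrightarrow> 0 < n \<and> n \<le> b \<and> (M, M + (n + 1 + s)) \<in> pairs A))"
proof -
  let ?Q = "\<lambda>(R', A'). A' = A \<and> (0 < R' 0 \<longleftrightarrow> 0 < n \<and> n \<le> b \<and> (M, M + (n + 1 + s)) \<in> pairs A)"
  let ?c = "affine 17 5 1 1 ;; addmul 14 17 1 1 ;; addmul 14 17 2 1"
  have mm: "r \<notin> mods (affine 17 5 1 1)" "r \<notin> mods (addmul 14 17 1 1)" "r \<notin> mods (addmul 14 17 2 1)"
    "r \<notin> mods (address 2 17)" if "r \<in> {0, 1, 2}" for r
    using that mods_affine[of 17 5 1 1] mods_addmul[of 14 17 1 1] mods_addmul[of 14 17 2 1]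
      mods_address[of 2 17] by auto
  have sets: "sets x ?c (18 * M + 50) R 17 (M + (n + 1 + s))"
  proof -
    have "sets x (affine 17 5 1 1) (s * (2 * 1 + 4) + 2 * 1 + 7) R 17 (s + 1)"
      using sets_affine[of 17 5 x 1 1 R] assms by simp
    then have "sets x ?c ((s * (2 * 1 + 4) + 2 * 1 + 7) + ((n * (2 * 1 + 4) + 3) + (M * (2 * 1 + 4) + 3) + 1) + 1) R 17 (M + (n + 1 + s))"
    proof (rule sets_Seq, goal_cases)
      case 1: (1 R1)
      have r1: "R1 1 = n" "R1 2 = M" using 1(2)[OF mm(1), of 1] 1(2)[OF mm(1), of 2] assms by simp_all
      have "sets x (addmul 14 17 1 1) (n * (2 * 1 + 4) + 3) R1 17 (s + 1 + n)"
        using sets_addmul[of 14 17 1 x 1 R1] r1 1(1) by simp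
      then show ?case
      proof (rule sets_Seq, goal_cases)
        case 2: (1 R2)
        have "R2 2 = M" using 2(2)[OF mm(2), of 2] r1 by simp
        then show ?case using sets_addmul[of 14 17 2 x 1 R2] 2(1) by (simp add: ac_simps)
      qed
    qed
    then show ?thesis by (rule sets_mono) (use assms in auto)
  qed
  show ?thesis
    unfolding query_def query_cost_def
  proof (rule ok_If, goal_cases)
    case n: 1
    show ?case
    proof (rule ok_If, goal_cases)
      case 1
      then show ?case using assms by (intro ok_Skip) auto
    next
      case b: 2
      have "ok x ?c (18 * M + 50) (R, A) (\<lambda>(R', A'). A' = A \<and> R' 17 = M + (n + 1 + s))"
        using sets by (simp add: sets_def)
      then show ?case
      proof (rule ok_Seq, goal_cases)
        case 1: (1 R1 A1)
        have nm: "2 \<notin> mods ?c" "0 \<notin> mods ?c" using mm[of 2] mm[of 0] by simp_all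
        have r1: "R1 2 = M" "R1 0 = 0" using 1(2)[OF nm(1)] 1(2)[OF nm(2)] assms by simp_all
        have "sets x (address 2 17) ((4 * M) * (6 * (4 * M) + 6) + 12 * (4 * M) + 30) R1 12 (pr (R1 2) (R1 17))"
          by (rule sets_address) (use r1 1 assms in auto)
        then have "ok x (address 2 17) ((4 * M) * (6 * (4 * M) + 6) + 12 * (4 * M) + 30) (R1, A1)
          (\<lambda>(R', A'). A' = A \<and> R' 12 = pr M (M + (n + 1 + s)))"
          using r1 1 by (simp add: sets_def)
        then show ?case
        proof (rule ok_Seq, goal_cases)
          case 2: (1 R2 A2)
          have r2: "R2 0 = 0" using 2(2)[OF mm(4), of 0] r1 by simp
          show ?case
            by (rule ok_If; rule ok_Inc ok_Skip) (use 2 r2 n b assms in \<open>auto simp: pairs_def\<close>)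
        qed
      qed
    qed
  next
    case 2
    then show ?case using assms by (intro ok_Skip) auto
  qed
qed

definition program :: "'l option com" where
  "program = While (Inp 1 (\<lambda>s. s \<noteq> Blank)) (Inc 1) ;; affine 2 1 2 2 ;; powc p ;; read_edges ;;
     last_edge ;; saturate ;; query"

definition program_cost :: "nat \<Rightarrow> nat" where
  "program_cost n = (let M = 2 * n + 2; V = M ^ p in
     (3 * n + 1) + ((n * (2 * 2 + 4) + 2 * 2 + 7) + (pow_cost p M + (read_cost n M +
       (((6 * M + 7) + emit_cost (2 * M) + 1) + (loop_cost V (loop_cost V (step_cost V)) +
         query_cost M + 1) + 1) + 1) + 1) + 1) + 1)"

lemma adds_last_edge:
  assumes M: "M = 2 * length x + 2"
    and f: "f 1 = length x" "f 2 = M" "f 5 = prev_start x (length x)"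
    and W: "enc M (prev_start x (length x), e, 2 * length x) \<in> W"
  shows "adds x W {} {1, 2, 5} f last_edge ((6 * M + 7) + emit_cost (2 * M) + 1)
    {enc M (prev_start x (length x), e, 2 * length x)}"
  unfolding last_edge_def
proof (rule adds_let[where w = 22 and v = "2 * length x"])
  let ?g = "f(22 := 2 * length x)"
  show "sets x (affine 22 1 2 0) (6 * M + 7) R 22 (2 * length x)" if "\<forall>r\<in>{1, 2, 5}. R r = f r" for R
    by (rule sets_mono[OF sets_affine]) (use that f M in auto)
  have eq: "enc M (prev_start x (length x), e, 2 * length x) = ((?g 2 + ?g 5) * B + e, ?g 2 + ?g 22)"
    using f by (simp add: enc_def)
  show "adds x W {} (insert 22 {1, 2, 5}) ?g (emit 5 22 e) (emit_cost (2 * M))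
    {enc M (prev_start x (length x), e, 2 * length x)}"
    using W unfolding eq
    by (intro adds_emit) (use f M e prev_start_le[of x "length x"] in auto)
qed (use mods_affine[of 22 1 2 0] in auto)

lemma mods_program_parts:
  shows "r \<in> {0, 1, 2, 3} \<Longrightarrow> r \<notin> mods read_edges"
    and "r \<in> {0, 1, 2, 3, 4, 5} \<Longrightarrow> r \<notin> mods last_edge"
    and "r \<in> {0, 1, 2, 3, 4, 5} \<Longrightarrow> r \<notin> mods saturate"
proof -
  have "mods read_edges \<subseteq> insert 6 (({12..18} \<union> {21, 22, 23}) \<union> {4, 5, 14})"
    unfolding read_edges_def mods_For mods.simps
    by (intro insert_mono Un_mono mods_edges_at mods_block_at)
  then show "r \<in> {0, 1, 2, 3} \<Longrightarrow> r \<notin> mods read_edges" by auto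
  have "mods last_edge \<subseteq> {14, 22} \<union> {12..18}"
    unfolding last_edge_def mods.simps by (intro Un_mono mods_affine mods_emit)
  then show "r \<in> {0, 1, 2, 3, 4, 5} \<Longrightarrow> r \<notin> mods last_edge" by auto
  have "mods saturate \<subseteq> insert 10 (insert 11 {7, 8, 9, 12, 13, 14, 15, 16, 17, 18})"
    unfolding saturate_def mods_For by (intro insert_mono mods_step)
  then show "r \<in> {0, 1, 2, 3, 4, 5} \<Longrightarrow> r \<notin> mods saturate" by auto
qed

text \<open>Any relation closed under the unrestricted rules and containing the edges bounds the
  array from above, and a set closed below \<open>V\<close> bounds it from below; the meaning of the
  numbers enters only later.\<close>

theorem ok_program:
  assumes n: "n = length x" and M: "M = 2 * n + 2" and V: "V = M ^ p"
    and W: "rules_closed M B ds ts UNIV W" "enc M ` edges x \<subseteq> W"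
  shows "ok x program (program_cost n) (\<lambda>_. 0, {}) (\<lambda>(R, A). pairs A \<subseteq> W \<and>
    (\<exists>Z\<subseteq>pairs A. rules_closed M B ds ts {..<V} Z \<and> enc M ` edges x \<inter> {..<V} \<times> {..<V} \<subseteq> Z) \<and>
    (0 < R 0 \<longleftrightarrow> 0 < n \<and> block_start x n = n \<and> (M, M + (n + 1 + prev_start x n)) \<in> pairs A))"
    (is "ok x program _ _ ?Q")
proof -
  let ?I = "enc M ` edges x"
  let ?k5 = "(6 * M + 7) + emit_cost (2 * M) + 1"
  let ?k6 = "loop_cost V (loop_cost V (step_cost V))"
  have final: "ok x query (query_cost M) (R, A) ?Q"
    if "R 0 = 0" "R 1 = n" "R 2 = M" "R 4 = block_start x n" "R 5 = prev_start x n" "pairs A \<subseteq> W"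
      "\<exists>Z\<subseteq>pairs A. rules_closed M B ds ts {..<V} Z \<and> ?I \<inter> {..<V} \<times> {..<V} \<subseteq> Z" for R A
  proof -
    have "ok x query (query_cost M) (R, A) (\<lambda>(R', A'). A' = A \<and> (0 < R' 0 \<longleftrightarrow>
      0 < n \<and> n \<le> block_start x n \<and> (M, M + (n + 1 + prev_start x n)) \<in> pairs A))"
      by (rule ok_query) (use that M prev_start_le[of x n] in auto)
    then show ?thesis
    proof (rule ok_conseq)
      fix R' :: "nat \<Rightarrow> nat" and A'
      assume a: "case (R', A') of (R', A') \<Rightarrow> A' = A \<and> (0 < R' 0 \<longleftrightarrow>
        0 < n \<and> n \<le> block_start x n \<and> (M, M + (n + 1 + prev_start x n)) \<in> pairs A)"
      have "n \<le> block_start x n \<longleftrightarrow> block_start x n = n" using block_start_le[of x n] by auto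
      then show "?Q (R', A')" using a that(6,7) by simp
    qed simp
  qed
  have "ok x program ((3 * n + 1) + ((n * (2 * 2 + 4) + 2 * 2 + 7) + (pow_cost p M + (read_cost n M +
       (?k5 + (?k6 + query_cost M + 1) + 1) + 1) + 1) + 1) + 1) (\<lambda>_. 0, {}) ?Q"
    unfolding program_def
  proof (rule ok_Seq[OF ok_count[of x, folded n]], goal_cases)
    case (1 R A)
    then have R: "R 1 = n" "\<And>r. r \<noteq> 1 \<Longrightarrow> R r = 0" "A = {}" by auto
    have "ok x (affine 2 1 2 2) (n * (2 * 2 + 4) + 2 * 2 + 7) (R, A) (\<lambda>(R', A'). A' = {} \<and> R' 2 = M)"
      using sets_affine[of 2 1 x 2 2 R] R(1,3) M unfolding sets_def by (simp add: mult.commute)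
    then show ?case
    proof (rule ok_Seq, goal_cases)
      case (1 R1 A1)
      have r: "r \<notin> mods (affine 2 1 2 2)" if "r \<in> {0, 1, 3, 4, 5}" for r
        using that mods_affine[of 2 1 2 2] by auto
      have R1: "R1 0 = 0" "R1 1 = n" "R1 2 = M" "R1 3 = 0" "R1 4 = 0" "R1 5 = 0" "A1 = {}"
        using 1(1) 1(2)[OF r] R(1,2) by simp_all
      then have "ok x (powc p) (pow_cost p M) (R1, A1) (\<lambda>(R', A'). A' = {} \<and> R' 3 = V)"
        using sets_powc[of R1 M x p] V by (simp add: sets_def)
      then show ?case
      proof (rule ok_Seq, goal_cases)
        case (1 R2 A2)
        have R2: "R2 0 = 0" "R2 1 = n" "R2 2 = M" "R2 3 = V" "R2 4 = 0" "R2 5 = 0" "A2 = {}"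
          using 1(1) 1(2)[of 0] 1(2)[of 1] 1(2)[of 2] 1(2)[of 4] 1(2)[of 5] R1 by (simp_all add: mods_powc)
        have "ok x read_edges (read_cost n M) (R2, A2) (\<lambda>(R', A'). pairs A' \<subseteq> W \<and>
          R' 4 = block_start x n \<and> R' 5 = prev_start x n \<and>
          enc M ` (\<Union>i<n. separator_edges x i \<union> letter_edges x i) \<subseteq> pairs A')"
          unfolding n by (rule ok_read_edges) (use R2 n M W(2) in simp_all)
        then show ?case
        proof (rule ok_Seq, goal_cases)
          case (1 R3 A3)
          have R3: "R3 0 = 0" "R3 1 = n" "R3 2 = M" "R3 3 = V" "R3 4 = block_start x n" "R3 5 = prev_start x n"
            "pairs A3 \<subseteq> W" "enc M ` (\<Union>i<n. separator_edges x i \<union> letter_edges x i) \<subseteq> pairs A3"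
            using 1(1) 1(2)[OF mods_program_parts(1)] R2 by simp_all
          have "adds x W {} {1, 2, 5} R3 last_edge ?k5 {enc M (prev_start x n, e, 2 * n)}"
            unfolding n by (rule adds_last_edge) (use R3 n M W(2) in \<open>auto simp: edges_def\<close>)
          then have "ok x last_edge ?k5 (R3, A3) (\<lambda>(R', A'). pairs A3 \<subseteq> pairs A' \<and> pairs A' \<subseteq> W \<and>
            {enc M (prev_start x n, e, 2 * n)} \<subseteq> pairs A')"
            using R3(7) by (simp add: adds_def)
          then show ?case
          proof (rule ok_Seq, goal_cases)
            case (1 R4 A4)
            have R4: "R4 0 = 0" "R4 1 = n" "R4 2 = M" "R4 3 = V" "R4 4 = block_start x n" "R4 5 = prev_start x n"
              "pairs A4 \<subseteq> W"
              using 1(1) 1(2)[OF mods_program_parts(2)] R3 by simp_all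
            have "?I \<subseteq> pairs A4"
              using 1(1) R3(8) unfolding edges_def image_Un n[symmetric] by (simp only: prod.case) blast
            from ok_saturate[OF W(1) R4(3,4) this R4(7)] show ?case
            proof (rule ok_Seq, goal_cases)
              case (1 R5 A5)
              show ?case
                by (rule final) (use 1(1) 1(2)[OF mods_program_parts(3)] R4 in simp_all)
            qed
          qed
        qed
      qed
    qed
  qed
  then show ?thesis by (simp only: program_cost_def Let_def M V)
qed

end

section \<open>Polynomial bounds on the running time\<close>

definition poly_bounded :: "(nat \<Rightarrow> nat) \<Rightarrow> bool" where
  "poly_bounded f \<longleftrightarrow> (\<exists>q :: nat poly. \<forall>n. f n \<le> poly q n)"

lemma poly_bounded_const: "poly_bounded (\<lambda>_. c)"
  unfolding poly_bounded_def by (intro exI[of _ "[:c:]"]) simp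

lemma poly_bounded_id: "poly_bounded (\<lambda>n. n)"
  unfolding poly_bounded_def by (intro exI[of _ "[:0, 1:]"]) simp

lemma poly_bounded_add:
  assumes "poly_bounded f" "poly_bounded g"
  shows "poly_bounded (\<lambda>n. f n + g n)"
proof -
  obtain q r where "\<forall>n. f n \<le> poly q n" "\<forall>n. g n \<le> poly r n"
    using assms unfolding poly_bounded_def by blast
  then show ?thesis unfolding poly_bounded_def by (intro exI[of _ "q + r"]) (auto intro: add_le_mono)
qed

lemma poly_bounded_mult:
  assumes "poly_bounded f" "poly_bounded g"
  shows "poly_bounded (\<lambda>n. f n * g n)"
proof -
  obtain q r where "\<forall>n. f n \<le> poly q n" "\<forall>n. g n \<le> poly r n"
    using assms unfolding poly_bounded_def by blast
  then show ?thesis unfolding poly_bounded_def by (intro exI[of _ "q * r"]) (auto intro: mult_le_mono)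
qed

lemma poly_bounded_power: "poly_bounded f \<Longrightarrow> poly_bounded (\<lambda>n. f n ^ k)"
  by (induction k) (auto intro: poly_bounded_const poly_bounded_mult)

lemma poly_bounded_pow_cost: "poly_bounded f \<Longrightarrow> poly_bounded (\<lambda>n. pow_cost k (f n))"
  by (induction k) (auto intro!: poly_bounded_const poly_bounded_mult poly_bounded_add)

lemma (in ssp_program) poly_bounded_program_cost: "poly_bounded program_cost"
  unfolding program_cost_def Let_def read_cost_def edge_cost_def emit_cost_def query_cost_def
    loop_cost_def step_cost_def trans_cost_def shift_cost_def rel_cost_def affine_cost_def
    max_sum_def pair_cost_def
  by (intro poly_bounded_add poly_bounded_mult poly_bounded_power poly_bounded_pow_cost
      poly_bounded_const poly_bounded_id)

section \<open>From Gromov's condition to an integer length function\<close>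

section \<open>Word lengths and soundness\<close>

lemma min_half: "min (a / 2) (b / 2) - d \<le> c / 2 \<Longrightarrow> min a b \<le> c + 2 * d" for a b c d :: real
  by (cases "a \<le> b") auto

context group
begin

lemma letter_val_closed: "Y \<subseteq> carrier G \<Longrightarrow> l \<in> Y \<times> UNIV \<Longrightarrow> letter_val G l \<in> carrier G"
  by (auto simp: letter_val_def)

lemma word_val_simps [simp]:
  "word_val G [] = \<one>" "word_val G (l # w) = letter_val G l \<otimes> word_val G w"
  by (simp_all add: word_val_def list_prod_def)

lemma word_val_closed: "Y \<subseteq> carrier G \<Longrightarrow> w \<in> words Y \<Longrightarrow> word_val G w \<in> carrier G"
  by (induction w) (auto simp: words_def letter_val_def)

lemma word_val_append:
  assumes "Y \<subseteq> carrier G" "v \<in> words Y" "w \<in> words Y"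
  shows "word_val G (v @ w) = word_val G v \<otimes> word_val G w"
  using assms(2)
proof (induction v)
  case Nil
  then show ?case using word_val_closed[OF assms(1,3)] by simp
next
  case (Cons l v)
  then have "l \<in> Y \<times> UNIV" "v \<in> words Y" by (auto simp: words_def)
  then show ?case
    using Cons letter_val_closed[OF assms(1)] word_val_closed[OF assms(1)] assms(3)
    by (simp add: m_assoc)
qed

lemma ex_inverse_word:
  assumes "Y \<subseteq> carrier G" "w \<in> words Y"
  shows "\<exists>v\<in>words Y. length v = length w \<and> word_val G v = inv (word_val G w)"
  using assms(2)
proof (induction w)
  case Nil
  then show ?case by (intro bexI[of _ "[]"]) (auto simp: words_def)
next
  case (Cons l w)
  then have l: "l \<in> Y \<times> UNIV" "w \<in> words Y" by (auto simp: words_def)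
  then obtain v where v: "v \<in> words Y" "length v = length w" "word_val G v = inv (word_val G w)"
    using Cons by auto
  let ?l = "(fst l, \<not> snd l)"
  have lv: "letter_val G ?l = inv (letter_val G l)" using l assms(1) by (auto simp: letter_val_def)
  have "[?l] \<in> words Y" using l by (auto simp: words_def)
  then have "word_val G (v @ [?l]) = inv (word_val G (l # w))"
    using word_val_append[OF assms(1) v(1)] v(3) lv letter_val_closed[OF assms(1) l(1)]
      word_val_closed[OF assms(1) l(2)] by (simp add: inv_mult_group)
  moreover have "v @ [?l] \<in> words Y" using v(1) l by (auto simp: words_def)
  ultimately show ?case using v(2) by (intro bexI[of _ "v @ [?l]"]) auto
qed

lemma ex_word:
  assumes "finite_generating_set G Y" "g \<in> carrier G"
  shows "\<exists>w\<in>words Y. word_val G w = g"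
proof -
  have Y: "Y \<subseteq> carrier G" using assms(1) by (simp add: finite_generating_set_def)
  have "g \<in> generate G Y" using assms by (simp add: finite_generating_set_def)
  then show ?thesis
  proof (induction rule: generate.induct)
    case one
    then show ?case by (intro bexI[of _ "[]"]) (auto simp: words_def)
  next
    case (incl h)
    then show ?case using Y by (intro bexI[of _ "[(h, True)]"]) (auto simp: words_def letter_val_def)
  next
    case (inv h)
    then show ?case using Y by (intro bexI[of _ "[(h, False)]"]) (auto simp: words_def letter_val_def)
  next
    case (eng h1 h2)
    then obtain v w where "v \<in> words Y" "word_val G v = h1" "w \<in> words Y" "word_val G w = h2" by blast
    then show ?case using word_val_append[OF Y]
      by (intro bexI[of _ "v @ w"]) (auto simp: words_def)
  qed
qed

definition word_len :: "'a set \<Rightarrow> 'a \<Rightarrow> nat" where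
  "word_len Y g = (LEAST n. \<exists>w\<in>words Y. length w = n \<and> word_val G w = g)"

lemma word_metric_len:
  "x \<in> carrier G \<Longrightarrow> y \<in> carrier G \<Longrightarrow> word_metric G Y x y = word_len Y (inv x \<otimes> y)"
  by (simp add: word_metric_def word_len_def)

lemma word_len_le: "w \<in> words Y \<Longrightarrow> word_len Y (word_val G w) \<le> length w"
  unfolding word_len_def by (rule Least_le) blast

lemma ex_geodesic_word:
  assumes "finite_generating_set G Y" "g \<in> carrier G"
  shows "\<exists>w\<in>words Y. length w = word_len Y g \<and> word_val G w = g"
  unfolding word_len_def
proof (rule LeastI_ex)
  show "\<exists>n. \<exists>w\<in>words Y. length w = n \<and> word_val G w = g" using ex_word[OF assms] by auto
qed

lemma word_len_mult:
  assumes "finite_generating_set G Y" "g \<in> carrier G" "h \<in> carrier G"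
  shows "word_len Y (g \<otimes> h) \<le> word_len Y g + word_len Y h"
proof -
  have Y: "Y \<subseteq> carrier G" using assms(1) by (simp add: finite_generating_set_def)
  obtain v w where vw: "v \<in> words Y" "length v = word_len Y g" "word_val G v = g"
    "w \<in> words Y" "length w = word_len Y h" "word_val G w = h"
    using ex_geodesic_word[OF assms(1,2)] ex_geodesic_word[OF assms(1,3)] by blast
  have "v @ w \<in> words Y" using vw by (auto simp: words_def)
  then show ?thesis using word_len_le[of "v @ w" Y] word_val_append[OF Y vw(1,4)] vw by simp
qed

lemma word_len_inv:
  assumes "finite_generating_set G Y" "g \<in> carrier G"
  shows "word_len Y (inv g) = word_len Y g"
proof -
  have Y: "Y \<subseteq> carrier G" using assms(1) by (simp add: finite_generating_set_def)
  have le: "word_len Y (inv h) \<le> word_len Y h" if h: "h \<in> carrier G" for h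
  proof -
    obtain w where w: "w \<in> words Y" "length w = word_len Y h" "word_val G w = h"
      using ex_geodesic_word[OF assms(1) h] by blast
    obtain v where "v \<in> words Y" "length v = length w" "word_val G v = inv (word_val G w)"
      using ex_inverse_word[OF Y w(1)] by blast
    then show ?thesis using word_len_le[of v Y] w by simp
  qed
  show ?thesis using le[of g] le[of "inv g"] assms(2) by simp
qed

text \<open>Gromov's condition is taken at the base point 1. Doubling the products removes the
  halves and turns \<open>\<delta>\<close> into \<open>2 * \<delta>\<close>, rounded up to a natural
  number.\<close>

lemma hyperbolic_length_word_len:
  assumes Y: "finite_generating_set G Y" and "\<delta> \<ge> 0"
    and hyp: "gromov_hyperbolic \<delta> (carrier G) (word_metric G Y)"
  shows "hyperbolic_length G (word_len Y) (nat \<lceil>2 * \<delta>\<rceil>)"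
proof -
  have Yc: "Y \<subseteq> carrier G" "finite Y" using Y by (auto simp: finite_generating_set_def)
  show ?thesis
  proof
    fix g assume g: "g \<in> carrier G"
    show "word_len Y g = 0 \<longleftrightarrow> g = \<one>"
    proof
      show "g = \<one>" if "word_len Y g = 0" using ex_geodesic_word[OF Y g] that by auto
      show "word_len Y g = 0" if "g = \<one>"
        using word_len_le[of "[]" Y] that by (simp add: words_def)
    qed
    show "word_len Y (inv g) = word_len Y g" using word_len_inv[OF Y g] .
  next
    fix g h assume "g \<in> carrier G" "h \<in> carrier G"
    then show "word_len Y (g \<otimes> h) \<le> word_len Y g + word_len Y h" by (rule word_len_mult[OF Y])
  next
    fix g n assume g: "g \<in> carrier G" "word_len Y g = Suc n"
    obtain w where w: "w \<in> words Y" "length w = Suc n" "word_val G w = g"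
      using ex_geodesic_word[OF Y g(1)] g(2) by auto
    \<comment> \<open>The last letter of a shortest word is split off; by subadditivity the rest
      cannot be shorter than \<open>n\<close>.\<close>
    obtain v l where vl: "w = v @ [l]" using w(2) by (cases w rule: rev_cases) auto
    have v: "v \<in> words Y" "[l] \<in> words Y" "length v = n" using w vl by (auto simp: words_def)
    let ?h = "word_val G v" and ?a = "word_val G [l]"
    have c: "?h \<in> carrier G" "?a \<in> carrier G" using word_val_closed[OF Yc(1)] v by blast+
    have g': "g = ?h \<otimes> ?a" using word_val_append[OF Yc(1) v(1,2)] w(3) vl by simp
    have "word_len Y ?h \<le> n" "word_len Y ?a \<le> 1" using word_len_le[OF v(1)] word_len_le[OF v(2)] v(3) by auto
    moreover have "Suc n \<le> word_len Y ?h + word_len Y ?a" using word_len_mult[OF Y c] g(2) g' by simp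
    ultimately show "\<exists>h\<in>carrier G. \<exists>a\<in>carrier G. g = h \<otimes> a \<and> word_len Y h = n \<and> word_len Y a \<le> 1"
      using c g' by (intro bexI[of _ ?h] bexI[of _ ?a]) auto
  next
    fix r
    have "{g \<in> carrier G. word_len Y g \<le> r} \<subseteq> word_val G ` {w. set w \<subseteq> Y \<times> UNIV \<and> length w \<le> r}"
    proof
      fix g assume g: "g \<in> {g \<in> carrier G. word_len Y g \<le> r}"
      then obtain w where "w \<in> words Y" "length w = word_len Y g" "word_val G w = g"
        using ex_geodesic_word[OF Y] by blast
      then show "g \<in> word_val G ` {w. set w \<subseteq> Y \<times> UNIV \<and> length w \<le> r}"
        using g by (auto simp: words_def lists_eq_set intro!: image_eqI[of _ _ w])
    qed
    moreover have "finite {w. set w \<subseteq> Y \<times> (UNIV :: bool set) \<and> length w \<le> r}"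
      using Yc(2) by (intro finite_lists_length_le) simp
    ultimately show "finite {g \<in> carrier G. word_len Y g \<le> r}" by (meson finite_surj)
  next
    fix x y z assume xyz: "x \<in> carrier G" "y \<in> carrier G" "z \<in> carrier G"
    let ?l = "word_len Y" and ?d = "\<lambda>x y. word_len Y (inv x \<otimes> y)"
    have d_le: "?d u v \<le> ?l u + ?l v" if "u \<in> carrier G" "v \<in> carrier G" for u v
      using word_len_mult[OF Y, of "inv u" v] word_len_inv[OF Y] that by simp
    have gp: "gromov_product (word_metric G Y) \<one> u v = (real (?l u) + real (?l v) - real (?d u v)) / 2"
      if "u \<in> carrier G" "v \<in> carrier G" for u v
      using that by (simp add: gromov_product_def word_metric_len word_len_inv[OF Y])
    have "gromov_product (word_metric G Y) \<one> x z \<ge>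
        min (gromov_product (word_metric G Y) \<one> x y) (gromov_product (word_metric G Y) \<one> y z) - \<delta>"
      using hyp xyz unfolding gromov_hyperbolic_def by blast
    then have main: "min (real (?l x) + real (?l y) - real (?d x y)) (real (?l y) + real (?l z) - real (?d y z))
        \<le> real (?l x) + real (?l z) - real (?d x z) + 2 * \<delta>"
      unfolding gp[OF xyz(1,2)] gp[OF xyz(2,3)] gp[OF xyz(1,3)] by (rule min_half)
    have "2 * \<delta> \<le> real (nat \<lceil>2 * \<delta>\<rceil>)" using assms(2) by linarith
    then have "min (real (?l x) + real (?l y) - real (?d x y)) (real (?l y) + real (?l z) - real (?d y z))
        \<le> real (?l x) + real (?l z) - real (?d x z) + real (nat \<lceil>2 * \<delta>\<rceil>)" using main by linarith
    \<comment> \<open>No subtraction truncates, by the triangle inequality \<open>d_le\<close>, so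
      the inequality transfers to natural numbers.\<close>
    then have "real (min (?l x + ?l y - ?d x y) (?l y + ?l z - ?d y z))
        \<le> real (?l x + ?l z - ?d x z + nat \<lceil>2 * \<delta>\<rceil>)"
      using d_le[OF xyz(1,2)] d_le[OF xyz(2,3)] d_le[OF xyz(1,3)]
      by (simp add: of_nat_min of_nat_diff)
    then show "min (?l x + ?l y - ?d x y) (?l y + ?l z - ?d y z) \<le> ?l x + ?l z - ?d x z + nat \<lceil>2 * \<delta>\<rceil>"
      by (simp only: of_nat_le_iff)
  qed
qed

end

section \<open>Paths in labelled graphs and soundness of the closure rules\<close>

inductive gpath :: "('a, 'm) monoid_scheme \<Rightarrow> (nat \<times> 'a \<times> nat) set \<Rightarrow> nat \<Rightarrow> 'a \<Rightarrow> nat \<Rightarrow> bool"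
  for G and \<Gamma> and u where
  refl: "gpath G \<Gamma> u \<one>\<^bsub>G\<^esub> u"
| step: "gpath G \<Gamma> u g v \<Longrightarrow> (v, a, w) \<in> \<Gamma> \<Longrightarrow> gpath G \<Gamma> u (g \<otimes>\<^bsub>G\<^esub> a) w"

text \<open>A number \<open>s \<ge> M\<close> stands for the element spelled by its base-\<open>B\<close> digits below a leading part
  in \<open>{M..<M * B}\<close>, attached to the node given by this leading part.\<close>

lemma div_decreases: "\<not> s < M * B \<Longrightarrow> 0 < M \<Longrightarrow> \<not> B < 2 \<Longrightarrow> s div B < s" for s M B :: nat
  by (rule div_less_dividend) (auto intro: gr0I)

function num_root :: "nat \<Rightarrow> nat \<Rightarrow> nat \<Rightarrow> nat" where
  "num_root M B s = (if s < M * B \<or> M = 0 \<or> B < 2 then s - M else num_root M B (s div B))"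
  by auto
termination by (relation "measure (\<lambda>(M, B, s). s)") (auto intro: div_decreases)

declare num_root.simps [simp del]

function num_val :: "('a, 'm) monoid_scheme \<Rightarrow> (nat \<Rightarrow> 'a) \<Rightarrow> nat \<Rightarrow> nat \<Rightarrow> nat \<Rightarrow> 'a" where
  "num_val G dv M B s = (if s < M * B \<or> M = 0 \<or> B < 2 then \<one>\<^bsub>G\<^esub>
     else num_val G dv M B (s div B) \<otimes>\<^bsub>G\<^esub> dv (s mod B))"
  by auto
termination by (relation "measure (\<lambda>(G, dv, M, B, s). s)") (auto intro: div_decreases)

declare num_val.simps [simp del]

text \<open>For \<open>M \<le> s\<close> the longer number is at least \<open>M * B\<close>, so the
  recursion strips exactly this digit. This is the reason for excluding numbers below
  \<open>M\<close> from the digit rules.\<close>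

lemma num_root_digit:
  assumes "0 < M" "2 \<le> B" "M \<le> s" "a < B"
  shows "num_root M B (s * B + a) = num_root M B s"
    and "num_val G dv M B (s * B + a) = num_val G dv M B s \<otimes>\<^bsub>G\<^esub> dv a"
proof -
  have "M * B \<le> s * B" using assms(3) by (rule mult_le_mono1)
  then have n: "\<not> (s * B + a < M * B \<or> M = 0 \<or> B < 2)" using assms(1,2) by linarith
  have "(s * B + a) div B = s" "(s * B + a) mod B = a" using assms by auto
  then show "num_root M B (s * B + a) = num_root M B s"
    "num_val G dv M B (s * B + a) = num_val G dv M B s \<otimes>\<^bsub>G\<^esub> dv a"
    using n num_root.simps[of M B "s * B + a"] num_val.simps[of G dv M B "s * B + a"] by simp_all
qed

text \<open>\<open>2 \<le> B\<close> keeps the node numbers \<open>M + u\<close> below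
  \<open>M * B\<close>, in the range where nothing is stripped.\<close>

lemma num_root_base:
  assumes "2 \<le> B" "u < M"
  shows "num_root M B (M + u) = u" "num_val G dv M B (M + u) = \<one>\<^bsub>G\<^esub>"
proof -
  have "M * 2 \<le> M * B" using assms(1) by (rule mult_le_mono2)
  then have "M + u < M * B" using assms(2) by linarith
  then show "num_root M B (M + u) = u" "num_val G dv M B (M + u) = \<one>\<^bsub>G\<^esub>"
    using num_root.simps[of M B "M + u"] num_val.simps[of G dv M B "M + u"] by simp_all
qed

context group
begin

lemma gpath_closed: "gpath G \<Gamma> u g v \<Longrightarrow> \<Gamma> \<subseteq> UNIV \<times> carrier G \<times> UNIV \<Longrightarrow> g \<in> carrier G"
  by (induction rule: gpath.induct) auto

lemma gpath_trans:
  assumes "gpath G \<Gamma> v h w" "gpath G \<Gamma> u g v" "\<Gamma> \<subseteq> UNIV \<times> carrier G \<times> UNIV"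
  shows "gpath G \<Gamma> u (g \<otimes> h) w"
  using assms(1)
proof (induction rule: gpath.induct)
  case refl
  then show ?case using assms gpath_closed[OF assms(2,3)] by simp
next
  case (step h w a w')
  have "a \<in> carrier G" "g \<in> carrier G" "h \<in> carrier G"
    using step assms gpath_closed by blast+
  then show ?case using gpath.step[OF step(3,2)] by (simp add: m_assoc)
qed

definition sound_pairs :: "(nat \<times> 'a \<times> nat) set \<Rightarrow> (nat \<Rightarrow> 'a) \<Rightarrow> nat \<Rightarrow> nat \<Rightarrow> (nat \<times> nat) set" where
  "sound_pairs \<Gamma> dv M B = {(s, t). M \<le> s \<and> M \<le> t \<and>
     gpath G \<Gamma> (num_root M B s) (num_val G dv M B s \<otimes> inv (num_val G dv M B t)) (num_root M B t)}"

lemma num_val_closed: "(\<And>n. dv n \<in> carrier G) \<Longrightarrow> num_val G dv M B s \<in> carrier G"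
proof (induction s rule: less_induct)
  case (less s)
  then show ?case
    using less.IH[of "s div B"] num_val.simps[of G dv M B s]
    by (cases "s < M * B \<or> M = 0 \<or> B < 2") (auto simp: div_decreases)
qed

text \<open>Transitivity is concatenation of paths; a common last digit cancels in the value of
  \<open>s\<close> times the inverse of that of \<open>t\<close>, which makes the shift rule an
  equivalence; the table relates words of equal value by the empty path.\<close>

lemma closed_sound_pairs:
  assumes \<Gamma>: "\<Gamma> \<subseteq> UNIV \<times> carrier G \<times> UNIV" and dv: "\<And>n. dv n \<in> carrier G"
    and MB: "0 < M" "2 \<le> B" and ds: "set ds \<subseteq> {..<B}"
    and ts: "\<And>a b c. (a, b, c) \<in> set ts \<Longrightarrow> a < B \<and> b < B \<and> c < B \<and> dv a \<otimes> dv b = dv c"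
  shows "rules_closed M B ds ts UNIV (sound_pairs \<Gamma> dv M B)"
proof -
  let ?v = "num_val G dv M B" and ?r = "num_root M B"
  have v: "?v s \<in> carrier G" for s using num_val_closed[OF dv] .
  have ge: "M \<le> s * B + a" if "M \<le> s" for s a
  proof -
    have "M * 1 \<le> s * B" by (rule mult_le_mono) (use that MB in auto)
    then show ?thesis by simp
  qed
  show ?thesis
    unfolding rules_closed_def
  proof (intro conjI ballI impI, goal_cases)
    case (1 s m t)
    have "(?v s \<otimes> inv ?v m) \<otimes> (?v m \<otimes> inv ?v t) = ?v s \<otimes> inv ?v t"
    proof -
      have "inv ?v m \<otimes> (?v m \<otimes> inv ?v t) = inv ?v t" using v by (simp flip: m_assoc)
      then show ?thesis using v by (simp add: m_assoc)
    qed
    then show ?case using 1 gpath_trans[OF _ _ \<Gamma>, of "?r m" "?v m \<otimes> inv ?v t" "?r t"]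
      by (fastforce simp: sound_pairs_def)
  next
    case (2 a s t)
    have a: "a < B" using 2 ds by auto
    have "(?v s \<otimes> dv a) \<otimes> inv (?v t \<otimes> dv a) = ?v s \<otimes> inv ?v t"
      using v dv by (simp add: inv_mult_group m_assoc) (simp flip: m_assoc)
    then show ?case
      using 2 ge a MB by (simp add: sound_pairs_def num_root_digit)
  next
    case (3 y)
    obtain a b c where y: "y = (a, b, c)" by (cases y)
    have abc: "a < B" "b < B" "c < B" "dv a \<otimes> dv b = dv c" using ts 3 y by auto
    have "gpath G \<Gamma> (?r s) (?v s \<otimes> dv c \<otimes> inv (?v s \<otimes> dv c)) (?r s)" for s
      using gpath.refl[of G \<Gamma> "?r s"] v dv by simp
    moreover have "?v s \<otimes> dv a \<otimes> dv b = ?v s \<otimes> dv c" for s using abc v dv by (simp add: m_assoc)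
    ultimately show ?case
      unfolding y prod.case using ge abc(1-3) MB
      by (simp add: sound_pairs_def num_root_digit)
  qed
qed

lemma sound_pairs_edge:
  assumes "(u, dv d, w) \<in> \<Gamma>" "dv d \<in> carrier G" "u < M" "w < M" "2 \<le> B" "d < B"
  shows "((M + u) * B + d, M + w) \<in> sound_pairs \<Gamma> dv M B"
proof -
  have M: "0 < M" "M \<le> M + u" using assms by auto
  have "M * 1 \<le> (M + u) * B" by (rule mult_le_mono) (use assms in auto)
  moreover have "gpath G \<Gamma> u (\<one> \<otimes> dv d) w" by (rule gpath.step[OF gpath.refl assms(1)])
  ultimately show ?thesis
    using num_root_digit(1)[OF M(1) assms(5) M(2) assms(6)] num_root_digit(2)[OF M(1) assms(5) M(2) assms(6), of G dv]
      num_root_base(1)[OF assms(5,3)] num_root_base(1)[OF assms(5,4)]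
      num_root_base(2)[OF assms(5,3), of G dv] num_root_base(2)[OF assms(5,4), of G dv] assms(2)
    by (simp add: sound_pairs_def)
qed

lemma sound_pairs_base:
  assumes "(M + u, M + w) \<in> sound_pairs \<Gamma> dv M B" "u < M" "w < M" "2 \<le> B"
  shows "gpath G \<Gamma> u \<one> w"
  using assms(1) num_root_base(1)[OF assms(4,2)] num_root_base(1)[OF assms(4,3)]
    num_root_base(2)[OF assms(4,2), of G dv] num_root_base(2)[OF assms(4,3), of G dv] by (simp add: sound_pairs_def)

text \<open>The partial values \<open>P\<close> are the points of the group that the geometric
  argument works with; a path of value 1 yields a closed one.\<close>

lemma gpath_nodes:
  assumes "gpath G \<Gamma> u g w" "\<Gamma> \<subseteq> UNIV \<times> carrier G \<times> UNIV"
  shows "\<exists>m node P. node 0 = u \<and> node m = w \<and> P 0 = \<one> \<and> P m = g \<and> (\<forall>k\<le>m. P k \<in> carrier G) \<and>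
    (\<forall>k<m. (node k, inv (P k) \<otimes> P (Suc k), node (Suc k)) \<in> \<Gamma>)"
  using assms(1)
proof (induction rule: gpath.induct)
  case refl
  show ?case by (intro exI[of _ 0] exI[of _ "\<lambda>_. u"] exI[of _ "\<lambda>_. \<one>"]) simp
next
  case (step g v a w)
  then obtain m node P where mp: "node 0 = u" "node m = v" "P 0 = \<one>" "P m = g" "\<forall>k\<le>m. P k \<in> carrier G"
    "\<forall>k<m. (node k, inv (P k) \<otimes> P (Suc k), node (Suc k)) \<in> \<Gamma>" by blast
  have c: "a \<in> carrier G" "g \<in> carrier G" using step assms(2) mp by auto
  let ?node = "node(Suc m := w)" and ?P = "P(Suc m := g \<otimes> a)"
  have "inv g \<otimes> (g \<otimes> a) = a" using c by (simp flip: m_assoc)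
  then have "\<forall>k<Suc m. (?node k, inv (?P k) \<otimes> ?P (Suc k), ?node (Suc k)) \<in> \<Gamma>"
    using mp step(2) by (auto simp: less_Suc_eq)
  moreover have "\<forall>k\<le>Suc m. ?P k \<in> carrier G" using mp c by (auto simp: le_Suc_eq)
  ultimately show ?case using mp by (intro exI[of _ "Suc m"] exI[of _ ?node] exI[of _ ?P]) auto
qed

end

section \<open>Instances as paths in a labelled graph\<close>

section \<open>The graph of an instance\<close>

lemma encode_tuple_simps [simp]:
  "encode_tuple [] = []" "encode_tuple (u # us) = map Some u @ None # encode_tuple us"
  "encode_tuple (us @ vs) = encode_tuple us @ encode_tuple vs"
  by (simp_all add: encode_tuple_def)

lemma ex_encode_tuple: "\<exists>us w. x = encode_tuple us @ map Some w"
proof (induction x rule: rev_induct)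
  case Nil
  show ?case by (intro exI[of _ "[]"]) simp
next
  case (snoc z x)
  then obtain us w where x: "x = encode_tuple us @ map Some w" by blast
  show ?case
  proof (cases z)
    case None
    then show ?thesis using x by (intro exI[of _ "us @ [w]"] exI[of _ "[]"]) simp
  next
    case (Some l)
    then show ?thesis using x by (intro exI[of _ us] exI[of _ "w @ [l]"]) simp
  qed
qed

lemma encode_tuple_last:
  "us \<noteq> [] \<Longrightarrow> 0 < length (encode_tuple us) \<and> encode_tuple us ! (length (encode_tuple us) - 1) = None"
  by (cases us rule: rev_cases) (auto simp: nth_append)

lemma block_start_encode:
  assumes "x = encode_tuple us @ map Some w @ r"
  shows "block_start x (length (encode_tuple us) + length w) = length (encode_tuple us)"
  using assms
proof (induction w arbitrary: r rule: rev_induct)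
  case Nil
  show ?case
  proof (cases "us = []")
    case False
    then obtain m where m: "length (encode_tuple us) = Suc m" "encode_tuple us ! m = None"
      using encode_tuple_last[of us] by (cases "length (encode_tuple us)") auto
    then have "x ! m = None" using Nil by (simp add: nth_append)
    then show ?thesis using m by simp
  qed simp
next
  case (snoc l w)
  have "x = encode_tuple us @ map Some w @ Some l # r" using snoc.prems by simp
  moreover from this have "x ! (length (encode_tuple us) + length w) = Some l"
    by (simp add: nth_append)
  ultimately show ?case using snoc.IH[of "Some l # r"] by simp
qed

lemma prev_start_encode:
  assumes "x = encode_tuple (us @ [u])"
  shows "prev_start x (length x) = length (encode_tuple us)" "block_start x (length x) = length x"
proof -
  let ?i = "length (encode_tuple us) + length u"
  have x: "x = encode_tuple us @ map Some u @ [None]" "length x = Suc ?i" using assms by auto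
  then have "x ! ?i = None" by (simp add: nth_append)
  then show "prev_start x (length x) = length (encode_tuple us)" "block_start x (length x) = length x"
    using block_start_encode[OF x(1)] x(2) by simp_all
qed

text \<open>Justifies the well-formedness test of the program: any input is a list of complete
  blocks and a rest, and the rest is empty iff the current block begins at the very end.\<close>

lemma encode_tuple_if_block_start:
  assumes "block_start x (length x) = length x" "0 < length x"
  shows "\<exists>us u. x = encode_tuple (us @ [u])"
proof -
  obtain us w where x: "x = encode_tuple us @ map Some w" using ex_encode_tuple by blast
  have "block_start x (length (encode_tuple us) + length w) = length (encode_tuple us)"
    by (rule block_start_encode[where r = "[]"]) (simp add: x)
  then have w: "w = []" using assms(1) x by simp
  then have "us \<noteq> []" using assms(2) x by auto
  then show ?thesis using x w by (metis append_Nil2 list.map_disc_iff rev_exhaust)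
qed

lemma block_at:
  assumes "i < length x" "x ! i = None"
  obtains us u r where "x = encode_tuple us @ map Some u @ None # r"
    "i = length (encode_tuple us) + length u" "block_start x i = length (encode_tuple us)"
proof -
  obtain us u where t: "take i x = encode_tuple us @ map Some u" using ex_encode_tuple by blast
  then have i: "i = length (encode_tuple us) + length u"
    using assms(1) by (metis length_append length_map length_take less_imp_le min.absorb2)
  have x: "x = encode_tuple us @ map Some u @ None # drop (Suc i) x"
    using id_take_nth_drop[OF assms(1)] assms(2) t by simp
  then show ?thesis using that[OF x i] block_start_encode[OF x] i by simp
qed

text \<open>\<open>block_start\<close> depends on the input alone, so a position where a block
  begins in one parse leaves no partial word in another.\<close>

lemma encode_tuple_same_start:
  assumes "x = encode_tuple us @ map Some w @ r" "x = encode_tuple us' @ r'"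
    and "length (encode_tuple us) + length w = length (encode_tuple us')"
  shows "w = []" "encode_tuple us = encode_tuple us'" "r = r'"
proof -
  have "block_start x (length (encode_tuple us')) = length (encode_tuple us')"
    using block_start_encode[of x us' "[]" r'] assms(2) by simp
  then show "w = []" using block_start_encode[OF assms(1)] assms(3) by simp
  then show "encode_tuple us = encode_tuple us'" "r = r'" using assms by (auto simp: append_eq_append_conv)
qed

context group
begin

text \<open>The graph of \<open>edges\<close>, labelled by group elements in place of digits, so
  that the combinatorics of instances is independent of their numbering.\<close>

definition graph :: "'a letter option list \<Rightarrow> (nat \<times> 'a \<times> nat) set" where
  "graph x =
     {(i, letter_val G l, Suc i) | i l. i < length x \<and> x ! i = Some l} \<union>
     {(length x + 2 + i, inv (letter_val G l), length x + 1 + i) | i l. i < length x \<and> x ! i = Some l} \<union>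
     {(i, \<one>, Suc i) | i. i < length x \<and> x ! i = None} \<union>
     {(block_start x i, \<one>, Suc i) | i. i < length x \<and> x ! i = None} \<union>
     {(prev_start x (length x), \<one>, 2 * length x)}"

lemma graph_cases:
  assumes "(p, a, q) \<in> graph x"
  obtains (letter) l where "p < length x" "x ! p = Some l" "a = letter_val G l" "q = Suc p"
    | (inverse) i l where "i < length x" "x ! i = Some l" "p = length x + 2 + i" "a = inv (letter_val G l)"
        "q = length x + 1 + i"
    | (separator) "p < length x" "x ! p = None" "a = \<one>" "q = Suc p"
    | (skip) i where "i < length x" "x ! i = None" "p = block_start x i" "a = \<one>" "q = Suc i"
    | (last) "p = prev_start x (length x)" "a = \<one>" "q = 2 * length x"
  using assms unfolding graph_def Un_iff mem_Collect_eq singleton_iff prod.inject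
proof (elim disjE exE conjE, goal_cases)
  case (1 i l)
  then show ?case by (intro letter[of l]) simp_all
next
  case (2 i l)
  show ?case by (rule inverse[of i l]) (use 2 in simp_all)
next
  case (3 i)
  then show ?case by (intro separator) simp_all
next
  case (4 i)
  show ?case by (rule skip[of i]) (use 4 in simp_all)
next
  case 5
  then show ?case by (intro last) simp_all
qed

lemma subset_sum_Nil: "subset_sum G [] g \<longleftrightarrow> g = \<one>"
  by (simp add: subset_sum_def)

lemma subset_sum_snoc:
  assumes "set gs \<subseteq> carrier G" "h \<in> carrier G"
  shows "subset_sum G (gs @ [h]) g \<longleftrightarrow> subset_sum G gs g \<or> (\<exists>g'. subset_sum G gs g' \<and> g = g' \<otimes> h)"
proof -
  let ?P = "\<lambda>gs \<epsilon>. list_prod G (map (\<lambda>i. (gs ! i) [^] \<epsilon> i) [0..<length gs])"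
  let ?n = "length gs"
  have c: "(gs ! i) [^] (\<epsilon> i :: nat) \<in> carrier G" if "i < ?n" for i \<epsilon>
    using assms(1) that by (meson nat_pow_closed nth_mem subsetD)
  have P: "?P (gs @ [h]) \<epsilon> = ?P gs \<epsilon> \<otimes> h [^] \<epsilon> ?n" for \<epsilon> :: "nat \<Rightarrow> nat"
  proof -
    have e: "map (\<lambda>i. ((gs @ [h]) ! i) [^] \<epsilon> i) [0..<length (gs @ [h])]
        = map (\<lambda>i. (gs ! i) [^] \<epsilon> i) [0..<?n] @ [h [^] \<epsilon> ?n]"
      by (simp add: nth_append)
    have "set (map (\<lambda>i. (gs ! i) [^] \<epsilon> i) [0..<?n]) \<subseteq> carrier G" using c by auto
    from list_prod_append[OF this, of "[h [^] \<epsilon> ?n]"] show ?thesis unfolding e using assms(2) by simp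
  qed
  have Pc: "?P gs \<epsilon> \<in> carrier G" for \<epsilon> :: "nat \<Rightarrow> nat"
    by (rule list_prod_closed) (use c in auto)
  show ?thesis
  proof
    assume "subset_sum G (gs @ [h]) g"
    then obtain \<epsilon> :: "nat \<Rightarrow> nat" where \<epsilon>: "\<forall>i<Suc ?n. \<epsilon> i \<in> {0, 1}" "g = ?P (gs @ [h]) \<epsilon>"
      unfolding subset_sum_def by auto
    have s: "subset_sum G gs (?P gs \<epsilon>)" unfolding subset_sum_def
      by (rule exI[of _ \<epsilon>]) (use \<epsilon>(1) in auto)
    have g: "g = ?P gs \<epsilon> \<otimes> h [^] \<epsilon> ?n" using \<epsilon>(2) P by simp
    show "subset_sum G gs g \<or> (\<exists>g'. subset_sum G gs g' \<and> g = g' \<otimes> h)"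
    proof (cases "\<epsilon> ?n = 0")
      case True
      then have "g = ?P gs \<epsilon>" using g Pc by simp
      then show ?thesis using s by simp
    next
      case False
      then have "\<epsilon> ?n = 1" using \<epsilon>(1) by auto
      then have "g = ?P gs \<epsilon> \<otimes> h" using g assms(2) by simp
      then show ?thesis using s by blast
    qed
  next
    assume "subset_sum G gs g \<or> (\<exists>g'. subset_sum G gs g' \<and> g = g' \<otimes> h)"
    then obtain g' and b :: nat where g': "subset_sum G gs g'" "b \<in> {0, 1}" "g = g' \<otimes> h [^] b"
    proof (elim disjE exE conjE, goal_cases)
      case 1
      have "g \<in> carrier G" using 1(2) Pc unfolding subset_sum_def by auto
      then show ?case using 1(1)[of g 0] 1(2) by simp
    next
      case (2 g')
      then show ?case using 2(1)[of g' 1] assms(2) by simp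
    qed
    then obtain \<epsilon> :: "nat \<Rightarrow> nat" where \<epsilon>: "\<forall>i<?n. \<epsilon> i \<in> {0, 1}" "g' = ?P gs \<epsilon>"
      unfolding subset_sum_def by auto
    have "?P gs (\<epsilon>(?n := b)) = ?P gs \<epsilon>"
      by (intro arg_cong[where f = "list_prod G"] map_cong) auto
    then have "g = ?P (gs @ [h]) (\<epsilon>(?n := b))" using P[of "\<epsilon>(?n := b)"] g' \<epsilon> by simp
    then show "subset_sum G (gs @ [h]) g"
      unfolding subset_sum_def using \<epsilon>(1) g'(2) by (intro exI[of _ "\<epsilon>(?n := b)"]) (auto simp: less_Suc_eq)
  qed
qed

lemma subset_sum_closed: "set gs \<subseteq> carrier G \<Longrightarrow> subset_sum G gs g \<Longrightarrow> g \<in> carrier G"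
proof (induction gs arbitrary: g rule: rev_induct)
  case Nil
  then show ?case by (simp add: subset_sum_Nil)
next
  case (snoc h gs)
  then show ?case using subset_sum_snoc[of gs h g] by auto
qed

lemma words_encode_tuple:
  "encode_tuple us @ map Some w @ r \<in> lists (ssp_alphabet X) \<longleftrightarrow>
     us \<in> lists (words X) \<and> w \<in> words X \<and> r \<in> lists (ssp_alphabet X)"
proof -
  have w: "map Some v \<in> lists (ssp_alphabet X) \<longleftrightarrow> v \<in> words X" for v
    by (auto simp: in_lists_conv_set ssp_alphabet_def words_def)
  have "None \<in> ssp_alphabet X" by (simp add: ssp_alphabet_def)
  then show ?thesis by (induction us) (auto simp: w)
qed

text \<open>Invariant of walking from node 0. In the forward copy, \<open>g'\<close> is a subset
  product of the completed words and \<open>w\<close> the part read of the current one; in the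
  backward copy, \<open>w\<close> is the part of the last word already divided off, and
  \<open>v\<close> the part still ahead.\<close>

definition reached :: "'a letter option list \<Rightarrow> nat \<Rightarrow> 'a \<Rightarrow> bool" where
  "reached x q g \<longleftrightarrow>
     (\<exists>us w r g'. x = encode_tuple us @ map Some w @ r \<and> q = length (encode_tuple us) + length w \<and>
        subset_sum G (map (word_val G) us) g' \<and> g = g' \<otimes> word_val G w) \<or>
     (\<exists>us v w g'. x = encode_tuple (us @ [v @ w]) \<and>
        q = length x + 1 + length (encode_tuple us) + length v \<and>
        subset_sum G (map (word_val G) us) g' \<and> g = g' \<otimes> inv (word_val G w))"

lemma reached_graph:
  assumes X: "X \<subseteq> carrier G" and x: "x \<in> lists (ssp_alphabet X)"
    and valid: "x = encode_tuple (vs @ [v0])"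
    and path: "gpath G (graph x) 0 g q"
  shows "reached x q g"
  using path
proof (induction rule: gpath.induct)
  case refl
  show ?case unfolding reached_def
    by (intro disjI1 exI[of _ "[]"] exI[of _ x] exI[of _ \<one>]) (simp add: subset_sum_Nil)
next
  case (step g p a q)
  have wc: "word_val G w \<in> carrier G" if "w \<in> words X" for w using word_val_closed[OF X that] .
  have sc: "g' \<in> carrier G" if "subset_sum G (map (word_val G) us) g'" "us \<in> lists (words X)" for us g'
    using that wc by (intro subset_sum_closed[OF _ that(1)]) auto
  have front: thesis
    if "p \<le> length x"
      and "\<And>us w r g'. x = encode_tuple us @ map Some w @ r \<Longrightarrow> p = length (encode_tuple us) + length w \<Longrightarrow>
        subset_sum G (map (word_val G) us) g' \<Longrightarrow> g = g' \<otimes> word_val G w \<Longrightarrow> us \<in> lists (words X) \<Longrightarrow>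
        w \<in> words X \<Longrightarrow> g' \<in> carrier G \<Longrightarrow> word_val G w \<in> carrier G \<Longrightarrow> r \<in> lists (ssp_alphabet X) \<Longrightarrow> thesis"
    for thesis
    using step.IH that(1) unfolding reached_def
  proof (elim disjE exE conjE, goal_cases)
    case (1 us w r g')
    have "encode_tuple us @ map Some w @ r \<in> lists (ssp_alphabet X)" using x 1 by simp
    then have "us \<in> lists (words X)" "w \<in> words X" "r \<in> lists (ssp_alphabet X)"
      unfolding words_encode_tuple by auto
    then show ?case using that(2) 1 sc wc by blast
  qed auto
  from step.hyps(2) show ?case
  proof (cases rule: graph_cases)
    case (letter l)
    show ?thesis
    proof (rule front)
      fix us w r g'
      assume a: "x = encode_tuple us @ map Some w @ r" "p = length (encode_tuple us) + length w"
        "subset_sum G (map (word_val G) us) g'" "g = g' \<otimes> word_val G w" "w \<in> words X" "g' \<in> carrier G"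
        "word_val G w \<in> carrier G" "r \<in> lists (ssp_alphabet X)"
      \<comment> \<open>The symbol put behind \<open>r\<close> only gives \<open>! 0\<close> a
        meaning in case \<open>r\<close> were empty; \<open>p < length x\<close> rules that
        out.\<close>
      have "x ! p = (r @ [None]) ! 0" "r \<noteq> []" using a(1,2) letter(1) by (auto simp: nth_append)
      then obtain r' where r: "r = Some l # r'" using letter(2) by (cases r) auto
      then have l: "l \<in> X \<times> UNIV" using a(8) by (auto simp: ssp_alphabet_def)
      then have lw: "[l] \<in> words X" "letter_val G l \<in> carrier G"
        using letter_val_closed[OF X] by (auto simp: words_def)
      have "x = encode_tuple us @ map Some (w @ [l]) @ r'" using a(1) r by simp
      moreover have "g \<otimes> a = g' \<otimes> word_val G (w @ [l])"
        using a lw letter(3) by (simp add: word_val_append[OF X] m_assoc)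
      ultimately show ?thesis unfolding reached_def using a(2,3) letter(4)
        by (intro disjI1 exI[of _ us] exI[of _ "w @ [l]"] exI[of _ r'] exI[of _ g']) simp
    qed (use letter in simp)
  next
    case (inverse i l)
    obtain us v w g' where b: "x = encode_tuple (us @ [v @ w])"
      "p = length x + 1 + length (encode_tuple us) + length v"
      "subset_sum G (map (word_val G) us) g'" "g = g' \<otimes> inv (word_val G w)"
      using step.IH unfolding reached_def
    proof (elim disjE exE conjE, goal_cases)
      case (1 us w r g')
      then have "p \<le> length x" by simp
      then show ?case using inverse(3) by simp
    next
      case (2 us v w g')
      then show ?case by (intro that)
    qed
    have i: "Suc i = length (encode_tuple us) + length v" using b(2) inverse(3) by simp
    have x': "x = encode_tuple us @ map Some (v @ w) @ [None]" using b(1) by simp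
    have us: "us \<in> lists (words X)" "v @ w \<in> words X"
      using x unfolding x' words_encode_tuple by auto
    \<comment> \<open>With \<open>v\<close> empty the symbol before this position would be the
      separator of the preceding word, which no letter edge crosses.\<close>
    have "v \<noteq> []"
    proof
      assume v: "v = []"
      then have "us \<noteq> []" using i by auto
      moreover have e: "length (encode_tuple us) = Suc i" using i v by simp
      ultimately have "encode_tuple us ! i = None" "i < length (encode_tuple us)"
        using encode_tuple_last[of us] unfolding e by simp_all
      then have "x ! i = None" unfolding x' by (simp add: nth_append)
      then show False using inverse(2) by simp
    qed
    then obtain v' l' where v: "v = v' @ [l']" by (cases v rule: rev_cases) auto
    have "x = encode_tuple us @ map Some v' @ Some l' # map Some w @ [None]"
      "i = length (encode_tuple us) + length v'"
      using x' v i by auto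
    then have "x ! i = Some l'" by (simp add: nth_append)
    then have l: "l' = l" using inverse(2) by simp
    have c: "letter_val G l \<in> carrier G" "word_val G w \<in> carrier G" "g' \<in> carrier G"
      using us v l letter_val_closed[OF X] wc sc[OF b(3)] by (auto simp: words_def)
    have "g \<otimes> a = g' \<otimes> inv (word_val G (l # w))"
      using b(4) inverse(4) c by (simp add: inv_mult_group m_assoc)
    then show ?thesis unfolding reached_def using b v l inverse i
      by (intro disjI2 exI[of _ us] exI[of _ v'] exI[of _ "l # w"] exI[of _ g']) simp
  next
    case separator
    show ?thesis
    proof (rule front)
      fix us w r g'
      assume a: "x = encode_tuple us @ map Some w @ r" "p = length (encode_tuple us) + length w"
        "subset_sum G (map (word_val G) us) g'" "g = g' \<otimes> word_val G w" "us \<in> lists (words X)"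
        "w \<in> words X" "g' \<in> carrier G" "word_val G w \<in> carrier G"
      have "x ! p = (r @ [Some undefined]) ! 0" "r \<noteq> []" using a(1,2) separator(1) by (auto simp: nth_append)
      then obtain r' where r: "r = None # r'" using separator(2) by (cases r) auto
      have "subset_sum G (map (word_val G) (us @ [w])) g"
        using subset_sum_snoc[of "map (word_val G) us" "word_val G w" g] a wc by auto
      moreover have "g \<otimes> a = g \<otimes> word_val G []" using separator(3) by simp
      moreover have "x = encode_tuple (us @ [w]) @ map Some [] @ r'" using a(1) r by simp
      ultimately show ?thesis unfolding reached_def using a(2) separator(4)
        by (intro disjI1 exI[of _ "us @ [w]"] exI[of _ "[]"] exI[of _ r'] exI[of _ g]) simp
    qed (use separator in simp)
  next
    case (skip i)
    obtain us2 u r2 where s: "x = encode_tuple us2 @ map Some u @ None # r2"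
      "i = length (encode_tuple us2) + length u" "block_start x i = length (encode_tuple us2)"
      using block_at[OF skip(1,2)] .
    show ?thesis
    proof (rule front)
      fix us w r g'
      assume a: "x = encode_tuple us @ map Some w @ r" "p = length (encode_tuple us) + length w"
        "subset_sum G (map (word_val G) us) g'" "g = g' \<otimes> word_val G w" "us \<in> lists (words X)"
        "w \<in> words X" "g' \<in> carrier G" "r \<in> lists (ssp_alphabet X)"
      have "length (encode_tuple us) + length w = length (encode_tuple us2)"
        using a(2) s(3) skip(3) by simp
      \<comment> \<open>A jump starts where a block begins, so no letter of the word has been read,
        and the word is skipped as a whole.\<close>
      note e = encode_tuple_same_start[OF a(1) s(1) this]
      have "u \<in> words X" using a(8) e(3) by (auto simp: ssp_alphabet_def words_def)
      then have "subset_sum G (map (word_val G) (us @ [u])) g'"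
        using subset_sum_snoc[of "map (word_val G) us" "word_val G u" g'] a(3,5) wc by auto
      moreover have "g \<otimes> a = g' \<otimes> word_val G []" using skip(4) a e(1) by simp
      moreover have "x = encode_tuple (us @ [u]) @ map Some [] @ r2" using a(1) e by simp
      moreover have "q = length (encode_tuple (us @ [u])) + length []" using skip(5) s(2) e(2) by simp
      ultimately show ?thesis unfolding reached_def
        by (intro disjI1 exI[of _ "us @ [u]"] exI[of _ "[]"] exI[of _ r2] exI[of _ g']) simp
    qed (use skip block_start_le[of x i] in simp)
  next
    case last
    have s: "x = encode_tuple vs @ map Some v0 @ [None]" using valid by simp
    show ?thesis
    proof (rule front)
      fix us w r g'
      assume a: "x = encode_tuple us @ map Some w @ r" "p = length (encode_tuple us) + length w"
        "subset_sum G (map (word_val G) us) g'" "g = g' \<otimes> word_val G w" "g' \<in> carrier G"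
      have "length (encode_tuple us) + length w = length (encode_tuple vs)"
        using a(2) last(1) prev_start_encode(1)[OF valid] by simp
      note e = encode_tuple_same_start[OF a(1) s this]
      have "g \<otimes> a = g' \<otimes> inv (word_val G [])" using last(2) a e(1) by simp
      moreover have "x = encode_tuple (us @ [v0 @ []])" using a(1) e by simp
      moreover from this have "q = length x + 1 + length (encode_tuple us) + length v0" using last(3) by simp
      ultimately show ?thesis unfolding reached_def using a(3)
        by (intro disjI2 exI[of _ us] exI[of _ v0] exI[of _ "[]"] exI[of _ g']) simp
    qed (use last prev_start_le[of x "length x"] in simp)
  qed
qed

lemma SSP_if_gpath:
  assumes X: "X \<subseteq> carrier G" and x: "x \<in> lists (ssp_alphabet X)"
    and valid: "0 < length x" "block_start x (length x) = length x"
    and path: "gpath G (graph x) 0 \<one> (length x + 1 + prev_start x (length x))"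
  shows "x \<in> SSP G X"
proof -
  obtain vs v0 where v: "x = encode_tuple (vs @ [v0])"
    using encode_tuple_if_block_start[OF valid(2,1)] by blast
  obtain us v w g' where b: "x = encode_tuple (us @ [v @ w])"
      "length x + 1 + prev_start x (length x) = length x + 1 + length (encode_tuple us) + length v"
      "subset_sum G (map (word_val G) us) g'" "\<one> = g' \<otimes> inv (word_val G w)"
    using reached_graph[OF X x v path] unfolding reached_def by auto
  \<comment> \<open>The target node is the beginning of the last word in the backward copy, so all
    of that word has been divided off.\<close>
  have "v = []" using prev_start_encode(1)[OF b(1)] b(2) by simp
  moreover have x': "x = encode_tuple us @ map Some (v @ w) @ [None]" using b(1) by simp
  have us: "us \<in> lists (words X)" "v @ w \<in> words X"
    using x unfolding x' words_encode_tuple by auto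
  moreover have "g' \<in> carrier G" "word_val G w \<in> carrier G"
    using subset_sum_closed[OF _ b(3)] word_val_closed[OF X] us calculation(1) by auto
  moreover from this have "g' = word_val G w" using b(4) by (metis inv_closed inv_equality inv_inv)
  ultimately show ?thesis unfolding SSP_def using b(1,3) by auto
qed

lemma gpath_if_SSP:
  assumes X: "X \<subseteq> carrier G" and "x \<in> SSP G X"
  shows "0 < length x" "block_start x (length x) = length x"
    and "gpath G (graph x) 0 \<one> (length x + 1 + prev_start x (length x))"
proof -
  obtain us u where x: "x = encode_tuple (us @ [u])" "us \<in> lists (words X)" "u \<in> words X"
    "subset_sum G (map (word_val G) us) (word_val G u)" using assms(2) unfolding SSP_def by blast
  show "0 < length x" using x(1) by simp
  show "block_start x (length x) = length x" using prev_start_encode(2)[OF x(1)] .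
  have letter: "gpath G (graph x) 0 (g \<otimes> word_val G w) (length A + length w)"
    if "x = A @ map Some w @ r" "gpath G (graph x) 0 g (length A)" "w \<in> words X" "g \<in> carrier G" for A w r g
    using that
  proof (induction w arbitrary: r rule: rev_induct)
    case (snoc l w)
    have w: "w \<in> words X" "[l] \<in> words X" "letter_val G l \<in> carrier G"
      using snoc.prems(3) letter_val_closed[OF X] by (auto simp: words_def)
    have x': "x = A @ map Some w @ Some l # r" using snoc.prems(1) by simp
    then have "length A + length w < length x" "x ! (length A + length w) = Some l"
      by (auto simp: nth_append)
    then have "(length A + length w, letter_val G l, Suc (length A + length w)) \<in> graph x"
      unfolding graph_def by blast
    from gpath.step[OF snoc.IH[OF x' snoc.prems(2) w(1) snoc.prems(4)] this]
    show ?case using w snoc.prems(4) word_val_closed[OF X w(1)]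
      by (simp add: word_val_append[OF X] m_assoc)
  qed simp
  have front: "gpath G (graph x) 0 g (length (encode_tuple vs))"
    if "x = encode_tuple vs @ r" "vs \<in> lists (words X)" "subset_sum G (map (word_val G) vs) g" for vs r g
    using that
  proof (induction vs arbitrary: r g rule: rev_induct)
    case Nil
    then show ?case using gpath.refl[of G "graph x" 0] by (simp add: subset_sum_Nil)
  next
    case (snoc v vs)
    let ?i = "length (encode_tuple vs) + length v"
    have v: "vs \<in> lists (words X)" "v \<in> words X" using snoc.prems by auto
    have x': "x = encode_tuple vs @ map Some v @ None # r" using snoc.prems(1) by simp
    then have i: "?i < length x" "x ! ?i = None" by (auto simp: nth_append)
    have c: "set (map (word_val G) vs) \<subseteq> carrier G" "word_val G v \<in> carrier G"
      using v word_val_closed[OF X] by auto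
    have e1: "(?i, \<one>, Suc ?i) \<in> graph x" using i unfolding graph_def by blast
    have "(block_start x ?i, \<one>, Suc ?i) \<in> graph x" using i unfolding graph_def by blast
    then have e2: "(length (encode_tuple vs), \<one>, Suc ?i) \<in> graph x"
      using block_start_encode[OF x'] by simp
    have "length (encode_tuple (vs @ [v])) = Suc ?i" by simp
    moreover have "gpath G (graph x) 0 g (Suc ?i)"
      using snoc.prems(3) unfolding map_append list.map subset_sum_snoc[OF c]
    proof (elim disjE exE conjE)
      assume s: "subset_sum G (map (word_val G) vs) g"
      show ?thesis using gpath.step[OF snoc.IH[OF x' v(1) s] e2] subset_sum_closed[OF c(1) s] by simp
    next
      fix g' assume s: "subset_sum G (map (word_val G) vs) g'" "g = g' \<otimes> word_val G v"
      have "g' \<in> carrier G" using subset_sum_closed[OF c(1) s(1)] .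
      then show ?thesis
        using gpath.step[OF letter[OF x' snoc.IH[OF x' v(1) s(1)] v(2)] e1] s(2) c(2) by simp
    qed
    ultimately show ?case by simp
  qed
  let ?g = "word_val G u" and ?E = "length (encode_tuple us)"
  have x': "x = encode_tuple us @ map Some u @ [None]" using x(1) by simp
  have n: "length x = Suc (?E + length u)" using x' by simp
  have gc: "?g \<in> carrier G" using word_val_closed[OF X x(3)] .
  have "gpath G (graph x) 0 ?g ?E" using front[OF x' x(2,4)] .
  moreover have "(?E, \<one>, 2 * length x) \<in> graph x"
    using prev_start_encode(1)[OF x(1)] unfolding graph_def by auto
  ultimately have fin: "gpath G (graph x) 0 ?g (2 * length x)" using gpath.step gc by fastforce
  have "gpath G (graph x) 0 (?g \<otimes> inv (word_val G w)) (length x + 1 + ?E + length v)"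
    if "u = v @ w" for v w
    using that
  proof (induction w arbitrary: v)
    case Nil
    then have "2 * length x = length x + 1 + ?E + length v" using n by simp
    with fin gc show ?case by simp
  next
    case (Cons l w)
    have "(v @ [l]) @ w = u" using Cons.prems by simp
    from Cons.IH[OF this[symmetric]]
    have p: "gpath G (graph x) 0 (?g \<otimes> inv (word_val G w)) (length x + 2 + (?E + length v))" by (simp add: add.assoc)
    have "x = encode_tuple us @ map Some v @ Some l # map Some w @ [None]" using x' Cons.prems by simp
    then have "?E + length v < length x" "x ! (?E + length v) = Some l" by (auto simp: nth_append)
    then have "(length x + 2 + (?E + length v), inv (letter_val G l), length x + 1 + (?E + length v)) \<in> graph x"
      unfolding graph_def by blast
    from gpath.step[OF p this]
    have "gpath G (graph x) 0 (?g \<otimes> inv (word_val G w) \<otimes> inv (letter_val G l)) (length x + 1 + ?E + length v)"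
      by (simp add: add.assoc)
    moreover have "letter_val G l \<in> carrier G" "word_val G w \<in> carrier G"
      using x(3) Cons.prems letter_val_closed[OF X] word_val_closed[OF X] by (auto simp: words_def)
    ultimately show ?case using gc by (simp add: inv_mult_group m_assoc)
  qed
  from this[of "[]" u] show "gpath G (graph x) 0 \<one> (length x + 1 + prev_start x (length x))"
    using gc prev_start_encode(1)[OF x(1)] by simp
qed

text \<open>A topological numbering: nodes of the forward copy in increasing, nodes of the backward
  copy in decreasing order, with values below \<open>2 * length x + 2\<close> on the nodes of the
  graph. It bounds the number of steps of a path.\<close>

definition rank :: "'l list \<Rightarrow> nat \<Rightarrow> nat" where
  "rank x u = (if u \<le> length x then u else 3 * length x + 2 - u)"

text \<open>The input must be nonempty because of the last edge, which for the empty input is a loop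
  at node 0.\<close>

lemma graph_rank:
  assumes "(u, a, v) \<in> graph x" "0 < length x"
  shows "rank x u < rank x v \<and> u < 2 * length x + 2 \<and> v < 2 * length x + 2"
proof -
  from assms(1) show ?thesis
  proof (cases rule: graph_cases)
    case (skip i)
    then show ?thesis using block_start_le[of x i] by (simp add: rank_def)
  next
    case last
    then show ?thesis using prev_start_le[of x "length x"] assms(2) by (simp add: rank_def)
  qed (simp_all add: rank_def)
qed

end

section \<open>Choice of the constants and the decision procedure\<close>

section \<open>Polynomial time\<close>

lemma ex_log:
  fixes m :: nat
  assumes "0 < m"
  shows "\<exists>k. m \<le> 2 ^ k \<and> 2 ^ k \<le> 2 * m"
proof -
  define k where "k = (LEAST k. m \<le> 2 ^ k)"
  have ex: "m \<le> 2 ^ m" by (simp add: less_imp_le)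
  have k: "m \<le> 2 ^ k" unfolding k_def by (rule LeastI[of "\<lambda>k. m \<le> 2 ^ k", OF ex])
  have "2 ^ k \<le> 2 * m"
  proof (cases k)
    case 0
    then show ?thesis using assms by simp
  next
    case (Suc j)
    then have "\<not> m \<le> 2 ^ j" using not_less_Least[of j "\<lambda>k. m \<le> 2 ^ k"] by (simp add: k_def)
    then show ?thesis using Suc by simp
  qed
  then show ?thesis using k by blast
qed

text \<open>Words of logarithmic length are polynomially many: \<open>B\<close> is at most
  \<open>2 ^ B\<close>, which moves the exponent \<open>k\<close> to base 2, and
  \<open>2 ^ k\<close> is at most \<open>M ^ 3\<close>. The factor \<open>2 * M\<close> costs
  \<open>M ^ 2\<close>. The exponent on the right becomes the constant \<open>p\<close> of the
  program.\<close>

lemma power_log_bound: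
  fixes M B a b k :: nat
  assumes "2 \<le> M" "2 ^ k \<le> 2 * M\<^sup>2"
  shows "2 * M * B ^ (a + b * k) \<le> M ^ (2 + B * a + 3 * (B * b))"
proof -
  have "B ^ (a + b * k) \<le> (2 ^ B) ^ (a + b * k)" by (rule power_mono) (simp_all add: less_imp_le)
  also have "\<dots> = 2 ^ (B * a) * (2 ^ k) ^ (B * b)"
    by (simp add: power_add algebra_simps flip: power_mult)
  also have "\<dots> \<le> M ^ (B * a) * (M ^ 3) ^ (B * b)"
  proof (rule mult_le_mono)
    show "2 ^ (B * a) \<le> M ^ (B * a)" using assms(1) by (rule power_mono) simp
    have "2 * M\<^sup>2 \<le> M * M\<^sup>2" using assms(1) by (rule mult_le_mono1)
    moreover have "M * M\<^sup>2 = M ^ 3" by (simp add: power3_eq_cube power2_eq_square)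
    ultimately have "2 ^ k \<le> M ^ 3" using assms(2) by linarith
    then show "(2 ^ k) ^ (B * b) \<le> (M ^ 3) ^ (B * b)" by (rule power_mono) simp
  qed
  finally have "2 * M * B ^ (a + b * k) \<le> M * M * (M ^ (B * a) * (M ^ 3) ^ (B * b))"
    using assms(1) by (intro mult_le_mono) simp_all
  also have "\<dots> = M ^ (2 + B * a + 3 * (B * b))"
    by (simp add: power_add power2_eq_square flip: power_mult)
  finally show ?thesis .
qed

context closure_system
begin

lemma roomI:
  assumes dig: "\<And>a. a \<in> digits \<Longrightarrow> dig a < B" and s: "M \<le> s" "s < 2 * M"
    and V: "2 * M * B ^ n \<le> V"
  shows "room s n"
  unfolding room_def
proof (intro conjI allI impI)
  fix w assume w: "set w \<subseteq> digits" "length w \<le> n"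
  \<comment> \<open>The summand 1 on both sides makes the bound hereditary: a digit is at most
    \<open>B - 1\<close>.\<close>
  have "code t w + 1 \<le> (t + 1) * B ^ length w" for t
    using w(1)
  proof (induction w arbitrary: t)
    case (Cons a w)
    have "code (app t a) w + 1 \<le> (app t a + 1) * B ^ length w" using Cons by simp
    also have "app t a + 1 \<le> (t + 1) * B" using dig[of a] Cons.prems by (simp add: app_def)
    finally show ?case by (simp add: algebra_simps)
  qed simp
  from this[of s] have "code s w < (s + 1) * B ^ length w" by simp
  also have "\<dots> \<le> 2 * M * B ^ n" using s w(2) B by (intro mult_le_mono power_increasing) auto
  finally show "code s w < V" using V by simp
qed (rule s(1))

end

context group
begin

lemma SSP_in_class_P:
  assumes Y: "finite_generating_set G Y" "\<delta> \<ge> 0"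
    "gromov_hyperbolic \<delta> (carrier G) (word_metric G Y)"
    and "finite_generating_set G X"
  shows "SSP G X \<in> class_P (ssp_alphabet X)"
proof -
  define len where "len = word_len Y"
  define \<Delta> where "\<Delta> = nat \<lceil>2 * \<delta>\<rceil>"
  interpret hyperbolic_length G len \<Delta>
    unfolding len_def \<Delta>_def by (rule hyperbolic_length_word_len[OF Y])
  have X: "finite X" "X \<subseteq> carrier G" using assms(4) by (auto simp: finite_generating_set_def)
  have lv: "letter_val G l \<in> carrier G" if "l \<in> X \<times> UNIV" for l using letter_val_closed[OF X(2) that] .
  have finL: "finite (X \<times> (UNIV :: bool set))" using X(1) by simp

  \<comment> \<open>Hyperbolicity is given for the generators \<open>Y\<close>, the input words are
    over \<open>X\<close>; \<open>L\<close> bounds the \<open>Y\<close>-lengths of the letters and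
    their inverses. The sum with \<open>Suc\<close> avoids a maximum over a possibly empty set and
    gives \<open>1 \<le> L\<close>.\<close>
  define L where "L = Suc (\<Sum>l\<in>X \<times> UNIV. len (letter_val G l))"
  have L: "1 \<le> L" by (simp add: L_def)
  have lenL: "len (letter_val G l) \<le> L" if "l \<in> X \<times> UNIV" for l
    using member_le_sum[OF that _ finL, of "\<lambda>l. len (letter_val G l)"] by (simp add: L_def)
  define D where "D = {g \<in> carrier G. len g \<le> L + 2 * \<Delta> + 1}"
  have D: "finite D" "D \<subseteq> carrier G" using finite_ball by (auto simp: D_def)
  have D_short: "g \<in> D" if "g \<in> carrier G" "len g \<le> L" for g using that by (simp add: D_def)
  have one: "\<one> \<in> D" using len_zero[of \<one>] by (simp add: D_def)
  have Dl: "letter_val G l \<in> D" "inv (letter_val G l) \<in> D" if "l \<in> X \<times> UNIV" for l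
    using D_short lv[OF that] lenL[OF that] len_inv by auto

  obtain dig where dig: "bij_betw dig D {0..<card D}" using ex_bij_betw_finite_nat[OF D(1)] by blast
  \<comment> \<open>One more than the number of digits, so that the base is at least 2 even if the
    identity is the only digit.\<close>
  define B where "B = card D + 1"
  have dig_less: "dig a < B" if "a \<in> D" for a
    using bij_betw_apply[OF dig that] by (simp add: B_def)
  then have dig_le: "dig a \<le> B" if "a \<in> D" for a using that less_imp_le by blast
  have "0 < card D" using one D(1) by (auto simp: card_gt_0_iff)
  then have B: "2 \<le> B" "1 \<le> B" by (auto simp: B_def)
  \<comment> \<open>The default \<open>\<one>\<close> keeps the values of all numbers in the
    group.\<close>
  define dv where "dv n = (if n \<in> dig ` D then inv_into D dig n else \<one>)" for n
  have dv: "dv n \<in> carrier G" for n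
    using D(2) inv_into_into[of n dig D] by (auto simp: dv_def)
  have dv_dig: "dv (dig a) = a" if "a \<in> D" for a
    using dig that by (auto simp: dv_def bij_betw_def)

  obtain ds where set_ds: "set ds = dig ` D" using finite_list[of "dig ` D"] D(1) by auto
  define T where "T = (\<lambda>(a, b). (dig a, dig b, dig (a \<otimes> b))) ` {(a, b). a \<in> D \<and> b \<in> D \<and> a \<otimes> b \<in> D}"
  have "finite T" unfolding T_def
    by (rule finite_imageI, rule finite_subset[of _ "D \<times> D"]) (use D(1) in auto)
  then obtain ts where set_ts: "set ts = T" using finite_list by blast
  define Ls where "Ls = (\<lambda>l. (l, dig (letter_val G l), dig (inv (letter_val G l)))) ` (X \<times> UNIV)"
  have "finite Ls" unfolding Ls_def by (rule finite_imageI[OF finL])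
  then obtain ls where set_ls: "set ls = Ls" using finite_list by blast

  \<comment> \<open>The room that \<open>closed_path\<close> requires is \<open>a0 + b0 * k\<close>,
    with \<open>k\<close> logarithmic in the input; \<open>p\<close> is the exponent that
    \<open>power_log_bound\<close> gives for it.\<close>
  define a0 where "a0 = L * (4 * L + 2) + 6"
  define b0 where "b0 = 2 * L * \<Delta>"
  define p where "p = 2 + B * a0 + 3 * (B * b0)"
  interpret ssp_program B "dig \<one>" ds ts ls p
  proof
    show "dig \<one> \<le> B" using dig_less[OF one] by simp
    show "a \<le> B" if "a \<in> set ds" for a using that set_ds dig_le by auto
    show "a \<le> B \<and> b \<le> B \<and> c \<le> B" if "(a, b, c) \<in> set ts" for a b c
      using that dig_le unfolding set_ts T_def by auto
    show "d \<le> B \<and> d' \<le> B" if "(l, d, d') \<in> set ls" for l d d'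
      using that dig_le Dl unfolding set_ls Ls_def by auto
  qed

  have letter_in: "l \<in> X \<times> UNIV" if "x \<in> lists (ssp_alphabet X)" "i < length x" "x ! i = Some l" for x i l
  proof -
    have "Some l \<in> set x" using that by (metis nth_mem)
    then show ?thesis using that(1) by (auto simp: in_lists_conv_set ssp_alphabet_def)
  qed
  have graph_sub: "graph x \<subseteq> UNIV \<times> {g \<in> carrier G. len g \<le> L} \<times> UNIV"
    if x: "x \<in> lists (ssp_alphabet X)" for x
  proof -
    have 1: "len \<one> \<le> L" using len_zero[of \<one>] by simp
    show ?thesis
    proof
      fix y assume "y \<in> graph x"
      moreover obtain u g v where y: "y = (u, g, v)" by (cases y)
      ultimately have "(u, g, v) \<in> graph x" by simp
      then have "g \<in> carrier G \<and> len g \<le> L"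
        by (cases rule: graph_cases) (use letter_in[OF x] lv lenL 1 len_inv in auto)
      then show "y \<in> UNIV \<times> {g \<in> carrier G. len g \<le> L} \<times> UNIV" using y by simp
    qed
  qed
  have edges_graph: "(u, dv d, v) \<in> graph x \<and> d < B"
    if x: "x \<in> lists (ssp_alphabet X)" and e: "(u, d, v) \<in> edges x" for x u d v
  proof -
    from e consider
        (separator) i where "i < length x" "(u, d, v) \<in> separator_edges x i"
      | (letter) i where "i < length x" "(u, d, v) \<in> letter_edges x i"
      | (last) "u = prev_start x (length x)" "d = dig \<one>" "v = 2 * length x"
      unfolding edges_def Un_iff UN_iff by (elim disjE bexE) auto
    then show ?thesis
    proof cases
      case (separator i)
      then have "x ! i = None" "d = dig \<one>" "v = Suc i" "u = i \<or> u = block_start x i"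
        by (auto simp: separator_edges_def split: if_splits)
      then show ?thesis using dv_dig[OF one] dig_less[OF one] separator(1) unfolding graph_def by auto
    next
      case (letter i)
      then obtain l d1 d2 where l: "(l, d1, d2) \<in> set ls" "x ! i = Some l"
        "(u, d, v) = (i, d1, Suc i) \<or> (u, d, v) = (length x + 2 + i, d2, length x + 1 + i)"
        by (auto simp: letter_edges_def split: if_splits)
      have l': "l \<in> X \<times> UNIV" using letter_in[OF x letter(1) l(2)] .
      have d: "d1 = dig (letter_val G l)" "d2 = dig (inv (letter_val G l))"
        using l(1) unfolding set_ls Ls_def by auto
      have "(i, letter_val G l, Suc i) \<in> graph x"
        "(length x + 2 + i, inv (letter_val G l), length x + 1 + i) \<in> graph x"
        using letter(1) l(2) unfolding graph_def by blast+
      then show ?thesis using l(3) dv_dig[OF Dl(1)[OF l']] dv_dig[OF Dl(2)[OF l']]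
          dig_less[OF Dl(1)[OF l']] dig_less[OF Dl(2)[OF l']] by (auto simp: d)
    next
      case last
      then show ?thesis using dv_dig[OF one] dig_less[OF one] unfolding graph_def by simp
    qed
  qed
  have graph_edges: "(u, dig g, v) \<in> edges x"
    if x: "x \<in> lists (ssp_alphabet X)" and e: "(u, g, v) \<in> graph x" for x u g v
    using e
  proof (cases rule: graph_cases)
    case (letter l)
    have "(l, dig (letter_val G l), dig (inv (letter_val G l))) \<in> set ls"
      unfolding set_ls Ls_def using letter_in[OF x letter(1,2)] by blast
    then have "(u, dig g, v) \<in> letter_edges x u"
      unfolding letter_edges_def by (rule UN_I) (use letter in simp)
    then show ?thesis unfolding edges_def using letter(1) by blast
  next
    case (inverse i l)
    have "(l, dig (letter_val G l), dig (inv (letter_val G l))) \<in> set ls"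
      unfolding set_ls Ls_def using letter_in[OF x inverse(1,2)] by blast
    then have "(u, dig g, v) \<in> letter_edges x i"
      unfolding letter_edges_def by (rule UN_I) (use inverse in simp)
    then show ?thesis unfolding edges_def using inverse(1) by blast
  next
    case separator
    then show ?thesis by (auto simp: edges_def separator_edges_def)
  next
    case (skip i)
    then show ?thesis by (auto simp: edges_def separator_edges_def)
  next
    case last
    then show ?thesis by (auto simp: edges_def)
  qed

  have SSP_sub: "SSP G X \<subseteq> lists (ssp_alphabet X)"
  proof
    fix x assume "x \<in> SSP G X"
    then obtain us u where x: "x = encode_tuple (us @ [u])" "us \<in> lists (words X)" "u \<in> words X"
      unfolding SSP_def by blast
    then have e: "x = encode_tuple us @ map Some u @ [None]" by simp
    have "[None] \<in> lists (ssp_alphabet X)" by (simp add: ssp_alphabet_def)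
    then show "x \<in> lists (ssp_alphabet X)" unfolding e words_encode_tuple using x(2,3) by blast
  qed

  obtain q :: "nat poly" where q: "\<forall>n. program_cost n \<le> poly q n"
    using poly_bounded_program_cost unfolding poly_bounded_def by blast
  show ?thesis
  proof (rule class_P_com[of _ _ program q])
    show "finite (ssp_alphabet X)" using X(1) by (simp add: ssp_alphabet_def)
    show "SSP G X \<subseteq> lists (ssp_alphabet X)" by (rule SSP_sub)
    fix x assume x: "x \<in> lists (ssp_alphabet X)"
    define n where "n = length x"
    \<comment> \<open>For nonempty input the nodes of the graph lie below \<open>M\<close>; the same
      number is the offset of the leading part.\<close>
    define M where "M = 2 * n + 2"
    define V where "V = M ^ p"
    \<comment> \<open>The empty input is rejected whatever the array contains, so
      \<open>UNIV\<close> serves there as a closed relation, whereas the bound on the nodes needs a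
      nonempty input.\<close>
    define W where "W = (if 0 < n then sound_pairs (graph x) dv M B else UNIV)"
    have \<Gamma>: "graph x \<subseteq> UNIV \<times> carrier G \<times> UNIV" using graph_sub[OF x] by auto
    have node: "u < M \<and> v < M \<and> rank x u < rank x v" if "(u, g, v) \<in> graph x" "0 < n" for u g v
      using graph_rank[OF that(1)] that(2) by (simp add: n_def M_def)
    have "rules_closed M B ds ts UNIV (sound_pairs (graph x) dv M B)"
    proof (rule closed_sound_pairs[OF \<Gamma> dv])
      show "0 < M" "2 \<le> B" using B by (auto simp: M_def)
      show "set ds \<subseteq> {..<B}" using dig_less by (auto simp: set_ds)
      show "a < B \<and> b < B \<and> c < B \<and> dv a \<otimes> dv b = dv c" if "(a, b, c) \<in> set ts" for a b c
        using that dig_less dv_dig unfolding set_ts T_def by auto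
    qed
    then have W1: "rules_closed M B ds ts UNIV W" by (auto simp: W_def rules_closed_def)
    have W2: "enc M ` edges x \<subseteq> W"
    proof (cases "0 < n")
      case True
      show ?thesis
      proof
        fix y assume "y \<in> enc M ` edges x"
        then obtain u d v where y: "(u, d, v) \<in> edges x" "y = ((M + u) * B + d, M + v)"
          by (auto simp: enc_def)
        have e: "(u, dv d, v) \<in> graph x" "d < B" using edges_graph[OF x y(1)] by auto
        show "y \<in> W"
          using sound_pairs_edge[of u dv d v, OF e(1) dv _ _ B(1) e(2)] node[OF e(1) True] y(2) True
          by (simp add: W_def)
      qed
    qed (simp add: W_def)
    have "ok x program (program_cost n) (\<lambda>_. 0, {}) (\<lambda>(R, A). pairs A \<subseteq> W \<and>
      (\<exists>Z\<subseteq>pairs A. rules_closed M B ds ts {..<V} Z \<and> enc M ` edges x \<inter> {..<V} \<times> {..<V} \<subseteq> Z) \<and>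
      (0 < R 0 \<longleftrightarrow> 0 < n \<and> block_start x n = n \<and> (M, M + (n + 1 + prev_start x n)) \<in> pairs A))"
      by (rule ok_program[OF n_def M_def V_def W1 W2])
    then obtain R A t Z where run: "exec x program (\<lambda>_. 0, {}) t (R, A)" "t \<le> program_cost n"
      "pairs A \<subseteq> W" "Z \<subseteq> pairs A" "rules_closed M B ds ts {..<V} Z" "enc M ` edges x \<inter> {..<V} \<times> {..<V} \<subseteq> Z"
      "0 < R 0 \<longleftrightarrow> 0 < n \<and> block_start x n = n \<and> (M, M + (n + 1 + prev_start x n)) \<in> pairs A"
      unfolding ok_def split_paired_Ex prod.case by (elim exE conjE) (rule that)
    have "0 < R 0 \<longleftrightarrow> x \<in> SSP G X"
    proof
      assume "0 < R 0"
      then have acc: "0 < n" "block_start x n = n" "(M + 0, M + (n + 1 + prev_start x n)) \<in> W"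
        using run(3,7) by auto
      have "gpath G (graph x) 0 \<one> (n + 1 + prev_start x n)"
      proof (rule sound_pairs_base[OF _ _ _ B(1)])
        show "(M + 0, M + (n + 1 + prev_start x n)) \<in> sound_pairs (graph x) dv M B"
          using acc(1,3) by (simp add: W_def)
        show "0 < M" "n + 1 + prev_start x n < M" using prev_start_le[of x n] by (simp_all add: M_def)
      qed
      then show "x \<in> SSP G X" using SSP_if_gpath[OF X(2) x] acc(1,2) by (simp add: n_def)
    next
      assume "x \<in> SSP G X"
      note s = gpath_if_SSP[OF X(2) this, folded n_def]
      obtain m node' P where nP: "node' 0 = 0" "node' m = n + 1 + prev_start x n" "P 0 = \<one>" "P m = \<one>"
        "\<forall>k\<le>m. P k \<in> carrier G"
        "\<forall>k<m. (node' k, inv (P k) \<otimes> P (Suc k), node' (Suc k)) \<in> graph x"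
        using gpath_nodes[OF s(3) \<Gamma>] by blast
      \<comment> \<open>The rank grows along every edge, so \<open>m\<close> steps force a rank of
        at least \<open>m\<close>, and hence \<open>m + 1 \<le> M\<close>.\<close>
      have rk: "k \<le> rank x (node' k)" if "k \<le> m" for k
        using that
      proof (induction k)
        case (Suc k)
        then have "(node' k, inv (P k) \<otimes> P (Suc k), node' (Suc k)) \<in> graph x" using nP(6) by simp
        from node[OF this s(1)] show ?case using Suc by linarith
      qed simp
      have m: "0 < m" using nP(1,2) by (cases m) auto
      have "m + 1 \<le> M" using rk[of m] by (auto simp: rank_def M_def n_def split: if_splits)
      \<comment> \<open>Large enough for the tree approximation of the path, small enough to keep
        the words polynomial in number.\<close>
      obtain k where k: "M\<^sup>2 \<le> 2 ^ k" "2 ^ k \<le> 2 * M\<^sup>2" using ex_log[of "M\<^sup>2"] by (auto simp: M_def)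
      \<comment> \<open>\<open>Z\<close> takes the part of \<open>C\<close>: it is closed below
        \<open>V\<close>, which the array as a whole need not be.\<close>
      interpret closure_system G len \<Delta> L dig B M V Z by unfold_locales (rule L B)+
      have digits: "digits = D" by (simp add: digits_def D_def)
      note Z = run(5)[unfolded rules_closed_def]
      have closed: closed_system
        unfolding closed_system_def digits
      proof (intro conjI allI impI)
        show "(s, t) \<in> Z" if "(s, u) \<in> Z" "(u, t) \<in> Z" "s < V" "u < V" "t < V" for s u t
          using conjunct1[OF Z] that by blast
        show "(s, t) \<in> Z \<longleftrightarrow> (app s a, app t a) \<in> Z"
          if "M \<le> s" "M \<le> t" "a \<in> D" "app s a < V" "app t a < V" for s t a
        proof -
          have "s < V" "t < V" using that app_ge[of s a] app_ge[of t a] by simp_all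
          moreover have "dig a \<in> set ds" using that(3) set_ds by simp
          ultimately show ?thesis
            using conjunct1[OF conjunct2[OF Z], rule_format, of "dig a" s t] that by (simp add: app_def)
        qed
        fix s a b
        assume a: "M \<le> s" "s < V" "a \<in> D" "b \<in> D" "a \<otimes> b \<in> D" "app (app s a) b < V" "app s (a \<otimes> b) < V"
        have "(dig a, dig b, dig (a \<otimes> b)) \<in> set ts" unfolding set_ts T_def using a(3-5) by force
        from bspec[OF conjunct2[OF conjunct2[OF Z]] this]
        show "(app (app s a) b, app s (a \<otimes> b)) \<in> Z" "(app s (a \<otimes> b), app (app s a) b) \<in> Z"
          using a(1,2,6,7) by (simp_all add: app_def)
      qed
      have node_less: "node' i < M" if "i \<le> m" for i
      proof (cases "i < m")
        case True
        then show ?thesis using node[of "node' i" _ "node' (Suc i)"] nP(6) s(1) by blast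
      next
        case False
        then show ?thesis using that nP(2) prev_start_le[of x n] by (simp add: M_def)
      qed
      have room: "room (M + node' i) (L * (2 * (2 * L + k * \<Delta>) + 2) + 6)" if "i \<le> m" for i
      proof (rule roomI)
        have "L * (2 * (2 * L + k * \<Delta>) + 2) + 6 = a0 + b0 * k"
          by (simp add: a0_def b0_def algebra_simps)
        then show "2 * M * B ^ (L * (2 * (2 * L + k * \<Delta>) + 2) + 6) \<le> V"
          using power_log_bound[of M k B a0 b0] k(2) by (simp add: V_def p_def M_def)
      qed (use dig_less digits node_less[OF that] in auto)
      have step: "inv (P i) \<otimes> P (Suc i) \<in> {g \<in> carrier G. len g \<le> L}" if "i < m" for i
        using nP(6) that graph_sub[OF x] by blast
      have "(M + node' 0, M + node' m) \<in> Z"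
      proof (rule closed_path[OF closed, where P = P and k = k])
        show "P i \<in> carrier G" if "i \<le> m" for i using nP(5) that by simp
        show "P 0 = P m" "0 < m" using nP(3,4) m by simp_all
        show "dist (P i) (P (Suc i)) \<le> L" if "i < m" for i using step[OF that] by (simp add: dist_def)
        have "(m + 1)\<^sup>2 \<le> M\<^sup>2" using \<open>m + 1 \<le> M\<close> by (rule power_mono) simp
        then show "(m + 1)\<^sup>2 \<le> 2 ^ k" using k(1) by linarith
        show "room (M + node' i) (L * (2 * (2 * L + k * \<Delta>) + 2) + 6)" if "i \<le> m" for i
          by (rule room[OF that])
        fix i assume i: "i < m"
        let ?g = "inv (P i) \<otimes> P (Suc i)"
        have "(node' i, dig ?g, node' (Suc i)) \<in> edges x" using graph_edges[OF x] nP(6) i by blast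
        then have "enc M (node' i, dig ?g, node' (Suc i)) \<in> enc M ` edges x" by (rule imageI)
        then have e: "(app (M + node' i) ?g, M + node' (Suc i)) \<in> enc M ` edges x"
          by (simp add: enc_def app_def)
        have "?g \<in> digits" using step[OF i] short_digit by blast
        then have "app (M + node' i) ?g < V"
          using room_less[OF room_app[OF room[of i], of ?g 0]] i by simp
        moreover have "M + node' (Suc i) < V" using room_less[OF room[of "Suc i"]] i by simp
        ultimately show "(app (M + node' i) ?g, M + node' (Suc i)) \<in> Z" using run(6) e by blast
      qed
      then show "0 < R 0" using run(4,7) s(1,2) nP(1,2) by auto
    qed
    then show "\<exists>t R B. exec x program (\<lambda>_. 0, {}) t (R, B) \<and> t \<le> poly q (length x) \<and> (0 < R 0 \<longleftrightarrow> x \<in> SSP G X)"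
      using run(1,2) q n_def by (metis le_trans)
  qed
qed

end

theorem theorem5p8:
  fixes G :: "('a, 'm) monoid_scheme" and X :: "'a set"
  assumes "hyperbolic_group G"
    and "finite_generating_set G X"
  shows "SSP G X \<in> class_P (ssp_alphabet X)"
  using assms group.SSP_in_class_P unfolding hyperbolic_group_def by blast

end
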